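(* Let $\gamma\subset\mathbf{R}^2$ be a $C^2$-smooth, centrally symmetric, simple closed convex curve of positive curvature whose billiard map $T:\mathbf{A}\to\mathbf{A}$ has a continuous rotational invariant curve $\alpha\subset\mathbf{A}$ of rotation number $1/4$ consisting of $4$-periodic orbits. Let $\bar\alpha$ be the corresponding invariant curve of rotation number $3/4$, let $\mathcal{B}\subset\mathbf{A}$ be the domain between $\alpha$ and $\bar\alpha$, and let $\mathcal{M}_{\mathcal{B}}\subset\mathcal{B}$ be the set of points of $\mathcal{B}$ lying on locally maximizing orbits. Then $\mathcal{M}_{\mathcal{B}}=\mathcal{B}$ if and only if $\gamma$ is a circle.
   Context: Fix the counterclockwise orientation on $\gamma$ and let $s$ be the arclength parameter. The phase cylinder $\mathbf{A}$ is the space of all oriented lines intersecting (the interior of the domain bounded by) $\gamma$. An oriented line is given coordinates $(\cos\delta,s)$, $\delta\in(0,\pi)$, where $\gamma(s)$ is the point at which the line enters the domain and $\delta$ is the angle between the line and the tangent vector $\gamma'(s)$. The billiard map $T:\mathbf{A}\to\mathbf{A}$ sends an oriented line to the line obtained by reflecting it in $\gamma$ (angle of incidence equals angle of reflection) at the point where it exits the domain. An invariant curve is called rotational if it is a simple closed curve winding once around the cylinder $\mathbf{A}$. If $\alpha$ is the invariant curve of rotation number $1/4$ consisting of $4$-periodic orbits, then $\bar\alpha$ is the invariant curve of rotation number $3/4$ consisting of the same lines with reversed orientation. $\mathcal{B}$ is the (closed) region of $\mathbf{A}$ bounded by $\alpha$ and $\bar\alpha$. Locally maximizing orbits: let $L(s,s_1)=|\gamma(s)-\gamma(s_1)|$.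 For an orbit of $T$, let $\{s_n\}_{n\in\mathbf{Z}}$ be the sequence of parameters of the successive reflection points (the configuration). The configuration is locally maximizing if for any integers $M<N$ the finite segment $(s_M,\dots,s_N)$ gives a local maximum of the functional $\sum_{n=M}^{N-1}L(s_n,s_{n+1})$ among segments with the same end-points $s_M,s_N$. The corresponding orbit in $\mathbf{A}$ is called locally maximizing (an m-orbit). $\mathcal{M}\subset\mathbf{A}$ is the set swept by all m-orbits, and $\mathcal{M}_{\mathcal{B}}:=\mathcal{M}\cap\mathcal{B}$. *)

theory Defs
  imports "HOL-Complex_Analysis.Complex_Analysis"
begin

text \<open>The Euclidean plane is \<^typ>\<open>complex\<close>, with inner product \<open>\<bullet>\<close>. A closed curve of length \<open>l\<close>
  is an \<open>l\<close>-periodic map on the real line, the parameter being arclength.\<close>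

definition velocity :: "(real \<Rightarrow> complex) \<Rightarrow> real \<Rightarrow> complex"
  where "velocity \<gamma> s = vector_derivative \<gamma> (at s)"

definition acceleration :: "(real \<Rightarrow> complex) \<Rightarrow> real \<Rightarrow> complex"
  where "acceleration \<gamma> s = vector_derivative (velocity \<gamma>) (at s)"

text \<open>For an arclength parameter the signed curvature is \<open>det (\<gamma>', \<gamma>'')\<close>; note that
  \<open>Im (cnj v * w)\<close> is the determinant of the plane vectors \<open>v\<close>, \<open>w\<close>.\<close>

definition signed_curvature :: "(real \<Rightarrow> complex) \<Rightarrow> real \<Rightarrow> real"
  where "signed_curvature \<gamma> s = Im (cnj (velocity \<gamma> s) * acceleration \<gamma> s)"

definition C2_curve :: "(real \<Rightarrow> complex) \<Rightarrow> bool"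
  where "C2_curve \<gamma> \<longleftrightarrow>
    (\<forall>s. \<gamma> differentiable (at s)) \<and> (\<forall>s. velocity \<gamma> differentiable (at s)) \<and>
    continuous_on UNIV (acceleration \<gamma>)"

text \<open>The winding number condition fixes the counterclockwise orientation.\<close>

definition convex_billiard_table :: "(real \<Rightarrow> complex) \<Rightarrow> real \<Rightarrow> bool"
  where "convex_billiard_table \<gamma> l \<longleftrightarrow>
    l > 0 \<and> (\<forall>s. \<gamma> (s + l) = \<gamma> s) \<and> simple_path (\<lambda>t. \<gamma> (l * t)) \<and>
    C2_curve \<gamma> \<and> (\<forall>s. norm (velocity \<gamma> s) = 1) \<and>
    (\<forall>z \<in> inside (range \<gamma>). winding_number (\<lambda>t. \<gamma> (l * t)) z = 1) \<and>
    convex (inside (range \<gamma>)) \<and>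
    (\<forall>s. signed_curvature \<gamma> s > 0)"

definition centrally_symmetric :: "complex set \<Rightarrow> bool"
  where "centrally_symmetric S \<longleftrightarrow> (\<exists>c. (\<lambda>p. 2 * c - p) ` S = S)"

definition is_circle :: "complex set \<Rightarrow> bool"
  where "is_circle S \<longleftrightarrow> (\<exists>c r. r > 0 \<and> S = sphere c r)"

text \<open>An oriented line meeting the interior is recorded as \<open>(x, u)\<close>, where \<open>x\<close> is the point at
  which it enters the domain and \<open>u\<close> its unit direction. The coordinates \<open>(cos \<delta>, s)\<close> of this line
  are given by \<open>x = \<gamma> s\<close> and \<open>u = \<gamma>' s * cis \<delta>\<close>, so that \<open>cos \<delta> = u \<bullet> \<gamma>' s\<close>. This
  correspondence is a homeomorphism between the cylinder of coordinates (with \<open>s\<close> modulo the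
  length of the curve and \<open>0 < \<delta> < pi\<close>) and the subspace of pairs below.\<close>

type_synonym oriented_line = "complex \<times> complex"

definition phase_cylinder :: "(real \<Rightarrow> complex) \<Rightarrow> oriented_line set"
  where "phase_cylinder \<gamma> =
    {(x, u). x \<in> range \<gamma> \<and> norm u = 1 \<and> (\<exists>t>0. x + t *\<^sub>R u \<in> inside (range \<gamma>))}"

text \<open>The exit point of a line in the phase cylinder is unique, hence its parameter is unique up to
  multiples of the length; the choice does not matter below.\<close>

definition exit_param :: "(real \<Rightarrow> complex) \<Rightarrow> oriented_line \<Rightarrow> real"
  where "exit_param \<gamma> = (\<lambda>(x, u). SOME s. \<exists>t>0. \<gamma> s = x + t *\<^sub>R u)"

definition reflect :: "complex \<Rightarrow> complex \<Rightarrow> complex"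
  where "reflect \<tau> u = (2 * (u \<bullet> \<tau>)) *\<^sub>R \<tau> - u"

definition billiard_map :: "(real \<Rightarrow> complex) \<Rightarrow> oriented_line \<Rightarrow> oriented_line"
  where "billiard_map \<gamma> = (\<lambda>(x, u).
    let s = exit_param \<gamma> (x, u) in (\<gamma> s, reflect (velocity \<gamma> s) u))"

definition reverse_line :: "(real \<Rightarrow> complex) \<Rightarrow> oriented_line \<Rightarrow> oriented_line"
  where "reverse_line \<gamma> = (\<lambda>(x, u). (\<gamma> (exit_param \<gamma> (x, u)), - u))"

text \<open>The projection \<open>(x, u) \<mapsto> x\<close> maps the cylinder onto its base circle \<open>\<gamma>\<close>, so the number of
  times a loop goes around the cylinder is the winding number of its projection about the interior
  points of \<open>\<gamma>\<close>. Since only the image counts, the loop may be taken to run in the positive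
  direction.\<close>

definition rotational_curve :: "(real \<Rightarrow> complex) \<Rightarrow> oriented_line set \<Rightarrow> bool"
  where "rotational_curve \<gamma> \<alpha> \<longleftrightarrow> \<alpha> \<subseteq> phase_cylinder \<gamma> \<and>
    (\<exists>c. simple_path c \<and> pathfinish c = pathstart c \<and> path_image c = \<alpha> \<and>
      (\<forall>z \<in> inside (range \<gamma>). winding_number (fst \<circ> c) z = 1))"

definition invariant_curve :: "(real \<Rightarrow> complex) \<Rightarrow> oriented_line set \<Rightarrow> bool"
  where "invariant_curve \<gamma> \<alpha> \<longleftrightarrow> rotational_curve \<gamma> \<alpha> \<and> billiard_map \<gamma> ` \<alpha> = \<alpha>"

text \<open>The sequence \<open>s\<close> is the lift of the successive reflection points to the real line that
  advances by an amount strictly between \<open>0\<close> and \<open>l\<close> at each step.\<close>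

definition orbit_has_rotation_number ::
    "(real \<Rightarrow> complex) \<Rightarrow> real \<Rightarrow> oriented_line \<Rightarrow> real \<Rightarrow> bool"
  where "orbit_has_rotation_number \<gamma> l p \<rho> \<longleftrightarrow>
    (\<exists>s :: nat \<Rightarrow> real.
      (\<forall>n. \<gamma> (s n) = fst ((billiard_map \<gamma> ^^ n) p) \<and> s n < s (Suc n) \<and> s (Suc n) < s n + l) \<and>
      (\<lambda>n. (s n - s 0) / (real n * l)) \<longlonglongrightarrow> \<rho>)"

definition curve_has_rotation_number ::
    "(real \<Rightarrow> complex) \<Rightarrow> real \<Rightarrow> oriented_line set \<Rightarrow> real \<Rightarrow> bool"
  where "curve_has_rotation_number \<gamma> l \<alpha> \<rho> \<longleftrightarrow> (\<forall>p\<in>\<alpha>. orbit_has_rotation_number \<gamma> l p \<rho>)"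

text \<open>The closed region of \<open>X\<close> bounded by \<open>\<alpha>\<close> and \<open>\<beta>\<close>. For two disjoint rotational curves in the
  cylinder, exactly one of the three components of the complement has relative frontier
  \<open>\<alpha> \<union> \<beta>\<close>.\<close>

definition region_bounded_by :: "'a::topological_space set \<Rightarrow> 'a set \<Rightarrow> 'a set \<Rightarrow> 'a set"
  where "region_bounded_by X \<alpha> \<beta> =
    \<Union> {top_of_set X closure_of C | C.
        C \<in> components (X - (\<alpha> \<union> \<beta>)) \<and> top_of_set X frontier_of C = \<alpha> \<union> \<beta>}"

definition billiard_orbit :: "(real \<Rightarrow> complex) \<Rightarrow> (int \<Rightarrow> oriented_line) \<Rightarrow> bool"
  where "billiard_orbit \<gamma> P \<longleftrightarrow>
    (\<forall>n. P n \<in> phase_cylinder \<gamma> \<and> P (n + 1) = billiard_map \<gamma> (P n))"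

definition chord_length :: "(real \<Rightarrow> complex) \<Rightarrow> real \<Rightarrow> real \<Rightarrow> real"
  where "chord_length \<gamma> s s' = norm (\<gamma> s - \<gamma> s')"

definition locally_maximizing :: "(real \<Rightarrow> complex) \<Rightarrow> (int \<Rightarrow> real) \<Rightarrow> bool"
  where "locally_maximizing \<gamma> s \<longleftrightarrow>
    (\<forall>M N. M < N \<longrightarrow>
      (\<exists>\<epsilon>>0. \<forall>r :: int \<Rightarrow> real.
        r M = s M \<and> r N = s N \<and> (\<forall>n\<in>{M..N}. \<bar>r n - s n\<bar> < \<epsilon>) \<longrightarrow>
        (\<Sum>n=M..N-1. chord_length \<gamma> (r n) (r (n + 1)))
          \<le> (\<Sum>n=M..N-1. chord_length \<gamma> (s n) (s (n + 1)))))"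

text \<open>Whether the configuration of an orbit is locally maximizing does not depend on which of the
  parameters modulo the length is used for each reflection point.\<close>

definition m_orbit :: "(real \<Rightarrow> complex) \<Rightarrow> (int \<Rightarrow> oriented_line) \<Rightarrow> bool"
  where "m_orbit \<gamma> P \<longleftrightarrow> billiard_orbit \<gamma> P \<and>
    (\<exists>s. (\<forall>n. \<gamma> (s n) = fst (P n)) \<and> locally_maximizing \<gamma> s)"

definition m_orbit_set :: "(real \<Rightarrow> complex) \<Rightarrow> oriented_line set"
  where "m_orbit_set \<gamma> = \<Union> {range P | P. m_orbit \<gamma> P}"

end

theory Submission
  imports Defs
begin

text \<open>Put the centre of symmetry at the origin and subtract the half turn from successive reflection
  parameters. A trajectory becomes a sequence \<open>y\<close> that is critical for the sum of
  \<open>G (y n) (y (n + 1))\<close>, where \<open>G a b = |g a + g b|\<close> is symmetric and has the twist property, and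
  the constant sequences at the critical points of \<open>|g|\<close> are the orbits along diameters.

  If \<open>|g|\<close> is not constant, let \<open>q\<close> be a minimum and \<open>m\<close> a maximum with
  \<open>q < m < q + l / 2\<close>. No line of \<open>\<alpha>\<close> passes through the centre, so \<open>\<alpha>\<close> lies on one side of the curve of
  lines through the centre and the reversed curve on the other. Moving up from the diameter at \<open>q\<close>, one stays
  inside \<open>\<B>\<close> until the reversed curve is met, at a line whose orbit is \<open>a\<close>. If all these lines are
  on m-orbits there are no conjugate points along them, and the \<open>N\<close>-th point of the orbit is a strictly increasing
  function of the initial line; in particular none of these orbits returns to \<open>q\<close>. But for large
  \<open>N\<close> it pays to travel from \<open>q\<close> to \<open>m\<close>, stay there, and come back, so the maximizer of the
  action among sequences from \<open>q\<close> to \<open>q\<close> between the barriers \<open>q\<close> and \<open>min a m\<close> is not constant; by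
  the twist property it does not touch the barriers, and it is an orbit that returns to \<open>q\<close>.

  Conversely, on a circle \<open>G a b\<close> is a concave function of \<open>a - b\<close>, and every orbit has constant
  increments.\<close>

section \<open>Convex tables\<close>

text \<open>Central symmetry gives \<open>\<gamma> (b + l / 2) - \<gamma> a = - (g a + g b)\<close>,
  so \<open>G a b\<close> is the length of a chord. Four steps of an orbit on \<alpha> advance the
  true parameter by \<open>l\<close>, while the subtracted half turns amount to
  \<open>2 * l\<close>; hence \<open>y (n + 4) = y n - l\<close> on \<alpha> and
  \<open>a (n + 4) = a n + l\<close> on the reversed curve. The barrier \<open>a\<close> therefore
  exceeds \<open>m\<close> from index 4 on, whatever \<open>N\<close> is, so the excursion to
  \<open>m\<close> has a bounded cost and pays for large \<open>N\<close>. The returning orbit is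
  compared with the constant orbit at \<open>q\<close>, which must be interior to the family of
  initial lines: the lines just below the diameter come from openness of the component of the
  diameters. The topological obstacle is that \<B> is given by a frontier condition, so it has to be
  shown that the frontier of this component contains all of both curves. That is done in a planar
  annulus homeomorphic to the phase cylinder.\<close>

definition cross :: "complex \<Rightarrow> complex \<Rightarrow> real"
  where "cross u v = Im (cnj u * v)"

lemma cross_altdef: "cross u v = Re u * Im v - Im u * Re v"
  by (simp add: cross_def)

lemma cross_eq_inner: "cross u v = (\<i> * u) \<bullet> v"
  by (simp add: cross_altdef inner_complex_def)

interpretation cross: bounded_bilinear cross
proof -
  have "bounded_bilinear (\<lambda>u v. (\<i> * u) \<bullet> v)"
    using bounded_bilinear.comp1[OF bounded_bilinear_inner bounded_linear_mult_right] .
  then show "bounded_bilinear cross"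
    by (simp add: cross_eq_inner[abs_def])
qed

declare cross.zero_left [simp] cross.zero_right [simp]

lemma cross_self [simp]: "cross u u = 0"
  by (simp add: cross_altdef)

lemma cross_commute: "cross v u = - cross u v"
  by (simp add: cross_altdef)

lemma unit_decomposition:
  assumes "norm u = 1"
  shows "v = (u \<bullet> v) *\<^sub>R u + cross u v *\<^sub>R (\<i> * u)"
proof -
  have "(Re u)\<^sup>2 + (Im u)\<^sup>2 = 1"
    using assms by (metis cmod_power2 power_one)
  then have "Re v = Re v * ((Re u)\<^sup>2 + (Im u)\<^sup>2)" "Im v = Im v * ((Re u)\<^sup>2 + (Im u)\<^sup>2)"
    by simp_all
  then show ?thesis
    by (auto simp: complex_eq_iff inner_complex_def cross_altdef power2_eq_square algebra_simps)
qed

lemma norm_unit_decomposition: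
  assumes "norm u = 1"
  shows "(norm v)\<^sup>2 = (u \<bullet> v)\<^sup>2 + (cross u v)\<^sup>2"
proof -
  have "(Re u)\<^sup>2 + (Im u)\<^sup>2 = 1"
    using assms by (metis cmod_power2 power_one)
  then have "(norm v)\<^sup>2 = ((Re u)\<^sup>2 + (Im u)\<^sup>2) * ((Re v)\<^sup>2 + (Im v)\<^sup>2)"
    by (simp add: cmod_power2)
  then show ?thesis
    by (simp add: inner_complex_def cross_altdef power2_eq_square algebra_simps)
qed

text \<open>The norm fixes the normal component up to sign, and the sign conditions remove the
  ambiguity. Directions pointing into the table can thus be compared by their tangential
  components.\<close>

lemma unit_vector_eqI:
  assumes "norm \<tau> = 1" "norm u = 1" "norm v = 1" "\<tau> \<bullet> u = \<tau> \<bullet> v"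
    and "cross \<tau> u > 0" "cross \<tau> v > 0"
  shows "u = v"
proof -
  have "(cross \<tau> u)\<^sup>2 = (cross \<tau> v)\<^sup>2"
    using norm_unit_decomposition[OF assms(1), of u] norm_unit_decomposition[OF assms(1), of v] assms(2-4)
    by simp
  then have "cross \<tau> u = cross \<tau> v"
    using assms(5,6) by (simp add: power2_eq_iff)
  then show ?thesis
    using unit_decomposition[OF assms(1), of u] unit_decomposition[OF assms(1), of v] assms(4)
    by simp
qed

text \<open>The derivative of \<open>f'\<close> at the single point \<open>a\<close> fixes the sign
  of \<open>f'\<close> on either side of \<open>a\<close>; the mean value theorem does the
  rest.\<close>

lemma second_derivative_strict_min:
  fixes f f' :: "real \<Rightarrow> real"
  assumes "e > 0" "\<And>x. \<bar>x - a\<bar> < e \<Longrightarrow> (f has_real_derivative f' x) (at x)"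
    and "(f' has_real_derivative d) (at a)" "f' a = 0" "d > 0"
  obtains r where "r > 0" "\<And>x. 0 < \<bar>x - a\<bar> \<Longrightarrow> \<bar>x - a\<bar> < r \<Longrightarrow> f a < f x"
proof -
  obtain r1 where r1: "r1 > 0" "\<And>h. 0 < h \<Longrightarrow> h < r1 \<Longrightarrow> f' a < f' (a + h)"
    using DERIV_pos_inc_right[OF assms(3,5)] by auto
  obtain r2 where r2: "r2 > 0" "\<And>h. 0 < h \<Longrightarrow> h < r2 \<Longrightarrow> f' (a - h) < f' a"
    using DERIV_pos_inc_left[OF assms(3,5)] by auto
  define r where "r = min e (min r1 r2)"
  have "f a < f x" if "0 < \<bar>x - a\<bar>" "\<bar>x - a\<bar> < r" for x
  proof (cases "a < x")
    case True
    have "\<exists>y. a < y \<and> y < x \<and> f x - f a = (x - a) * f' y"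
      by (rule MVT2[OF True]) (use that True in \<open>auto simp: r_def intro!: assms(2)\<close>)
    then obtain y where y: "a < y" "y < x" "f x - f a = (x - a) * f' y" by auto
    have "f' y > 0"
      using r1(2)[of "y - a"] y that assms(4) by (auto simp: r_def)
    then have "(x - a) * f' y > 0" using True by simp
    then show ?thesis using y by linarith
  next
    case False
    then have "x < a" using that by auto
    then have "\<exists>y. x < y \<and> y < a \<and> f a - f x = (a - x) * f' y"
      by (rule MVT2) (use that False in \<open>auto simp: r_def intro!: assms(2)\<close>)
    then obtain y where y: "x < y" "y < a" "f a - f x = (a - x) * f' y" by auto
    have "f' y < 0"
      using r2(2)[of "a - y"] y that assms(4) by (auto simp: r_def)
    then have "(a - x) * f' y < 0" using \<open>x < a\<close> by (simp add: mult_pos_neg)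
    then show ?thesis using y by linarith
  qed
  moreover have "r > 0" using assms(1) r1 r2 by (simp add: r_def)
  ultimately show thesis using that by blast
qed

text \<open>A positive second derivative would make the local maximum a strict local minimum as
  well.\<close>

lemma second_derivative_local_max:
  fixes f f' :: "real \<Rightarrow> real"
  assumes "e > 0" "\<And>x. \<bar>x - a\<bar> < e \<Longrightarrow> (f has_real_derivative f' x) (at x)"
    and "(f' has_real_derivative d) (at a)" "\<And>x. \<bar>x - a\<bar> < e \<Longrightarrow> f x \<le> f a"
  shows "d \<le> 0"
proof (rule ccontr)
  assume "\<not> d \<le> 0"
  have "f' a = 0"
    by (rule DERIV_local_max[OF assms(2)[of a] \<open>e > 0\<close>])
      (use assms(1,4) in \<open>auto simp: abs_minus_commute\<close>)
  then obtain r where r: "r > 0" "\<And>x. 0 < \<bar>x - a\<bar> \<Longrightarrow> \<bar>x - a\<bar> < r \<Longrightarrow> f a < f x"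
    using second_derivative_strict_min[OF assms(1-3)] \<open>\<not> d \<le> 0\<close> by (metis not_le)
  define h where "h = min r e / 2"
  have "h > 0" "h < r" "h < e" using r(1) assms(1) by (auto simp: h_def)
  then show False
    using r(2)[of "a + h"] assms(4)[of "a + h"] by auto
qed

section \<open>Parametrization, tangent lines and strict convexity of the table\<close>

locale convex_table =
  fixes \<gamma> :: "real \<Rightarrow> complex" and l :: real
  assumes table: "convex_billiard_table \<gamma> l"
begin

abbreviation \<tau> :: "real \<Rightarrow> complex" where "\<tau> \<equiv> velocity \<gamma>"

abbreviation \<A> :: "oriented_line set" where "\<A> \<equiv> phase_cylinder \<gamma>"

abbreviation T :: "oriented_line \<Rightarrow> oriented_line" where "T \<equiv> billiard_map \<gamma>"

lemma l_pos: "l > 0"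
  using table by (simp add: convex_billiard_table_def)

lemma periodic: "\<gamma> (s + l) = \<gamma> s"
  using table by (simp add: convex_billiard_table_def)

lemma periodic_int: "\<gamma> (s + of_int k * l) = \<gamma> s"
proof (induction k rule: int_induct[where k = 0])
  case (step1 i)
  then show ?case using periodic[of "s + of_int i * l"] by (simp add: algebra_simps)
next
  case (step2 i)
  then show ?case using periodic[of "s + of_int (i - 1) * l"] by (simp add: algebra_simps)
qed simp

lemma has_vector_derivative: "(\<gamma> has_vector_derivative \<tau> s) (at s)"
  using table unfolding convex_billiard_table_def C2_curve_def velocity_def
  by (simp add: vector_derivative_works)

lemma velocity_has_vector_derivative: "(\<tau> has_vector_derivative acceleration \<gamma> s) (at s)"
  using table unfolding convex_billiard_table_def C2_curve_def acceleration_def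
  by (simp add: vector_derivative_works)

lemma norm_velocity: "norm (\<tau> s) = 1"
  using table by (simp add: convex_billiard_table_def)

lemma cross_velocity_acceleration: "cross (\<tau> s) (acceleration \<gamma> s) > 0"
  using table by (simp add: convex_billiard_table_def signed_curvature_def cross_def)

lemma continuous_on_gamma: "continuous_on A \<gamma>"
  using has_vector_derivative by (meson continuous_at_imp_continuous_on has_vector_derivative_continuous)

lemma continuous_on_velocity: "continuous_on A \<tau>"
  using velocity_has_vector_derivative
  by (meson continuous_at_imp_continuous_on has_vector_derivative_continuous)

lemma velocity_periodic_int: "\<tau> (s + of_int k * l) = \<tau> s"
proof -
  have "((\<lambda>x. \<gamma> (x + of_int k * l)) has_vector_derivative \<tau> (s + of_int k * l)) (at s)"
    using vector_diff_chain_at[OF has_vector_derivative_add[OF has_vector_derivative_id has_vector_derivative_const]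
        has_vector_derivative[of "s + of_int k * l"]]
    by (simp add: o_def)
  then show ?thesis
    using has_vector_derivative[of s] by (simp add: periodic_int vector_derivative_unique_at)
qed

lemma path_image_eq: "path_image (\<lambda>t. \<gamma> (l * t)) = range \<gamma>"
proof -
  have "\<gamma> s \<in> path_image (\<lambda>t. \<gamma> (l * t))" for s
  proof -
    have "\<gamma> s = \<gamma> (l * frac (s / l))"
      using periodic_int[of "l * frac (s / l)" "\<lfloor>s / l\<rfloor>"] l_pos by (simp add: frac_def algebra_simps)
    moreover have "frac (s / l) \<in> {0..1}"
      using frac_lt_1[of "s / l"] by auto
    ultimately show ?thesis unfolding path_image_def by (rule image_eqI)
  qed
  then show ?thesis by (auto simp: path_image_def)
qed

lemma simple: "simple_path (\<lambda>t. \<gamma> (l * t))"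
  using table by (simp add: convex_billiard_table_def)

lemma eq_iff: "\<gamma> s = \<gamma> t \<longleftrightarrow> (\<exists>k::int. t = s + of_int k * l)"
proof
  assume eq: "\<gamma> s = \<gamma> t"
  have *: "\<gamma> x = \<gamma> (l * frac (x / l))" for x
      using periodic_int[of "l * frac (x / l)" "\<lfloor>x / l\<rfloor>"] l_pos by (simp add: frac_def algebra_simps)
  have "\<gamma> (l * frac (s / l)) = \<gamma> (l * frac (t / l))" using eq * by metis
  moreover have "frac (x / l) \<in> {0..1}" "frac (x / l) < 1" for x
    using frac_lt_1[of "x / l"] by auto
  ultimately have "frac (s / l) = frac (t / l)"
    using simple unfolding simple_path_def loop_free_def by (metis order_less_irrefl)
  then have "t / l - s / l = of_int (\<lfloor>t / l\<rfloor> - \<lfloor>s / l\<rfloor>)" by (simp add: frac_def)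
  then have "t = s + of_int (\<lfloor>t / l\<rfloor> - \<lfloor>s / l\<rfloor>) * l" using l_pos by (simp add: field_simps)
  then show "\<exists>k::int. t = s + of_int k * l" by blast
qed (auto simp: periodic_int)

lemma eq_imp_eq: "\<gamma> s = \<gamma> t \<Longrightarrow> \<bar>s - t\<bar> < l \<Longrightarrow> s = t"
proof -
  assume "\<gamma> s = \<gamma> t" "\<bar>s - t\<bar> < l"
  then obtain k :: int where k: "t = s + of_int k * l" using eq_iff by auto
  then have "\<bar>of_int k\<bar> * l < 1 * l" using \<open>\<bar>s - t\<bar> < l\<close> l_pos by (simp add: abs_mult)
  then have "\<bar>real_of_int k\<bar> < 1" using l_pos mult_less_cancel_right_pos by blast
  then have "k = 0" by linarith
  then show "s = t" using k by simp
qed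

abbreviation K :: "complex set" where "K \<equiv> inside (range \<gamma>)"

lemma jordan: "open K" "bounded K" "K \<noteq> {}" "frontier K = range \<gamma>" "closure K = K \<union> range \<gamma>"
  "K \<inter> range \<gamma> = {}"
proof -
  have "pathfinish (\<lambda>t. \<gamma> (l * t)) = pathstart (\<lambda>t. \<gamma> (l * t))"
    using periodic[of 0] by (simp add: pathfinish_def pathstart_def)
  then have J: "K \<noteq> {} \<and> open K \<and> connected K \<and> outside (range \<gamma>) \<noteq> {} \<and>
       open (outside (range \<gamma>)) \<and> connected (outside (range \<gamma>)) \<and>
       bounded K \<and> \<not> bounded (outside (range \<gamma>)) \<and> K \<inter> outside (range \<gamma>) = {} \<and>
       K \<union> outside (range \<gamma>) = - range \<gamma> \<and> frontier K = range \<gamma> \<and>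
       frontier (outside (range \<gamma>)) = range \<gamma>"
    using Jordan_inside_outside[OF simple] path_image_eq by auto
  then show "open K" "bounded K" "K \<noteq> {}" "frontier K = range \<gamma>" by auto
  show "closure K = K \<union> range \<gamma>"
    using J closure_Un_frontier[of K] by simp
  show "K \<inter> range \<gamma> = {}" using J by auto
qed

lemma convex_K: "convex K"
  using table by (simp add: convex_billiard_table_def)

lemma gamma_in_closure: "\<gamma> s \<in> closure K"
  using jordan by auto

text \<open>The supporting line of the convex domain at a boundary point is the tangent, and positive
  curvature decides on which side of it the domain lies.\<close>

lemma support_nonneg: "cross (\<tau> s) (\<gamma> t - \<gamma> s) \<ge> 0"
proof -
  define A where "A = (\<lambda>x. x - \<gamma> s) ` K"
  have "\<gamma> s \<notin> K"
    using jordan(6) by blast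
  then have "0 \<notin> A"
    unfolding A_def by auto
  moreover have "convex A"
    unfolding A_def by (rule convex_translation_subtract[OF convex_K])
  ultimately obtain n where n: "n \<noteq> 0" "\<And>x. x \<in> A \<Longrightarrow> 0 \<le> n \<bullet> x"
    using separating_hyperplane_set_0[of A] by blast
  have "n \<bullet> \<gamma> s \<le> n \<bullet> x" if "x \<in> K" for x
    using n(2)[of "x - \<gamma> s"] that by (simp add: A_def inner_diff_right)
  then have "closure K \<subseteq> {x. n \<bullet> x \<ge> n \<bullet> \<gamma> s}"
    by (intro closure_minimal closed_halfspace_ge) blast
  then have pos: "n \<bullet> (\<gamma> r - \<gamma> s) \<ge> 0" for r
    using gamma_in_closure[of r] unfolding inner_diff_right by force
  define f where "f = (\<lambda>r. - (n \<bullet> (\<gamma> r - \<gamma> s)))"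
  have f': "(f has_real_derivative - (n \<bullet> \<tau> r)) (at r)" for r
    unfolding f_def has_real_derivative_iff_has_vector_derivative
    using has_vector_derivative_minus[OF bounded_linear.has_vector_derivative[OF bounded_linear_inner_right
      has_vector_derivative_diff[OF has_vector_derivative[of r] has_vector_derivative_const[of "\<gamma> s"]]]]
    by simp
  have f'': "((\<lambda>r. - (n \<bullet> \<tau> r)) has_real_derivative - (n \<bullet> acceleration \<gamma> r)) (at r)" for r
    unfolding has_real_derivative_iff_has_vector_derivative
    by (intro has_vector_derivative_minus bounded_linear.has_vector_derivative[OF bounded_linear_inner_right]
        velocity_has_vector_derivative)
  have fmax: "f r \<le> f s" for r using pos[of r] by (simp add: f_def)
  have "- (n \<bullet> \<tau> s) = 0"
    by (rule DERIV_local_max[OF f', of 1]) (use fmax in auto)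
  then have orth: "\<tau> s \<bullet> n = 0" by (simp add: inner_commute)
  \<comment> \<open>The second-order condition at the maximum of \<open>f\<close>: together with
    positive curvature it rules out a negative \<nu> below.\<close>
  have "- (n \<bullet> acceleration \<gamma> s) \<le> 0"
    by (rule second_derivative_local_max[of 1 s f, OF _ f' f'']) (use fmax in auto)
  define \<nu> where "\<nu> = cross (\<tau> s) n"
  have n_eq: "n = \<nu> *\<^sub>R (\<i> * \<tau> s)"
    using unit_decomposition[OF norm_velocity, of n s] orth by (simp add: \<nu>_def)
  have inner: "n \<bullet> x = \<nu> * cross (\<tau> s) x" for x
    by (simp add: n_eq cross_eq_inner)
  have "\<nu> \<noteq> 0" using n(1) n_eq by auto
  then have "\<nu> > 0"
    using \<open>- (n \<bullet> acceleration \<gamma> s) \<le> 0\<close> cross_velocity_acceleration[of s]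
    unfolding inner by (auto simp: zero_le_mult_iff)
  then show ?thesis
    using pos[of t] by (simp add: inner zero_le_mult_iff)
qed

lemma has_real_derivative_cross:
  "((\<lambda>r. cross u (\<gamma> r - a)) has_real_derivative cross u (\<tau> r)) (at r)"
  unfolding has_real_derivative_iff_has_vector_derivative
  using bounded_linear.has_vector_derivative[OF cross.bounded_linear_right
      has_vector_derivative_diff[OF has_vector_derivative[of r] has_vector_derivative_const[of a]]]
  by simp

text \<open>At any contact point \<open>r\<close> the height over the tangent line is minimal, so
  the tangent at \<open>r\<close> is parallel to \<open>\<tau> s\<close>. Positive curvature at
  \<open>r\<close> then makes the second derivative nonzero, and minimality makes it
  positive.\<close>

lemma support_zero_isolated:
  assumes "cross (\<tau> s) (\<gamma> r - \<gamma> s) = 0"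
  obtains e where "e > 0" "\<And>x. 0 < \<bar>x - r\<bar> \<Longrightarrow> \<bar>x - r\<bar> < e \<Longrightarrow> cross (\<tau> s) (\<gamma> x - \<gamma> s) > 0"
proof -
  define f where "f = (\<lambda>r. cross (\<tau> s) (\<gamma> r - \<gamma> s))"
  define f' where "f' = (\<lambda>r. cross (\<tau> s) (\<tau> r))"
  have f': "(f has_real_derivative f' x) (at x)" for x
    unfolding f_def f'_def by (rule has_real_derivative_cross)
  have f'': "(f' has_real_derivative cross (\<tau> s) (acceleration \<gamma> x)) (at x)" for x
    unfolding f'_def has_real_derivative_iff_has_vector_derivative
    by (rule bounded_linear.has_vector_derivative[OF cross.bounded_linear_right
        velocity_has_vector_derivative])
  have min: "f r \<le> f x" for x
    using support_nonneg[of s x] assms by (simp add: f_def)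
  have f'0: "f' r = 0"
    by (rule DERIV_local_min[OF f', of 1]) (use min in auto)
  have "cross (\<tau> s) (acceleration \<gamma> r) \<ge> 0"
    using second_derivative_local_max[of 1 r "\<lambda>x. - f x", OF _ DERIV_minus[OF f'] DERIV_minus[OF f'']] min
    by simp
  moreover have "cross (\<tau> s) (acceleration \<gamma> r) \<noteq> 0"
  proof -
    have "\<tau> r = (\<tau> s \<bullet> \<tau> r) *\<^sub>R \<tau> s"
      using unit_decomposition[OF norm_velocity, of "\<tau> r" s] f'0 by (simp add: f'_def)
    then have "cross (\<tau> r) (acceleration \<gamma> r) = (\<tau> s \<bullet> \<tau> r) * cross (\<tau> s) (acceleration \<gamma> r)"
      by (metis cross.scaleR_left real_scaleR_def)
    then show ?thesis using cross_velocity_acceleration[of r] by auto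
  qed
  ultimately have pos: "cross (\<tau> s) (acceleration \<gamma> r) > 0" by simp
  obtain e where "e > 0" "\<And>x. 0 < \<bar>x - r\<bar> \<Longrightarrow> \<bar>x - r\<bar> < e \<Longrightarrow> f r < f x"
    using second_derivative_strict_min[OF zero_less_one f' f'' f'0 pos] by blast
  then show thesis
    using that assms by (auto simp: f_def)
qed

text \<open>A second contact point would put a whole segment of the supporting line into the closed
  domain, hence onto the boundary. The infinitely many contact parameters in one period would
  accumulate, against isolation of contacts.\<close>

lemma support_pos:
  assumes "\<gamma> t \<noteq> \<gamma> s"
  shows "cross (\<tau> s) (\<gamma> t - \<gamma> s) > 0"
proof (rule ccontr)
  assume "\<not> cross (\<tau> s) (\<gamma> t - \<gamma> s) > 0"
  then have t0: "cross (\<tau> s) (\<gamma> t - \<gamma> s) = 0"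
    using support_nonneg[of s t] by simp
  define Z where "Z = {r \<in> {0..l}. cross (\<tau> s) (\<gamma> r - \<gamma> s) = 0}"
  \<comment> \<open>From an interior point on the wrong side, the ray pointing away from
    \<open>\<gamma> s\<close> leaves the domain at a boundary point that is still on the wrong
    side.\<close>
  have closure_pos: "cross (\<tau> s) (x - \<gamma> s) \<ge> 0" if "x \<in> closure K" for x
  proof -
    have *: "continuous_on UNIV (\<lambda>x. cross (\<tau> s) (x - \<gamma> s))"
      by (intro cross.continuous_on continuous_intros)
    have fr: "frontier K \<subseteq> {x. 0 \<le> cross (\<tau> s) (x - \<gamma> s)}"
      using jordan(4) support_nonneg by auto
    have "\<not> cross (\<tau> s) (x - \<gamma> s) < 0" if x: "x \<in> K" for x
    proof
      assume neg: "cross (\<tau> s) (x - \<gamma> s) < 0"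
      then have "x - \<gamma> s \<noteq> 0" by auto
      then obtain d where d: "d > 0" "x + d *\<^sub>R (x - \<gamma> s) \<in> frontier K"
        using ray_to_frontier[OF jordan(2), of x "x - \<gamma> s"] x jordan(1)
        by (auto simp: interior_open)
      have "cross (\<tau> s) (x + d *\<^sub>R (x - \<gamma> s) - \<gamma> s) = (1 + d) * cross (\<tau> s) (x - \<gamma> s)"
        by (simp add: cross.diff_right cross.add_right cross.scaleR_right algebra_simps)
      also have "\<dots> < 0" using neg d by (simp add: mult_pos_neg)
      finally show False using fr d(2) by force
    qed
    then show ?thesis using that fr jordan(5) jordan(4) not_less by blast
  qed
  have seg: "closed_segment (\<gamma> s) (\<gamma> t) \<subseteq> \<gamma> ` Z"
  proof
    fix x assume x: "x \<in> closed_segment (\<gamma> s) (\<gamma> t)"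
    then have "x \<in> closure K"
      using closed_segment_subset[OF gamma_in_closure gamma_in_closure convex_closure[OF convex_K]]
      by blast
    obtain u where u: "x = (1 - u) *\<^sub>R \<gamma> s + u *\<^sub>R \<gamma> t" using x by (auto simp: in_segment)
    have "x - \<gamma> s = u *\<^sub>R (\<gamma> t - \<gamma> s)" by (simp add: u algebra_simps)
    then have x0: "cross (\<tau> s) (x - \<gamma> s) = 0" by (simp add: cross.scaleR_right t0)
    have "x \<notin> K"
    proof
      assume "x \<in> K"
      then obtain e where e: "e > 0" "cball x e \<subseteq> K"
        using jordan(1) open_contains_cball by blast
      \<comment> \<open>A small step against the inner normal stays in the domain but crosses the
        supporting line.\<close>
      define y where "y = x - e *\<^sub>R (\<i> * \<tau> s)"
      have "norm (e *\<^sub>R (\<i> * \<tau> s)) = e"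
        using norm_velocity e(1) by (simp add: norm_mult)
      then have "y \<in> closure K"
        using e closure_subset by (force simp: y_def dist_norm)
      moreover have "cross (\<tau> s) (y - \<gamma> s) = - e"
      proof -
        have "y - \<gamma> s = (x - \<gamma> s) - e *\<^sub>R (\<i> * \<tau> s)" by (simp add: y_def)
        moreover have "cross (\<tau> s) (\<i> * \<tau> s) = 1"
          using norm_velocity[of s] unfolding cross_eq_inner
          by (metis mult.left_neutral norm_eq_1 norm_ii norm_mult)
        ultimately show ?thesis using x0 by (simp add: cross.diff_right cross.scaleR_right)
      qed
      ultimately show False using closure_pos[of y] e(1) by simp
    qed
    then have "x \<in> range \<gamma>" using \<open>x \<in> closure K\<close> jordan(5) by blast
    then have "x \<in> path_image (\<lambda>t. \<gamma> (l * t))" using path_image_eq by simp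
    then obtain v where v: "v \<in> {0..1}" "x = \<gamma> (l * v)" by (auto simp: path_image_def)
    then have "l * v \<in> Z" using x0 l_pos by (auto simp: Z_def mult_left_le)
    then show "x \<in> \<gamma> ` Z" using v by blast
  qed
  have "infinite (closed_segment (\<gamma> s) (\<gamma> t))" using assms by (simp add: finite_closed_segment)
  then have "infinite Z" using seg finite_surj by blast
  then obtain r where r: "r islimpt Z"
    using compact_eq_Bolzano_Weierstrass[of "{0..l}"] Z_def by (metis (no_types, lifting) compact_Icc mem_Collect_eq subsetI)
  have "closed Z"
  proof -
    have "Z = {0..l} \<inter> {r. cross (\<tau> s) (\<gamma> r - \<gamma> s) = 0}" by (auto simp: Z_def)
    moreover have "closed {r. cross (\<tau> s) (\<gamma> r - \<gamma> s) = 0}"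
      by (intro closed_Collect_eq cross.continuous_on continuous_intros continuous_on_gamma)
    ultimately show ?thesis by auto
  qed
  then have "r \<in> Z" using r closed_limpt by blast
  then obtain e where e: "e > 0" "\<And>x. 0 < \<bar>x - r\<bar> \<Longrightarrow> \<bar>x - r\<bar> < e \<Longrightarrow> cross (\<tau> s) (\<gamma> x - \<gamma> s) > 0"
    using support_zero_isolated[of s r] by (auto simp: Z_def)
  obtain x where "x \<in> Z" "x \<noteq> r" "dist x r < e"
    using r e(1) islimpt_approachable by blast
  then show False using e(2)[of x] by (auto simp: Z_def dist_real_def)
qed

text \<open>The other two points lie strictly on one side of the tangent at
  \<open>\<gamma> r\<close>, and so does every convex combination of them.\<close>

lemma not_collinear:
  assumes "\<gamma> r \<in> open_segment (\<gamma> s) (\<gamma> t)"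
  shows False
proof -
  obtain u where u: "0 < u" "u < 1" "\<gamma> r = (1 - u) *\<^sub>R \<gamma> s + u *\<^sub>R \<gamma> t"
    using assms by (auto simp: in_segment)
  have "\<gamma> s \<noteq> \<gamma> r" "\<gamma> t \<noteq> \<gamma> r" using assms by (auto simp: open_segment_def)
  then have "(1 - u) * cross (\<tau> r) (\<gamma> s - \<gamma> r) + u * cross (\<tau> r) (\<gamma> t - \<gamma> r) > 0"
    using support_pos[of s r] support_pos[of t r] u by (simp add: add_pos_pos)
  also have "(1 - u) * cross (\<tau> r) (\<gamma> s - \<gamma> r) + u * cross (\<tau> r) (\<gamma> t - \<gamma> r) =
     cross (\<tau> r) ((1 - u) *\<^sub>R \<gamma> s + u *\<^sub>R \<gamma> t - \<gamma> r)"
    by (simp add: cross.diff_right cross.add_right cross.scaleR_right algebra_simps)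
  finally show False using u(3) by simp
qed

lemma open_segment_subset_inside:
  assumes "\<gamma> s \<noteq> \<gamma> t"
  shows "open_segment (\<gamma> s) (\<gamma> t) \<subseteq> K"
proof
  fix x assume x: "x \<in> open_segment (\<gamma> s) (\<gamma> t)"
  then have "x \<in> closure K"
    using closed_segment_subset[OF gamma_in_closure gamma_in_closure convex_closure[OF convex_K]]
      open_closed_segment by blast
  moreover have "x \<notin> range \<gamma>" using not_collinear x by auto
  ultimately show "x \<in> K" using jordan(5) by blast
qed

section \<open>Chords, the phase cylinder and the billiard map\<close>

definition chord :: "real \<Rightarrow> real \<Rightarrow> oriented_line"
  where "chord s t = (\<gamma> s, sgn (\<gamma> t - \<gamma> s))"

text \<open>Otherwise one of the two further points on the ray would lie strictly between
  \<open>\<gamma> s\<close> and the other.\<close>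

lemma ray_point_unique:
  assumes "\<gamma> s \<noteq> \<gamma> t" "a > 0" "\<gamma> r = \<gamma> s + a *\<^sub>R sgn (\<gamma> t - \<gamma> s)"
  shows "\<gamma> r = \<gamma> t"
proof (rule ccontr)
  assume ne: "\<gamma> r \<noteq> \<gamma> t"
  define b where "b = a / norm (\<gamma> t - \<gamma> s)"
  have nz: "norm (\<gamma> t - \<gamma> s) > 0" using assms(1) by simp
  have b: "b > 0" "\<gamma> r = \<gamma> s + b *\<^sub>R (\<gamma> t - \<gamma> s)"
    using assms nz by (auto simp: b_def sgn_div_norm divide_inverse)
  then have "b \<noteq> 1" using ne by auto
  then consider "b < 1" | "b > 1" by linarith
  then show False
  proof cases
    case 1
    then have "\<gamma> r \<in> open_segment (\<gamma> s) (\<gamma> t)"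
      using b assms(1) by (auto simp: in_segment algebra_simps intro!: exI[of _ b])
    then show False by (rule not_collinear)
  next
    case 2
    have "\<gamma> r - \<gamma> s = b *\<^sub>R (\<gamma> t - \<gamma> s)" using b by simp
    then have "\<gamma> t - \<gamma> s = (1 / b) *\<^sub>R (\<gamma> r - \<gamma> s)" using 2 by simp
    then have "\<gamma> t = (1 - 1 / b) *\<^sub>R \<gamma> s + (1 / b) *\<^sub>R \<gamma> r"
      by (simp add: algebra_simps)
    moreover have "\<gamma> s \<noteq> \<gamma> r" using b assms(1) by auto
    ultimately have "\<gamma> t \<in> open_segment (\<gamma> s) (\<gamma> r)"
      using 2 by (auto simp: in_segment intro!: exI[of _ "1 / b"])
    then show False by (rule not_collinear)
  qed
qed

lemma chord_in_phase_cylinder: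
  assumes "\<gamma> s \<noteq> \<gamma> t"
  shows "chord s t \<in> \<A>"
proof -
  have nz: "norm (\<gamma> t - \<gamma> s) > 0" using assms by simp
  define a where "a = norm (\<gamma> t - \<gamma> s) / 2"
  have "\<gamma> s + a *\<^sub>R sgn (\<gamma> t - \<gamma> s) = midpoint (\<gamma> s) (\<gamma> t)"
    using nz by (simp add: a_def sgn_div_norm midpoint_def complex_eq_iff field_simps)
  then have "\<gamma> s + a *\<^sub>R sgn (\<gamma> t - \<gamma> s) \<in> K"
    using open_segment_subset_inside[OF assms] assms midpoint_in_open_segment[of "\<gamma> s" "\<gamma> t"] by auto
  then show ?thesis
    using nz assms by (auto simp: phase_cylinder_def chord_def norm_sgn a_def intro!: exI[of _ a])
qed

lemma lift_param:
  assumes "\<gamma> t \<noteq> \<gamma> s"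
  obtains t' where "s < t'" "t' < s + l" "\<gamma> t' = \<gamma> t"
proof -
  define k where "k = - \<lfloor>(t - s) / l\<rfloor>"
  define t' where "t' = t + of_int k * l"
  have "\<gamma> t' = \<gamma> t" by (simp add: t'_def periodic_int)
  moreover have "s \<le> t'" "t' < s + l"
  proof -
    have "of_int \<lfloor>(t - s) / l\<rfloor> * l \<le> t - s" "t - s < (of_int \<lfloor>(t - s) / l\<rfloor> + 1) * l"
      using l_pos by (simp_all flip: pos_le_divide_eq pos_divide_less_eq)
    then show "s \<le> t'" "t' < s + l" by (auto simp: t'_def k_def algebra_simps)
  qed
  moreover have "s \<noteq> t'" using assms calculation by auto
  ultimately show thesis using that by force
qed

lemma gamma_neq: "s < t \<Longrightarrow> t < s + l \<Longrightarrow> \<gamma> s \<noteq> \<gamma> t"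
  using eq_imp_eq[of s t] by auto

lemma phase_cylinder_base:
  assumes "p \<in> \<A>"
  obtains s where "fst p = \<gamma> s"
  using assms by (force simp: phase_cylinder_def)

lemma phase_cylinder_chord:
  assumes "p \<in> \<A>" "fst p = \<gamma> s"
  obtains t where "s < t" "t < s + l" "p = chord s t"
proof -
  obtain u a where u: "p = (\<gamma> s, u)" "norm u = 1" "a > 0" "\<gamma> s + a *\<^sub>R u \<in> K"
    using assms by (cases p) (auto simp: phase_cylinder_def)
  have "u \<noteq> 0" using u(2) by auto
  then obtain d where d: "d > 0" "\<gamma> s + a *\<^sub>R u + d *\<^sub>R u \<in> frontier K"
    using ray_to_frontier[OF jordan(2), of "\<gamma> s + a *\<^sub>R u" u] u jordan(1)
    by (auto simp: interior_open)
  then obtain t where t: "\<gamma> t = \<gamma> s + (a + d) *\<^sub>R u" using jordan(4) by (auto simp: algebra_simps)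
  have "a + d > 0" using u d by simp
  then have ne: "\<gamma> t \<noteq> \<gamma> s" using t \<open>u \<noteq> 0\<close> by auto
  obtain t' where t': "s < t'" "t' < s + l" "\<gamma> t' = \<gamma> t" using lift_param[OF ne] .
  have "sgn (\<gamma> t' - \<gamma> s) = u"
    using t t'(3) \<open>a + d > 0\<close> u(2) by (simp add: sgn_div_norm)
  then have "p = chord s t'" using u by (simp add: chord_def)
  then show thesis using that t' by blast
qed

lemma exit_param_chord:
  assumes "\<gamma> s \<noteq> \<gamma> t"
  shows "\<gamma> (exit_param \<gamma> (chord s t)) = \<gamma> t"
proof -
  have "\<gamma> t = \<gamma> s + norm (\<gamma> t - \<gamma> s) *\<^sub>R sgn (\<gamma> t - \<gamma> s)"
    using assms by (simp add: sgn_div_norm)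
  then have ex: "\<exists>r. \<exists>a>0. \<gamma> r = \<gamma> s + a *\<^sub>R sgn (\<gamma> t - \<gamma> s)"
    using assms by (intro exI[of _ t] exI[of _ "norm (\<gamma> t - \<gamma> s)"] conjI) auto
  show ?thesis
    using someI_ex[OF ex] ray_point_unique[OF assms] by (auto simp: exit_param_def chord_def)
qed

lemma velocity_cong: "\<gamma> s = \<gamma> t \<Longrightarrow> \<tau> s = \<tau> t"
  using eq_iff[of s t] velocity_periodic_int[of s] by auto

lemma billiard_map_chord:
  assumes "\<gamma> s \<noteq> \<gamma> t"
  shows "T (chord s t) = (\<gamma> t, reflect (\<tau> t) (sgn (\<gamma> t - \<gamma> s)))"
  using exit_param_chord[OF assms] velocity_cong[OF exit_param_chord[OF assms]]
  by (simp add: billiard_map_def chord_def Let_def)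

lemma reverse_line_chord:
  assumes "\<gamma> s \<noteq> \<gamma> t"
  shows "reverse_line \<gamma> (chord s t) = chord t s"
  using exit_param_chord[OF assms]
  by (auto simp: reverse_line_def chord_def simp flip: sgn_minus)

text \<open>Both the reflected direction and the direction of the next chord point into the table,
  so they agree once their tangential components do. The equation says that the sum of the two chord
  lengths is critical in \<open>t\<close>.\<close>

lemma billiard_map_chord_eq_iff:
  assumes "\<gamma> s \<noteq> \<gamma> t" "\<gamma> t \<noteq> \<gamma> r"
  shows "T (chord s t) = chord t r \<longleftrightarrow>
    \<tau> t \<bullet> sgn (\<gamma> t - \<gamma> s) = \<tau> t \<bullet> sgn (\<gamma> r - \<gamma> t)"
proof -
  define u where "u = sgn (\<gamma> t - \<gamma> s)"
  define v where "v = sgn (\<gamma> r - \<gamma> t)"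
  define w where "w = reflect (\<tau> t) u"
  have n: "norm u = 1" "norm v = 1" using assms by (auto simp: u_def v_def norm_sgn)
  have tt: "\<tau> t \<bullet> \<tau> t = 1" using norm_velocity norm_eq_1 by blast
  have wt: "\<tau> t \<bullet> w = \<tau> t \<bullet> u"
    by (simp add: w_def reflect_def inner_diff_right tt inner_commute)
  have wc: "cross (\<tau> t) w = - cross (\<tau> t) u"
    by (simp add: w_def reflect_def cross.diff_right cross.scaleR_right)
  have "(norm w)\<^sup>2 = 1"
    using norm_unit_decomposition[OF norm_velocity, of w t]
      norm_unit_decomposition[OF norm_velocity, of u t] n wt wc by simp
  then have nw: "norm w = 1" by (metis norm_ge_zero power2_eq_1_iff abs_norm_cancel abs_minus_cancel abs_one)
  have "- cross (\<tau> t) u = cross (\<tau> t) (\<gamma> s - \<gamma> t) / norm (\<gamma> t - \<gamma> s)"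
    by (simp add: u_def sgn_div_norm cross.scaleR_right cross.diff_right divide_inverse algebra_simps)
  then have 1: "cross (\<tau> t) w > 0"
    using support_pos[of s t] assms wc by simp
  have 2: "cross (\<tau> t) v > 0"
    using support_pos[of r t] assms by (simp add: v_def sgn_div_norm cross.scaleR_right)
  show ?thesis
    using unit_vector_eqI[OF norm_velocity nw n(2), of t] 1 2 wt
    unfolding billiard_map_chord[OF assms(1)]
    by (auto simp: chord_def w_def u_def v_def)
qed

text \<open>As a function of the third parameter the determinant has no zero before
  \<open>s + l\<close>, since three boundary points are never collinear, and it is positive just
  after \<open>t\<close> because its derivative there is positive.\<close>

lemma cross_chords_pos:
  assumes "s < t" "t < r" "r < s + l"
  shows "cross (\<gamma> t - \<gamma> s) (\<gamma> r - \<gamma> s) > 0"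
proof -
  define f where "f = (\<lambda>r. cross (\<gamma> t - \<gamma> s) (\<gamma> r - \<gamma> s))"
  have ne: "\<gamma> s \<noteq> \<gamma> t" using assms by (intro gamma_neq) auto
  have nz: "f x \<noteq> 0" if "t < x" "x < s + l" for x
  proof
    assume "f x = 0"
    have nex: "\<gamma> s \<noteq> \<gamma> x" "\<gamma> t \<noteq> \<gamma> x" using gamma_neq[of s x] gamma_neq[of t x] that assms by auto
    define u where "u = sgn (\<gamma> t - \<gamma> s)"
    have u: "norm u = 1" using ne by (simp add: u_def norm_sgn)
    have "cross u (\<gamma> x - \<gamma> s) = 0"
      using \<open>f x = 0\<close> by (simp add: u_def f_def sgn_div_norm cross.scaleR_left)
    then have eq: "\<gamma> x - \<gamma> s = (u \<bullet> (\<gamma> x - \<gamma> s)) *\<^sub>R u"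
      using unit_decomposition[OF u, of "\<gamma> x - \<gamma> s"] by simp
    define c where "c = u \<bullet> (\<gamma> x - \<gamma> s)"
    have "c \<noteq> 0" using eq nex by (auto simp: c_def)
    show False
    proof (cases "c > 0")
      case True
      then show False
        using ray_point_unique[OF ne True, of x] eq nex by (simp add: c_def u_def algebra_simps)
    next
      case False
      define d where "d = norm (\<gamma> t - \<gamma> s)"
      have "d > 0" using ne by (simp add: d_def)
      have "c < 0" using False \<open>c \<noteq> 0\<close> by simp
      have tx: "\<gamma> t = \<gamma> s + d *\<^sub>R u" "\<gamma> x = \<gamma> s + c *\<^sub>R u"
        using eq ne by (auto simp: d_def u_def c_def sgn_div_norm algebra_simps)
      \<comment> \<open>The weight at which the opposite multiples \<open>c\<close> and
        \<open>d\<close> of \<open>u\<close> cancel, so that \<open>\<gamma> s\<close> falls between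
        \<open>\<gamma> x\<close> and \<open>\<gamma> t\<close>.\<close>
      define v where "v = - c / (d - c)"
      have v: "0 < v" "v < 1" using \<open>d > 0\<close> \<open>c < 0\<close> by (auto simp: v_def field_simps)
      have "(1 - v) * c + v * d = 0"
        using \<open>d > 0\<close> \<open>c < 0\<close> by (simp add: v_def field_simps)
      then have "\<gamma> s = (1 - v) *\<^sub>R \<gamma> x + v *\<^sub>R \<gamma> t"
        unfolding tx by (simp add: algebra_simps) (metis (no_types, lifting) add.commute diff_add_cancel
          left_diff_distrib' mult.commute scaleR_add_left scaleR_collapse scaleR_zero_left add_0 mult_1)
      then have "\<gamma> s \<in> open_segment (\<gamma> x) (\<gamma> t)"
        using v nex by (auto simp: in_segment)
      then show False by (rule not_collinear)
    qed
  qed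
  have f': "(f has_real_derivative cross (\<gamma> t - \<gamma> s) (\<tau> x)) (at x)" for x
    unfolding f_def by (rule has_real_derivative_cross)
  have "cross (\<gamma> t - \<gamma> s) (\<tau> t) = cross (\<tau> t) (\<gamma> s - \<gamma> t)"
    by (simp add: cross_altdef algebra_simps)
  then have "cross (\<gamma> t - \<gamma> s) (\<tau> t) > 0" using support_pos[OF ne] by simp
  then obtain d where d: "d > 0" "\<And>h. 0 < h \<Longrightarrow> h < d \<Longrightarrow> f t < f (t + h)"
    using DERIV_pos_inc_right[OF f'] by blast
  have ft: "f t = 0" by (simp add: f_def)
  define x where "x = t + min d (r - t) / 2"
  have x: "t < x" "x < r" "x - t < d"
    using d(1) assms by (auto simp: x_def min_def field_simps)
  have fx: "f x > 0"
    using d(2)[of "x - t"] ft x by auto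
  show ?thesis
  proof (rule ccontr)
    assume "\<not> ?thesis"
    then have "f r \<le> 0" by (simp add: f_def)
    moreover have "continuous_on {x..r} f"
      unfolding f_def by (intro cross.continuous_on continuous_intros continuous_on_gamma)
    ultimately obtain y where "x \<le> y" "y \<le> r" "f y = 0"
      using IVT2'[of f r 0 x] x fx by auto
    then show False using nz[of y] x fx assms by auto
  qed
qed

text \<open>Let \<sigma> give the parameter of the opposite point in the next period. The point
  reflection is an isometry and reverses tangents, so \<sigma> has derivative 1 and is a
  translation; applied twice it is a period, and its size lies strictly between 0 and
  \<open>l\<close>.\<close>

lemma half_period:
  assumes sym: "(\<lambda>p. 2 * c - p) ` range \<gamma> = range \<gamma>"
  shows "\<gamma> (s + l / 2) = 2 * c - \<gamma> s"
proof -
  have refl: "\<exists>t. \<gamma> t = 2 * c - \<gamma> s" for s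
    using sym by (metis (mono_tags, lifting) image_iff rangeI)
  \<comment> \<open>If the centre were on the curve, the reflection in it would carry boundary
    points across the tangent at the centre.\<close>
  have ne: "2 * c - \<gamma> s \<noteq> \<gamma> s" for s
  proof
    assume eq: "2 * c - \<gamma> s = \<gamma> s"
    have "\<gamma> s \<noteq> \<gamma> (s + l / 2)" using gamma_neq[of s "s + l / 2"] l_pos by simp
    moreover obtain t where t: "\<gamma> t = 2 * c - \<gamma> (s + l / 2)" using refl by blast
    then have t': "\<gamma> t - \<gamma> s = - (\<gamma> (s + l / 2) - \<gamma> s)" using eq by (simp add: algebra_simps)
    then have "\<gamma> t \<noteq> \<gamma> s" using calculation by auto
    ultimately show False
      using support_pos[of t s] support_pos[of "s + l / 2" s] t' by (metis cross.minus_right neg_0_less_iff_less not_less_iff_gr_or_eq)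
  qed
  have "\<exists>t. s < t \<and> t < s + l \<and> \<gamma> t = 2 * c - \<gamma> s" for s
    using refl[of s] ne[of s] lift_param by metis
  then obtain \<sigma> where \<sigma>: "\<And>s. s < \<sigma> s" "\<And>s. \<sigma> s < s + l" "\<And>s. \<gamma> (\<sigma> s) = 2 * c - \<gamma> s"
    by metis
  \<comment> \<open>Were this false, a limit \<open>t\<close> of values of \<sigma> would be a
    parameter of the opposite point within distance less than \<open>l\<close> of
    \<open>\<sigma> s\<close>, forcing equality.\<close>
  have \<sigma>_cont: "isCont \<sigma> s" for s
  proof (rule ccontr)
    assume "\<not> isCont \<sigma> s"
    then obtain e where e: "e > 0" "\<And>d. d > 0 \<Longrightarrow> \<exists>x. \<bar>x - s\<bar> < d \<and> \<bar>\<sigma> x - \<sigma> s\<bar> \<ge> e"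
      unfolding continuous_at_eps_delta dist_real_def not_all not_ex not_less not_imp by (metis not_le)
    have "\<forall>n. \<exists>x. \<bar>x - s\<bar> < 1 / real (Suc n) \<and> \<bar>\<sigma> x - \<sigma> s\<bar> \<ge> e"
      using e(2) by simp
    then obtain x where x: "\<And>n. \<bar>x n - s\<bar> < 1 / real (Suc n)" "\<And>n. \<bar>\<sigma> (x n) - \<sigma> s\<bar> \<ge> e"
      by metis
    have "(\<lambda>n. x n - s) \<longlonglongrightarrow> 0"
      using x(1) by (intro Lim_null_comparison[OF _ lim_1_over_n[THEN LIMSEQ_Suc]])
        (intro always_eventually allI, use x(1) less_imp_le in \<open>metis real_norm_def\<close>)
    then have xs: "x \<longlonglongrightarrow> s" by (simp add: LIM_zero_iff)
    have "\<sigma> (x n) \<in> {s - 1..s + 1 + l}" for n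
    proof -
      have "1 / real (Suc n) \<le> 1" by simp
      then have "\<bar>x n - s\<bar> < 1" using x(1)[of n] by linarith
      then show ?thesis using \<sigma>(1,2)[of "x n"] unfolding atLeastAtMost_iff by linarith
    qed
    then obtain t r where t: "strict_mono (r :: nat \<Rightarrow> nat)" "((\<lambda>n. \<sigma> (x n)) \<circ> r) \<longlonglongrightarrow> t"
      using compact_Icc[of "s - 1" "s + 1 + l"] unfolding compact_def by metis
    have xr: "(\<lambda>n. x (r n)) \<longlonglongrightarrow> s" using LIMSEQ_subseq_LIMSEQ[OF xs t(1)] by (simp add: o_def)
    have tr: "(\<lambda>n. \<sigma> (x (r n))) \<longlonglongrightarrow> t" using t(2) by (simp add: o_def)
    have cont: "isCont \<gamma> z" for z using has_vector_derivative has_vector_derivative_continuous by blast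
    have "(\<lambda>n. \<gamma> (\<sigma> (x (r n)))) \<longlonglongrightarrow> \<gamma> t" by (rule isCont_tendsto_compose[OF cont tr])
    moreover have "(\<lambda>n. \<gamma> (\<sigma> (x (r n)))) \<longlonglongrightarrow> 2 * c - \<gamma> s"
      unfolding \<sigma>(3) by (intro tendsto_intros isCont_tendsto_compose[OF cont xr])
    ultimately have gt: "\<gamma> t = \<gamma> (\<sigma> s)" using LIMSEQ_unique \<sigma>(3) by metis
    have "s \<le> t" by (rule LIMSEQ_le[OF xr tr]) (use \<sigma>(1) less_imp_le in blast)
    moreover have "t \<le> s + l"
      by (rule LIMSEQ_le[OF tr tendsto_add[OF xr tendsto_const]]) (use \<sigma>(2) less_imp_le in blast)
    ultimately have "t = \<sigma> s" using eq_imp_eq[OF gt] \<sigma>(1,2)[of s] by auto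
    then have "(\<lambda>n. \<bar>\<sigma> (x (r n)) - \<sigma> s\<bar>) \<longlonglongrightarrow> 0"
      using tendsto_rabs_zero[OF LIM_zero[OF tr]] by simp
    then show False
      using LIMSEQ_le_const[of _ 0 e] x(2) e(1) by (meson not_le)
  qed
  \<comment> \<open>The table is its own reflection, so the height over the tangent at
    \<open>\<sigma> s\<close> is extremal at \<open>s\<close> and the tangents are parallel. Equal
    tangents would put the table on both sides of the tangent at \<open>s\<close>.\<close>
  have \<tau>_\<sigma>: "\<tau> (\<sigma> s) = - \<tau> s" for s
  proof -
    have le: "cross (\<tau> (\<sigma> s)) (\<gamma> t - \<gamma> s) \<le> 0" for t
    proof -
      have "\<gamma> (\<sigma> t) - \<gamma> (\<sigma> s) = - (\<gamma> t - \<gamma> s)" by (simp add: \<sigma>(3))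
      then show ?thesis
        using support_nonneg[of "\<sigma> s" "\<sigma> t"] by (metis cross.minus_right neg_0_le_iff_le)
    qed
    have "cross (\<tau> (\<sigma> s)) (\<tau> s) = 0"
      by (rule DERIV_local_max[OF has_real_derivative_cross[of "\<tau> (\<sigma> s)" "\<gamma> s" s], of 1]) (use le in auto)
    then have eq: "\<tau> s = (\<tau> (\<sigma> s) \<bullet> \<tau> s) *\<^sub>R \<tau> (\<sigma> s)"
      using unit_decomposition[OF norm_velocity[of "\<sigma> s"], of "\<tau> s"] by simp
    define a where "a = \<tau> (\<sigma> s) \<bullet> \<tau> s"
    have a: "\<tau> s = a *\<^sub>R \<tau> (\<sigma> s)" using eq by (simp add: a_def)
    have "\<bar>a\<bar> = 1" using arg_cong[OF a, of norm] norm_velocity by simp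
    moreover have "a \<noteq> 1"
    proof
      assume "a = 1"
      then have "\<tau> (\<sigma> s) = \<tau> s" using a by simp
      moreover have "\<gamma> s \<noteq> \<gamma> (s + l / 2)" using gamma_neq[of s "s + l / 2"] l_pos by simp
      ultimately show False using le[of "s + l / 2"] support_pos[of "s + l / 2" s] by simp
    qed
    ultimately have "a = - 1" by linarith
    then show ?thesis using a by simp
  qed
  have \<sigma>': "(\<sigma> has_real_derivative 1) (at s)" for s
  proof -
    \<comment> \<open>Projecting to the common tangent direction turns
      \<open>\<gamma> (\<sigma> z) = 2 * c - \<gamma> z\<close> into a relation between two slope
      functions with values 1 and -1 at the base point, from which the difference quotient of
      \<sigma> is solved.\<close>
    define u where "u = \<tau> (\<sigma> s)"
    have w': "((\<lambda>t. u \<bullet> \<gamma> t) has_real_derivative u \<bullet> \<tau> t) (at t)" for t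
      unfolding has_real_derivative_iff_has_vector_derivative
      by (rule bounded_linear.has_vector_derivative[OF bounded_linear_inner_right has_vector_derivative])
    obtain m where m: "\<And>z. u \<bullet> \<gamma> z - u \<bullet> \<gamma> (\<sigma> s) = m z * (z - \<sigma> s)" "isCont m (\<sigma> s)" "m (\<sigma> s) = 1"
      using w'[of "\<sigma> s"] norm_velocity[of "\<sigma> s"] unfolding CARAT_DERIV by (auto simp: u_def norm_eq_1)
    obtain n where n: "\<And>z. u \<bullet> \<gamma> z - u \<bullet> \<gamma> s = n z * (z - s)" "isCont n s" "n s = - 1"
      using w'[of s] norm_velocity[of s] \<tau>_\<sigma>[of s] unfolding CARAT_DERIV by (auto simp: u_def norm_eq_1)
    have rel: "m (\<sigma> z) * (\<sigma> z - \<sigma> s) = - n z * (z - s)" for z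
      using m(1)[of "\<sigma> z"] n(1)[of z] by (simp add: \<sigma>(3) inner_diff_right)
    have mc: "isCont (\<lambda>z. m (\<sigma> z)) s"
      using isCont_o2[OF \<sigma>_cont m(2)] .
    have nz: "eventually (\<lambda>z. m (\<sigma> z) \<noteq> 0) (at s)"
      using mc m(3) by (simp add: isCont_def tendsto_imp_eventually_ne)
    have "((\<lambda>z. - n z / m (\<sigma> z)) \<longlongrightarrow> - n s / m (\<sigma> s)) (at s)"
      using mc n(2) m(3) unfolding isCont_def by (intro tendsto_intros) auto
    moreover have "eventually (\<lambda>z. - n z / m (\<sigma> z) = (\<sigma> z - \<sigma> s) / (z - s)) (at s)"
      using nz eventually_neq_at_within[of s s UNIV]
      by eventually_elim (use rel in \<open>simp add: field_simps\<close>)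
    ultimately have "((\<lambda>z. (\<sigma> z - \<sigma> s) / (z - s)) \<longlongrightarrow> 1) (at s)"
      using n(3) m(3) by (simp add: Lim_transform_eventually)
    then show ?thesis by (simp add: has_field_derivative_iff)
  qed
  have "((\<lambda>x. \<sigma> x - x) has_real_derivative 0) (at s)" for s
    using DERIV_diff[OF \<sigma>' DERIV_ident] by simp
  then have "\<sigma> x - x = \<sigma> 0 - 0" for x
    using DERIV_isconst_all by blast
  then obtain a where a: "\<And>x. \<sigma> x = x + a" by (metis add.commute diff_add_cancel)
  have "\<gamma> (s + (a + a)) = \<gamma> s" using \<sigma>(3)[of "s + a"] \<sigma>(3)[of s] by (simp add: a add.assoc)
  then obtain k :: int where k: "s = s + (a + a) + of_int k * l" using eq_iff by metis
  have "0 < a" "a < l" using \<sigma>(1,2)[of s] a by auto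
  then have "- 2 * l < of_int k * l" "of_int k * l < 0 * l" using k by auto
  then have "- 2 < real_of_int k" "real_of_int k < 0"
    using l_pos mult_less_cancel_right_pos by blast+
  then have "k = - 1" by linarith
  then have "l / 2 = a" using k by simp
  then show ?thesis using \<sigma>(3)[of s] a by metis
qed

end

section \<open>The reduced generating function\<close>

locale symmetric_table = convex_table +
  fixes c :: complex
  assumes half: "\<gamma> (s + l / 2) = 2 * c - \<gamma> s"
begin

definition g :: "real \<Rightarrow> complex" where "g s = \<gamma> s - c"

text \<open>The length of the chord from \<open>\<gamma> a\<close> to
  \<open>\<gamma> (b + l / 2)\<close>. The shift by half a period puts the chords through the centre
  on the diagonal and makes the phase cylinder the strip where \<open>a\<close> and \<open>b\<close>
  differ by less than \<open>l / 2\<close>.\<close>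

definition G :: "real \<Rightarrow> real \<Rightarrow> real" where "G a b = norm (g a + g b)"

definition P :: "real \<Rightarrow> real \<Rightarrow> real" where "P a b = \<tau> a \<bullet> sgn (g a + g b)"

text \<open>\<open>P\<close> is the partial derivative of \<open>G\<close> in its first argument, and \<open>P1\<close>, \<open>P2\<close> are those of \<open>P\<close>.\<close>

definition P1 :: "real \<Rightarrow> real \<Rightarrow> real"
  where "P1 a b = acceleration \<gamma> a \<bullet> sgn (g a + g b) + (1 - (P a b)\<^sup>2) / G a b"

definition P2 :: "real \<Rightarrow> real \<Rightarrow> real"
  where "P2 a b = (\<tau> a \<bullet> \<tau> b - P a b * P b a) / G a b"

lemma G_commute: "G b a = G a b"
  by (simp add: G_def add.commute)

lemma P2_commute: "P2 b a = P2 a b"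
  by (simp add: P2_def G_commute inner_commute mult.commute)

lemma g_half: "g (s + l / 2) = - g s"
  by (simp add: g_def half)

lemma g_half_minus: "g (s - l / 2) = - g s"
  using g_half[of "s - l / 2"] by simp

lemma velocity_half: "\<tau> (s + l / 2) = - \<tau> s"
proof -
  have "((\<lambda>x. \<gamma> (x + l / 2)) has_vector_derivative \<tau> (s + l / 2)) (at s)"
    using vector_diff_chain_at[OF has_vector_derivative_add[OF has_vector_derivative_id has_vector_derivative_const]
        has_vector_derivative[of "s + l / 2"]]
    by (simp add: o_def)
  moreover have "((\<lambda>x. \<gamma> (x + l / 2)) has_vector_derivative - \<tau> s) (at s)"
    unfolding half using has_vector_derivative_diff[OF has_vector_derivative_const has_vector_derivative[of s]]
    by simp
  ultimately show ?thesis by (rule vector_derivative_unique_at)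
qed

lemma gamma_diff_half: "\<gamma> (b + l / 2) - \<gamma> a = - (g a + g b)"
  by (simp add: half g_def)

lemma ychord_ne:
  assumes "\<bar>a - b\<bar> < l / 2"
  shows "\<gamma> a \<noteq> \<gamma> (b + l / 2)"
proof -
  have "a < b + l / 2" "b + l / 2 < a + l" using assms by linarith+
  then show ?thesis by (rule gamma_neq)
qed

lemma g_add_nonzero:
  assumes "\<bar>a - b\<bar> < l / 2"
  shows "g a + g b \<noteq> 0"
proof
  assume "g a + g b = 0"
  then have "\<gamma> (b + l / 2) - \<gamma> a = 0" unfolding gamma_diff_half by (simp only: minus_zero)
  then show False using ychord_ne[OF assms] by simp
qed

lemma G_pos: "\<bar>a - b\<bar> < l / 2 \<Longrightarrow> G a b > 0"
  using g_add_nonzero by (simp add: G_def)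

lemma P_shift: "P (a + l / 2) (b + l / 2) = P a b"
proof -
  have "sgn (- g a - g b) = - sgn (g a + g b)" by (simp flip: sgn_minus)
  then show ?thesis by (simp add: P_def g_half velocity_half)
qed

lemma G_shift: "G (a + l / 2) (b + l / 2) = G a b"
proof -
  have "norm (- g a - g b) = norm (g a + g b)" by (metis minus_add_distrib norm_minus_cancel uminus_add_conv_diff add.commute)
  then show ?thesis by (simp add: G_def g_half)
qed

text \<open>This is the twist condition. Splitting both tangents along the chord and normal to it,
  the numerator of \<open>P2\<close> becomes the product of the two normal components, each positive
  by strict support at an end of the chord.\<close>

lemma P2_pos:
  assumes "\<bar>a - b\<bar> < l / 2"
  shows "P2 a b > 0"
proof -
  define w where "w = g a + g b"
  define u where "u = sgn w"
  have w: "w \<noteq> 0" using g_add_nonzero[OF assms] by (simp add: w_def)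
  then have u: "norm u = 1" by (simp add: u_def norm_sgn)
  have neg: "cross u (\<tau> x) > 0" if "w = g x + g y" "\<bar>x - y\<bar> < l / 2" for x y
  proof -
    have "\<gamma> (y + l / 2) \<noteq> \<gamma> x" using ychord_ne[OF that(2)] by simp
    then have "cross (\<tau> x) (- w) > 0" using support_pos[of "y + l / 2" x] gamma_diff_half[of y x] that(1) by simp
    then have "cross w (\<tau> x) > 0" by (simp add: cross_commute[of w] cross.minus_right)
    then show ?thesis using w by (simp add: u_def sgn_div_norm cross.scaleR_left)
  qed
  have "\<tau> a \<bullet> \<tau> b = (u \<bullet> \<tau> a) * (u \<bullet> \<tau> b) + cross u (\<tau> a) * cross u (\<tau> b)"
  proof -
    have 1: "u \<bullet> u = 1" using u by (simp only: norm_eq_1)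
    have 2: "(\<i> * u) \<bullet> u = 0" using cross_self[of u] by (simp only: cross_eq_inner)
    then have 3: "u \<bullet> (\<i> * u) = 0" by (simp only: inner_commute)
    have "norm (\<i> * u) = 1" using u by (simp add: norm_mult)
    then have 4: "(\<i> * u) \<bullet> (\<i> * u) = 1" by (simp only: norm_eq_1)
    have "((u \<bullet> \<tau> a) *\<^sub>R u + cross u (\<tau> a) *\<^sub>R (\<i> * u)) \<bullet> ((u \<bullet> \<tau> b) *\<^sub>R u + cross u (\<tau> b) *\<^sub>R (\<i> * u))
       = (u \<bullet> \<tau> a) * (u \<bullet> \<tau> b) + cross u (\<tau> a) * cross u (\<tau> b)"
      by (simp add: inner_add_left inner_add_right 1 2 3 4)
    then show ?thesis using unit_decomposition[OF u] by metis
  qed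
  moreover have "P a b = u \<bullet> \<tau> a" "P b a = u \<bullet> \<tau> b"
    by (simp_all add: P_def u_def w_def inner_commute add.commute)
  ultimately have "\<tau> a \<bullet> \<tau> b - P a b * P b a = cross u (\<tau> a) * cross u (\<tau> b)" by simp
  moreover have "cross u (\<tau> a) > 0" using neg[of a b] assms by (simp add: w_def)
  moreover have "cross u (\<tau> b) > 0" using neg[of b a] assms by (simp add: w_def add.commute abs_minus_commute)
  ultimately show ?thesis using G_pos[OF assms] by (simp add: P2_def)
qed

lemma g_has_vector_derivative: "(g has_vector_derivative \<tau> s) (at s)"
  unfolding g_def[abs_def] using has_vector_derivative_diff[OF has_vector_derivative has_vector_derivative_const]
  by simp

lemma curve_has_vector_derivative:
  assumes "(A has_real_derivative A') (at x)" "(B has_real_derivative B') (at x)"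
  shows "((\<lambda>x. g (A x) + g (B x)) has_vector_derivative A' *\<^sub>R \<tau> (A x) + B' *\<^sub>R \<tau> (B x)) (at x)"
proof -
  have "((g \<circ> F) has_vector_derivative F' *\<^sub>R \<tau> (F x)) (at x)"
    if "(F has_real_derivative F') (at x)" for F F'
    using vector_diff_chain_at[OF that[unfolded has_real_derivative_iff_has_vector_derivative]
        g_has_vector_derivative] .
  then show ?thesis
    using assms has_vector_derivative_add by (fastforce simp: o_def)
qed

text \<open>The arguments run along an arbitrary differentiable curve, here and for \<open>P\<close>
  below, so that partial derivatives, variations of a sequence and derivatives of a family of orbits
  are all instances.\<close>

lemma G_has_real_derivative:
  assumes "(A has_real_derivative A') (at x)" "(B has_real_derivative B') (at x)"
    and "g (A x) + g (B x) \<noteq> 0"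
  shows "((\<lambda>x. G (A x) (B x)) has_real_derivative A' * P (A x) (B x) + B' * P (B x) (A x)) (at x)"
proof -
  define w where "w = g (A x) + g (B x)"
  define V where "V = A' *\<^sub>R \<tau> (A x) + B' *\<^sub>R \<tau> (B x)"
  have "((\<lambda>x. g (A x) + g (B x)) has_derivative (\<lambda>h. h *\<^sub>R V)) (at x)"
    using curve_has_vector_derivative[OF assms(1,2)] by (simp add: has_vector_derivative_def V_def)
  moreover have "(norm has_derivative (\<lambda>h. h \<bullet> sgn w)) (at w)"
    using has_derivative_norm[of w] assms(3) by (simp add: w_def)
  ultimately have "((\<lambda>x. norm (g (A x) + g (B x))) has_derivative (\<lambda>h. (h *\<^sub>R V) \<bullet> sgn w)) (at x)"
    using diff_chain_at[of "\<lambda>x. g (A x) + g (B x)" "\<lambda>h. h *\<^sub>R V" x norm "\<lambda>h. h \<bullet> sgn w"]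
    unfolding o_def w_def by blast
  then have "((\<lambda>x. norm (g (A x) + g (B x))) has_real_derivative V \<bullet> sgn w) (at x)"
    unfolding has_field_derivative_def
    by (rule has_derivative_eq_rhs) (simp add: fun_eq_iff)
  moreover have "V \<bullet> sgn w = A' * P (A x) (B x) + B' * P (B x) (A x)"
    by (simp add: V_def w_def P_def inner_add_left add.commute)
  ultimately show ?thesis by (simp add: G_def)
qed

lemma P_has_real_derivative:
  assumes "(A has_real_derivative A') (at x)" "(B has_real_derivative B') (at x)"
    and "g (A x) + g (B x) \<noteq> 0"
  shows "((\<lambda>x. P (A x) (B x)) has_real_derivative A' * P1 (A x) (B x) + B' * P2 (A x) (B x)) (at x)"
proof -
  define W where "W = (\<lambda>x. g (A x) + g (B x))"
  define V where "V = A' *\<^sub>R \<tau> (A x) + B' *\<^sub>R \<tau> (B x)"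
  define N where "N = G (A x) (B x)"
  have N: "N > 0" using assms(3) by (simp add: N_def G_def)
  have W': "(W has_vector_derivative V) (at x)"
    using curve_has_vector_derivative[OF assms(1,2)] by (simp add: W_def V_def)
  have \<tau>': "((\<lambda>x. \<tau> (A x)) has_vector_derivative A' *\<^sub>R acceleration \<gamma> (A x)) (at x)"
    using vector_diff_chain_at[OF assms(1)[unfolded has_real_derivative_iff_has_vector_derivative]
        velocity_has_vector_derivative] by (simp add: o_def)
  have num: "((\<lambda>x. \<tau> (A x) \<bullet> W x) has_real_derivative \<tau> (A x) \<bullet> V + (A' *\<^sub>R acceleration \<gamma> (A x)) \<bullet> W x) (at x)"
    unfolding has_real_derivative_iff_has_vector_derivative
    by (rule bounded_bilinear.has_vector_derivative[OF bounded_bilinear_inner \<tau>' W'])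
  have den: "((\<lambda>x. G (A x) (B x)) has_real_derivative A' * P (A x) (B x) + B' * P (B x) (A x)) (at x)"
    by (rule G_has_real_derivative[OF assms])
  have P_eq: "P (A y) (B y) = (\<tau> (A y) \<bullet> W y) / G (A y) (B y)" for y
    by (simp add: P_def W_def G_def sgn_div_norm divide_inverse mult.commute)
  have quot: "((\<lambda>x. P (A x) (B x)) has_real_derivative
      ((\<tau> (A x) \<bullet> V + (A' *\<^sub>R acceleration \<gamma> (A x)) \<bullet> W x) * N
        - (\<tau> (A x) \<bullet> W x) * (A' * P (A x) (B x) + B' * P (B x) (A x))) / (N * N)) (at x)"
    unfolding P_eq N_def by (rule DERIV_divide[OF num den[unfolded P_eq]]) (use N in \<open>simp add: N_def\<close>)
  have 1: "\<tau> (A x) \<bullet> V = A' + B' * (\<tau> (A x) \<bullet> \<tau> (B x))"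
    using norm_velocity[of "A x"] by (simp add: V_def inner_add_right norm_eq_1)
  have 2: "\<tau> (A x) \<bullet> W x = P (A x) (B x) * N" using P_eq[of x] N by (simp add: N_def)
  have 3: "acceleration \<gamma> (A x) \<bullet> W x = (acceleration \<gamma> (A x) \<bullet> sgn (W x)) * N"
    using N by (simp add: N_def G_def W_def sgn_div_norm)
  have "((\<tau> (A x) \<bullet> V + (A' *\<^sub>R acceleration \<gamma> (A x)) \<bullet> W x) * N
        - (\<tau> (A x) \<bullet> W x) * (A' * P (A x) (B x) + B' * P (B x) (A x))) / (N * N)
      = A' * P1 (A x) (B x) + B' * P2 (A x) (B x)"
    unfolding 1 2 inner_scaleR_left 3 P1_def P2_def N_def[symmetric] W_def[symmetric]
    using N by (simp add: field_simps power2_eq_square W_def)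
  then show ?thesis using quot by simp
qed

text \<open>The integrated twist condition: a point and the value of \<open>P\<close> there
  determine the neighbour, and inequalities between neighbours can be read off from
  \<open>P\<close>.\<close>

lemma P_strict_mono:
  assumes "a - l / 2 < b" "b < b'" "b' < a + l / 2"
  shows "P a b < P a b'"
proof (rule DERIV_pos_imp_increasing[OF assms(2)])
  fix x assume "b \<le> x" "x \<le> b'"
  then have ax: "\<bar>a - x\<bar> < l / 2" using assms by linarith
  have "((\<lambda>x. P a x) has_real_derivative 0 * P1 a x + 1 * P2 a x) (at x)"
    by (rule P_has_real_derivative[of "\<lambda>_. a" 0 x "\<lambda>x. x" 1]) (use g_add_nonzero[OF ax] in auto)
  then show "\<exists>y. (P a has_real_derivative y) (at x) \<and> 0 < y"
    using P2_pos[OF ax] by auto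
qed

lemma P_less_iff:
  assumes "\<bar>a - b\<bar> < l / 2" "\<bar>a - b'\<bar> < l / 2"
  shows "P a b < P a b' \<longleftrightarrow> b < b'"
proof -
  have "a - l / 2 < b" "a - l / 2 < b'" "b < a + l / 2" "b' < a + l / 2" using assms by linarith+
  then have "b < b' \<Longrightarrow> P a b < P a b'" "b' < b \<Longrightarrow> P a b' < P a b"
    using P_strict_mono by blast+
  then show ?thesis by (metis less_asym less_irrefl linorder_neqE)
qed

lemma P_le_iff:
  assumes "\<bar>a - b\<bar> < l / 2" "\<bar>a - b'\<bar> < l / 2"
  shows "P a b \<le> P a b' \<longleftrightarrow> b \<le> b'"
  using P_less_iff[OF assms(2,1)] by linarith

lemma P_eq_iff:
  assumes "\<bar>a - b\<bar> < l / 2" "\<bar>a - b'\<bar> < l / 2"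
  shows "P a b = P a b' \<longleftrightarrow> b = b'"
  using P_less_iff[OF assms] P_less_iff[OF assms(2,1)] by (metis linorder_neqE less_irrefl)

text \<open>The line entering at \<open>\<gamma> a\<close> and leaving at the point opposite to \<open>\<gamma> b\<close>.\<close>

definition ychord :: "real \<Rightarrow> real \<Rightarrow> oriented_line"
  where "ychord a b = chord a (b + l / 2)"

lemma ychord_altdef: "ychord a b = (\<gamma> a, - sgn (g a + g b))"
  unfolding ychord_def chord_def gamma_diff_half by (simp only: sgn_minus)

lemma ychord_in_phase_cylinder: "\<bar>a - b\<bar> < l / 2 \<Longrightarrow> ychord a b \<in> \<A>"
  using chord_in_phase_cylinder ychord_ne by (simp add: ychord_def)

lemma phase_cylinder_ychord:
  assumes "p \<in> \<A>" "fst p = \<gamma> a"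
  obtains b where "\<bar>a - b\<bar> < l / 2" "p = ychord a b"
proof -
  obtain t where t: "a < t" "t < a + l" "p = chord a t" using phase_cylinder_chord[OF assms] .
  have "\<bar>a - (t - l / 2)\<bar> < l / 2" using t by linarith
  then show thesis by (rule that) (use t in \<open>simp add: ychord_def\<close>)
qed

text \<open>The sum on the right is the derivative of \<open>G a b + G b d\<close> in
  \<open>b\<close>. The next line carries the shift \<open>l / 2\<close> in both arguments because
  the present one leaves the table at \<open>\<gamma> (b + l / 2)\<close>.\<close>

lemma billiard_map_ychord_eq_iff:
  assumes "\<bar>a - b\<bar> < l / 2" "\<bar>b - d\<bar> < l / 2"
  shows "T (ychord a b) = ychord (b + l / 2) (d + l / 2) \<longleftrightarrow> P b a + P b d = 0"
proof -
  have ne: "\<gamma> (b + l / 2) \<noteq> \<gamma> (d + l / 2 + l / 2)"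
    by (rule ychord_ne) (use assms in simp)
  have 1: "sgn (\<gamma> (b + l / 2) - \<gamma> a) = - sgn (g a + g b)"
    unfolding gamma_diff_half by (simp only: sgn_minus)
  have "\<gamma> (d + l / 2 + l / 2) - \<gamma> (b + l / 2) = g b + g d"
    unfolding gamma_diff_half g_half by simp
  then have 2: "sgn (\<gamma> (d + l / 2 + l / 2) - \<gamma> (b + l / 2)) = sgn (g b + g d)" by simp
  show ?thesis
    unfolding ychord_def billiard_map_chord_eq_iff[OF ychord_ne[OF assms(1)] ne] 1 2
    by (auto simp: velocity_half P_def add.commute)
qed

lemma ychord_eq_imp:
  assumes "\<bar>a - b\<bar> < l / 2" "\<bar>a - b'\<bar> < l / 2" "ychord a b = ychord a b'"
  shows "b = b'"
proof -
  have "P a b = P a b'" using assms(3) by (simp add: P_def ychord_altdef)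
  then show ?thesis using P_eq_iff assms by simp
qed

end

section \<open>Conjugate points\<close>

text \<open>Differentiability of an implicit function, without continuity of the derivative: the graph
  is squeezed between lines along which the defining function has a derivative of known sign.\<close>

lemma implicit_has_real_derivative:
  fixes F :: "real \<Rightarrow> real \<Rightarrow> real" and z :: "real \<Rightarrow> real"
  assumes zero: "eventually (\<lambda>t. F t (z t) = 0) (nhds t0)"
    and inc: "\<And>m. eventually (\<lambda>t. (F t (z t0 + m * (t - t0)) < F t (z t) \<longleftrightarrow> z t0 + m * (t - t0) < z t)
        \<and> (F t (z t) < F t (z t0 + m * (t - t0)) \<longleftrightarrow> z t < z t0 + m * (t - t0))) (nhds t0)"
    and der: "\<And>m. ((\<lambda>t. F t (z t0 + m * (t - t0))) has_real_derivative p + m * r) (at t0)"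
    and r: "r > 0"
  shows "(z has_real_derivative - p / r) (at t0)"
proof -
  have at: "eventually Q (at t0)" if "eventually Q (nhds t0)" for Q
    using that by (auto simp: eventually_at_filter elim: eventually_mono)
  have z0: "F t0 (z t0) = 0" using zero eventually_nhds_x_imp_x by fast
  have sgn: "eventually (\<lambda>t. 0 < (t - t0) * h t) (at t0)"
    if h: "(h has_real_derivative d) (at t0)" "h t0 = 0" "d > 0" for h d
  proof -
    have "eventually (\<lambda>t. 0 < (h t - h t0) / (t - t0)) (at t0)"
      using h(1,3) order_tendstoD(1) unfolding has_field_derivative_iff by blast
    then show ?thesis
      by eventually_elim (auto simp: h(2) zero_less_divide_iff zero_less_mult_iff)
  qed
  \<comment> \<open>Along the line of slope \<open>m\<close> through the base point,
    \<open>F\<close> has derivative \<open>p + m * r\<close>, which changes sign exactly at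
    \<open>m = k\<close>. So lines of smaller and larger slope lie on opposite sides of the graph
    near \<open>t0\<close>.\<close>
  define k where "k = - p / r"
  have "((\<lambda>t. (z t - z t0) / (t - t0)) \<longlongrightarrow> k) (at t0)"
  proof (rule order_tendstoI)
    fix m assume "m < k"
    then have "- (p + m * r) > 0" using r by (simp add: k_def field_simps)
    then have "eventually (\<lambda>t. 0 < (t - t0) * - F t (z t0 + m * (t - t0))) (at t0)"
      by (intro sgn[OF DERIV_minus[OF der[of m]]]) (simp_all add: z0)
    then show "eventually (\<lambda>t. m < (z t - z t0) / (t - t0)) (at t0)"
      using eventually_neq_at_within[of t0 t0 UNIV] at[OF inc[of m]] at[OF zero]
    proof eventually_elim
      case (elim t)
      show ?case
      proof (cases "t > t0")
        case True
        then show ?thesis using elim by (auto simp: field_simps mult_less_0_iff zero_less_mult_iff)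
      next
        case False
        then show ?thesis using elim by (auto simp: field_simps mult_less_0_iff zero_less_mult_iff)
      qed
    qed
  next
    fix m assume "k < m"
    then have "p + m * r > 0" using r by (simp add: k_def field_simps)
    then have "eventually (\<lambda>t. 0 < (t - t0) * F t (z t0 + m * (t - t0))) (at t0)"
      by (intro sgn[OF der[of m]]) (simp_all add: z0)
    then show "eventually (\<lambda>t. (z t - z t0) / (t - t0) < m) (at t0)"
      using eventually_neq_at_within[of t0 t0 UNIV] at[OF inc[of m]] at[OF zero]
    proof eventually_elim
      case (elim t)
      show ?case
      proof (cases "t > t0")
        case True
        then show ?thesis using elim by (auto simp: field_simps zero_less_mult_iff)
      next
        case False
        then show ?thesis using elim by (auto simp: field_simps zero_less_mult_iff)
      qed
    qed
  qed
  then show ?thesis by (simp add: has_field_derivative_iff k_def)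
qed

context symmetric_table begin

text \<open>The discrete Euler-Lagrange equation: as \<open>G\<close> is symmetric, the derivative
  of two consecutive terms in their common variable is expressed by \<open>P\<close> alone.\<close>

definition orbit :: "(nat \<Rightarrow> real) \<Rightarrow> bool"
  where "orbit y \<longleftrightarrow> (\<forall>n. \<bar>y n - y (Suc n)\<bar> < l / 2 \<and>
    P (y (Suc n)) (y n) + P (y (Suc n)) (y (Suc (Suc n))) = 0)"

text \<open>Local maximality in reduced parameters; \<epsilon> may depend on \<open>N\<close>. The
  segments start at index 0, where the Jacobi fields used below vanish.\<close>

definition action_max :: "(nat \<Rightarrow> real) \<Rightarrow> bool"
  where "action_max y \<longleftrightarrow> (\<forall>N. \<exists>\<epsilon>>0. \<forall>r. r 0 = y 0 \<and> r N = y N \<and> (\<forall>n\<le>N. \<bar>r n - y n\<bar> < \<epsilon>) \<longrightarrow>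
    (\<Sum>n<N. G (r n) (r (Suc n))) \<le> (\<Sum>n<N. G (y n) (y (Suc n))))"

lemma orbit_step: "orbit y \<Longrightarrow> \<bar>y n - y (Suc n)\<bar> < l / 2" "orbit y \<Longrightarrow> \<bar>y (Suc n) - y n\<bar> < l / 2"
  unfolding orbit_def by (auto simp: abs_minus_commute)

lemma orbit_eq: "orbit y \<Longrightarrow> P (y (Suc n)) (y n) + P (y (Suc n)) (y (Suc (Suc n))) = 0"
  unfolding orbit_def by auto

lemma orbit_unique:
  assumes "orbit y" "orbit y'" "y 0 = y' 0" "y 1 = y' 1"
  shows "y n = y' n \<and> y (Suc n) = y' (Suc n)"
proof (induction n)
  case (Suc n)
  have "P (y (Suc n)) (y (Suc (Suc n))) = P (y (Suc n)) (y' (Suc (Suc n)))"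
    using orbit_eq[OF assms(1), of n] orbit_eq[OF assms(2), of n] Suc by simp
  then show ?case
    using P_eq_iff[of "y (Suc n)" "y (Suc (Suc n))" "y' (Suc (Suc n))"]
      orbit_step(1)[OF assms(1), of "Suc n"] orbit_step(1)[OF assms(2), of "Suc n"] Suc by simp
qed (use assms in auto)

text \<open>The sum is the second derivative at 0 of the action along
  \<open>y i + x * \<xi> i\<close>, a variation that keeps both ends fixed.\<close>

lemma second_variation:
  assumes y: "orbit y" and max: "action_max y" and "\<xi> 0 = 0" "\<xi> N = 0"
  shows "(\<Sum>i<N. P1 (y i) (y (Suc i)) * (\<xi> i)\<^sup>2 + 2 * P2 (y i) (y (Suc i)) * \<xi> i * \<xi> (Suc i)
    + P1 (y (Suc i)) (y i) * (\<xi> (Suc i))\<^sup>2) \<le> 0"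
proof -
  obtain \<epsilon> where \<epsilon>: "\<epsilon> > 0" "\<And>r. r 0 = y 0 \<Longrightarrow> r N = y N \<Longrightarrow> (\<And>n. n \<le> N \<Longrightarrow> \<bar>r n - y n\<bar> < \<epsilon>) \<Longrightarrow>
      (\<Sum>n<N. G (r n) (r (Suc n))) \<le> (\<Sum>n<N. G (y n) (y (Suc n)))"
    using max unfolding action_max_def by metis
  define Y where "Y = (\<lambda>i x. y i + x * \<xi> i)"
  have Y': "(Y i has_real_derivative \<xi> i) (at x)" for i x
    unfolding Y_def by (auto intro!: derivative_eq_intros)
  have Y0: "Y i 0 = y i" for i by (simp add: Y_def)
  have Ycont: "(Y i \<longlongrightarrow> Y i 0) (nhds 0)" for i
    unfolding Y_def by (auto intro!: tendsto_eq_intros filterlim_ident)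
  have e1: "eventually (\<lambda>x. \<forall>i\<in>{..N}. \<bar>Y i x - y i\<bar> < \<epsilon>) (nhds 0)"
  proof (intro eventually_ball_finite ballI)
    fix i
    have "((\<lambda>x. \<bar>Y i x - y i\<bar>) \<longlongrightarrow> \<bar>Y i 0 - y i\<bar>) (nhds 0)" by (intro tendsto_intros Ycont)
    then show "eventually (\<lambda>x. \<bar>Y i x - y i\<bar> < \<epsilon>) (nhds 0)"
      using \<epsilon>(1) by (intro order_tendstoD(2)) (auto simp: Y0)
  qed auto
  have e2: "eventually (\<lambda>x. \<forall>i\<in>{..<N}. \<bar>Y i x - Y (Suc i) x\<bar> < l / 2) (nhds 0)"
  proof (intro eventually_ball_finite ballI)
    fix i
    have "((\<lambda>x. \<bar>Y i x - Y (Suc i) x\<bar>) \<longlongrightarrow> \<bar>Y i 0 - Y (Suc i) 0\<bar>) (nhds 0)" by (intro tendsto_intros Ycont)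
    then show "eventually (\<lambda>x. \<bar>Y i x - Y (Suc i) x\<bar> < l / 2) (nhds 0)"
      by (rule order_tendstoD(2)) (use orbit_step[OF y] in \<open>auto simp: Y0\<close>)
  qed auto
  \<comment> \<open>Within \<open>e\<close> the varied sequence is both an admissible competitor and
    inside the strip where \<open>G\<close> is differentiable.\<close>
  obtain e where e: "e > 0" "\<And>x. \<bar>x\<bar> < e \<Longrightarrow> \<forall>i\<in>{..N}. \<bar>Y i x - y i\<bar> < \<epsilon>"
    "\<And>x. \<bar>x\<bar> < e \<Longrightarrow> \<forall>i\<in>{..<N}. \<bar>Y i x - Y (Suc i) x\<bar> < l / 2"
    using eventually_conj[OF e1 e2] unfolding eventually_nhds_metric by (auto simp: dist_real_def)
  define A where "A = (\<lambda>x. \<Sum>i<N. G (Y i x) (Y (Suc i) x))"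
  define A' where "A' = (\<lambda>x. \<Sum>i<N. \<xi> i * P (Y i x) (Y (Suc i) x) + \<xi> (Suc i) * P (Y (Suc i) x) (Y i x))"
  have nz: "g (Y i x) + g (Y (Suc i) x) \<noteq> 0" "g (Y (Suc i) x) + g (Y i x) \<noteq> 0" if "\<bar>x\<bar> < e" "i < N" for i x
    using e(3)[OF that(1)] that(2) g_add_nonzero by (auto simp: add.commute)
  have 1: "(A has_real_derivative A' x) (at x)" if "\<bar>x - 0\<bar> < e" for x
    unfolding A_def A'_def
    by (intro DERIV_sum G_has_real_derivative Y' nz) (use that in auto)
  define D where "D = (\<Sum>i<N. \<xi> i * (\<xi> i * P1 (Y i 0) (Y (Suc i) 0) + \<xi> (Suc i) * P2 (Y i 0) (Y (Suc i) 0)) +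
    \<xi> (Suc i) * (\<xi> (Suc i) * P1 (Y (Suc i) 0) (Y i 0) + \<xi> i * P2 (Y (Suc i) 0) (Y i 0)))"
  have 2: "(A' has_real_derivative D) (at 0)"
    unfolding A'_def D_def
    by (intro DERIV_sum DERIV_add DERIV_cmult P_has_real_derivative Y' nz) (use e(1) in auto)
  have 3: "A x \<le> A 0" if "\<bar>x - 0\<bar> < e" for x
    using \<epsilon>(2)[of "\<lambda>i. Y i x"] e(2)[of x] that assms(3,4) by (auto simp: A_def Y0) (auto simp: Y_def)
  have "D \<le> 0" by (rule second_derivative_local_max[OF e(1) 1 2 3])
  then show ?thesis
    unfolding D_def Y0 by (simp add: P2_commute[of "y _" "y (Suc _)"] power2_eq_square algebra_simps)
qed

text \<open>A Jacobi field vanishing at the start cannot become nonpositive again: otherwise cutting it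
  off one step later and raising the last value slightly gives a positive second variation.\<close>

lemma jacobi_field_pos:
  assumes y: "orbit y" and max: "action_max y" and J: "J 0 = 0" "J 1 > 0"
    and rec: "\<And>n. P2 (y n) (y (Suc n)) * J n +
      (P1 (y (Suc n)) (y n) + P1 (y (Suc n)) (y (Suc (Suc n)))) * J (Suc n) +
      P2 (y (Suc n)) (y (Suc (Suc n))) * J (Suc (Suc n)) = 0"
  shows "J (Suc n) > 0"
proof (induction n)
  case (Suc n)
  define b where "b = (\<lambda>i. P2 (y i) (y (Suc i)))"
  define q where "q = (\<lambda>\<xi> i. P1 (y i) (y (Suc i)) * (\<xi> i)\<^sup>2 + 2 * P2 (y i) (y (Suc i)) * \<xi> i * \<xi> (Suc i)
    + P1 (y (Suc i)) (y i) * (\<xi> (Suc i))\<^sup>2)"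
  \<comment> \<open>Summation by parts: on a Jacobi field the quadratic form reduces to a boundary
    term.\<close>
  have tele: "(\<Sum>i<m. q J i) + P1 (y m) (y (Suc m)) * (J m)\<^sup>2 + b m * J m * J (Suc m) = 0" for m
  proof (induction m)
    case (Suc m)
    have "(\<Sum>i<Suc m. q J i) + P1 (y (Suc m)) (y (Suc (Suc m))) * (J (Suc m))\<^sup>2 + b (Suc m) * J (Suc m) * J (Suc (Suc m))
      = ((\<Sum>i<m. q J i) + P1 (y m) (y (Suc m)) * (J m)\<^sup>2 + b m * J m * J (Suc m)) +
        J (Suc m) * (b m * J m + (P1 (y (Suc m)) (y m) + P1 (y (Suc m)) (y (Suc (Suc m)))) * J (Suc m) +
          b (Suc m) * J (Suc (Suc m)))"
      by (simp add: q_def b_def power2_eq_square algebra_simps)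
    then show ?case using Suc rec[of m] by (simp add: b_def)
  qed (use J in simp)
  show ?case
  proof (rule ccontr)
    assume neg: "\<not> ?case"
    define m where "m = Suc n"
    define \<xi> where "\<xi> = (\<lambda>\<epsilon> i. if i \<le> m then J i else if i = Suc m then \<epsilon> else 0)"
    define a where "a = P1 (y (Suc m)) (y m) + P1 (y (Suc m)) (y (Suc (Suc m)))"
    have bm: "b m > 0" using P2_pos orbit_step(1)[OF y] by (simp add: b_def)
    \<comment> \<open>The test variation follows \<open>J\<close> up to \<open>m\<close>, takes the
      value \<epsilon> at \<open>Suc m\<close> and vanishes afterwards. Its form contains the term
      \<open>- (b m * J m * J (Suc m))\<close>, nonnegative under the assumption being
      refuted.\<close>
    have le: "2 * \<epsilon> * b m * J m + \<epsilon>\<^sup>2 * a \<le> 0" for \<epsilon>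
    proof -
      have "(\<Sum>i<Suc (Suc m). q (\<xi> \<epsilon>) i) \<le> 0"
        unfolding q_def by (rule second_variation[OF y max]) (auto simp: \<xi>_def J)
      moreover have "(\<Sum>i<m. q (\<xi> \<epsilon>) i) = (\<Sum>i<m. q J i)"
        by (rule sum.cong) (auto simp: q_def \<xi>_def)
      moreover have "q (\<xi> \<epsilon>) m = P1 (y m) (y (Suc m)) * (J m)\<^sup>2 + 2 * b m * J m * \<epsilon> + P1 (y (Suc m)) (y m) * \<epsilon>\<^sup>2"
        by (simp add: q_def \<xi>_def b_def)
      moreover have "q (\<xi> \<epsilon>) (Suc m) = P1 (y (Suc m)) (y (Suc (Suc m))) * \<epsilon>\<^sup>2"
        by (simp add: q_def \<xi>_def)
      ultimately have "- (b m * J m * J (Suc m)) + 2 * b m * J m * \<epsilon> + a * \<epsilon>\<^sup>2 \<le> 0"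
        using tele[of m] by (simp add: a_def algebra_simps)
      moreover have "b m * J m * J (Suc m) \<le> 0"
        using bm Suc neg by (simp add: m_def mult_nonneg_nonpos)
      ultimately show ?thesis by (simp add: algebra_simps)
    qed
    define B where "B = b m * J m"
    have "B > 0" using bm Suc by (simp add: B_def m_def)
    \<comment> \<open>Small enough that the quadratic term cannot cancel the positive linear
      one.\<close>
    define \<epsilon> where "\<epsilon> = B / (\<bar>a\<bar> + 1)"
    have "\<epsilon> > 0" using \<open>B > 0\<close> by (simp add: \<epsilon>_def add_nonneg_pos)
    have "\<epsilon> * \<bar>a\<bar> \<le> B" using \<open>B > 0\<close> by (simp add: \<epsilon>_def field_simps)
    moreover have "\<epsilon> * (- a) \<le> \<epsilon> * \<bar>a\<bar>" using \<open>\<epsilon> > 0\<close> by (intro mult_left_mono) auto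
    ultimately have "- (\<epsilon> * a) \<le> B" by simp
    then have "2 * B + \<epsilon> * a > 0" using \<open>B > 0\<close> by simp
    then have "\<epsilon> * (2 * B + \<epsilon> * a) > 0" using \<open>\<epsilon> > 0\<close> by simp
    then show False using le[of \<epsilon>] by (simp add: B_def power2_eq_square algebra_simps)
  qed
qed (use J in simp)

text \<open>Differentiating the orbit equation in the parameter yields a Jacobi field with initial
  values 0 and 1. It stays positive by maximality, so every later point of the orbit has positive
  derivative.\<close>

lemma orbit_family_increasing:
  assumes "a < b" and orb: "\<And>t. t \<in> {a<..<b} \<Longrightarrow> orbit (\<lambda>n. Y n t)"
    and amax: "\<And>t. t \<in> {a<..<b} \<Longrightarrow> action_max (\<lambda>n. Y n t)"
    and Y0: "\<And>t. t \<in> {a<..<b} \<Longrightarrow> Y 0 t = q" and Y1: "\<And>t. t \<in> {a<..<b} \<Longrightarrow> Y 1 t = t"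
    and st: "a < s" "s < t" "t < b"
  shows "Y (Suc n) s < Y (Suc n) t"
proof -
  let ?I = "{a<..<b}"
  have nhds_I: "eventually (\<lambda>x. x \<in> ?I) (nhds t)" if "t \<in> ?I" for t
    by (rule eventually_nhds_in_open) (use that in auto)
  have deriv_cong: "(f has_real_derivative d) (at t)"
    if "t \<in> ?I" "\<And>x. x \<in> ?I \<Longrightarrow> f x = h x" "(h has_real_derivative d) (at t)" for f h d t
    using that DERIV_cong_ev[of t t f h d d] eventually_mono[OF nhds_I[OF that(1)], of "\<lambda>x. f x = h x"] by auto
  \<comment> \<open>Differentiability passes to the next point by the implicit function lemma, whose
    denominator is positive by the twist condition; the derivative it gives is the Jacobi
    recursion.\<close>
  have step: "\<exists>d. (Y (Suc (Suc n)) has_real_derivative d) (at t) \<and>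
      P2 (Y n t) (Y (Suc n) t) * j + (P1 (Y (Suc n) t) (Y n t) + P1 (Y (Suc n) t) (Y (Suc (Suc n)) t)) * k +
      P2 (Y (Suc n) t) (Y (Suc (Suc n)) t) * d = 0"
    if t: "t \<in> ?I" and j: "(Y n has_real_derivative j) (at t)"
      and k: "(Y (Suc n) has_real_derivative k) (at t)" for n t j k
  proof -
    let ?x = "Y n" and ?y = "Y (Suc n)" and ?z = "Y (Suc (Suc n))"
    define F where "F = (\<lambda>x z. P (?y x) (?x x) + P (?y x) z)"
    define p where "p = (k * P1 (?y t) (?x t) + j * P2 (?y t) (?x t)) + k * P1 (?y t) (?z t)"
    define r where "r = P2 (?y t) (?z t)"
    have near: "\<bar>?y x - ?x x\<bar> < l / 2" "\<bar>?y x - ?z x\<bar> < l / 2" if "x \<in> ?I" for x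
      using orbit_step[OF orb[OF that]] by auto
    have "(?z has_real_derivative - p / r) (at t)"
    proof (rule implicit_has_real_derivative[of F])
      show "eventually (\<lambda>x. F x (?z x) = 0) (nhds t)"
        using nhds_I[OF t] by eventually_elim (use orbit_eq[OF orb] in \<open>simp add: F_def\<close>)
      show "r > 0" unfolding r_def by (rule P2_pos[OF near(2)[OF t]])
      fix m
      define L where "L = (\<lambda>x. ?z t + m * (x - t))"
      have L': "(L has_real_derivative m) (at t)" unfolding L_def by (auto intro!: derivative_eq_intros)
      have Lt: "L t = ?z t" by (simp add: L_def)
      have "((\<lambda>x. \<bar>?y x - L x\<bar>) \<longlongrightarrow> \<bar>?y t - L t\<bar>) (nhds t)"
        using DERIV_isCont[OF k] DERIV_isCont[OF L']
        by (intro tendsto_intros) (auto simp: isCont_def tendsto_at_iff_tendsto_nhds)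
      then have "eventually (\<lambda>x. \<bar>?y x - L x\<bar> < l / 2) (nhds t)"
        by (rule order_tendstoD(2)) (use near(2)[OF t] in \<open>simp add: Lt\<close>)
      then show "eventually (\<lambda>x. (F x (?z t + m * (x - t)) < F x (?z x) \<longleftrightarrow>
            ?z t + m * (x - t) < ?z x) \<and>
          (F x (?z x) < F x (?z t + m * (x - t)) \<longleftrightarrow>
            ?z x < ?z t + m * (x - t))) (nhds t)"
        using nhds_I[OF t]
      proof eventually_elim
        case (elim x)
        then show ?case
          using P_less_iff[OF near(2)[OF elim(2)] elim(1)] P_less_iff[OF elim(1) near(2)[OF elim(2)]]
          by (simp add: F_def L_def)
      qed
      have "((\<lambda>x. F x (L x)) has_real_derivative
          (k * P1 (?y t) (?x t) + j * P2 (?y t) (?x t)) +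
          (k * P1 (?y t) (L t) + m * P2 (?y t) (L t))) (at t)"
        unfolding F_def
        by (intro DERIV_add P_has_real_derivative j k L' g_add_nonzero near[OF t]) (use near(2)[OF t] in \<open>simp_all add: Lt\<close>)
      then show "((\<lambda>x. F x (?z t + m * (x - t))) has_real_derivative p + m * r) (at t)"
        unfolding Lt by (simp add: L_def p_def r_def algebra_simps)
    qed
    moreover have "r > 0" unfolding r_def by (rule P2_pos[OF near(2)[OF t]])
    then have "p + r * (- p / r) = 0" by simp
    then have "P2 (?x t) (?y t) * j + (P1 (?y t) (?x t) + P1 (?y t) (?z t)) * k +
      P2 (?y t) (?z t) * (- p / r) = 0"
      by (simp add: p_def r_def P2_commute[of "?x t"] algebra_simps)
    ultimately show ?thesis by blast
  qed
  have pos: "\<exists>d>0. (Y (Suc n) has_real_derivative d) (at t)" if t: "t \<in> ?I" for t n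
  proof -
    have d0: "(Y 0 has_real_derivative 0) (at t)" by (rule deriv_cong[OF t Y0]) auto
    have d1: "(Y 1 has_real_derivative 1) (at t)" by (rule deriv_cong[OF t Y1]) auto
    have ex: "\<exists>d. (Y n has_real_derivative d) (at t)" for n
    proof (induction n rule: less_induct)
      case (less n)
      consider "n = 0" | "n = 1" | k where "n = Suc (Suc k)" by (metis One_nat_def not0_implies_Suc)
      then show ?case
      proof cases
        case 3
        then obtain j j' where "(Y k has_real_derivative j) (at t)" "(Y (Suc k) has_real_derivative j') (at t)"
          using less[of k] less[of "Suc k"] by auto
        then show ?thesis using step[OF t] 3 by metis
      qed (use d0 d1 in auto)
    qed
    define J where "J = (\<lambda>n. SOME d. (Y n has_real_derivative d) (at t))"
    have J: "(Y n has_real_derivative J n) (at t)" for n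
      unfolding J_def using someI_ex[OF ex] .
    have "J (Suc n) > 0"
    proof (rule jacobi_field_pos[OF orb[OF t] amax[OF t]])
      show "J 0 = 0" using J d0 DERIV_unique by blast
      have "J 1 = 1" using J d1 DERIV_unique by blast
      then show "J 1 > 0" by simp
      fix n
      show "P2 (Y n t) (Y (Suc n) t) * J n + (P1 (Y (Suc n) t) (Y n t) + P1 (Y (Suc n) t) (Y (Suc (Suc n)) t)) * J (Suc n) +
        P2 (Y (Suc n) t) (Y (Suc (Suc n)) t) * J (Suc (Suc n)) = 0"
        using step[OF t J J, of n] J[of "Suc (Suc n)"] DERIV_unique by blast
    qed
    then show ?thesis using J by blast
  qed
  show ?thesis
  proof (rule DERIV_pos_imp_increasing[OF st(2)])
    fix x assume "s \<le> x" "x \<le> t"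
    then have "x \<in> ?I" using st by simp
    then show "\<exists>d. (Y (Suc n) has_real_derivative d) (at x) \<and> 0 < d" using pos[of x n] by blast
  qed
qed

end

section \<open>Maximizers between barriers\<close>

context symmetric_table begin

lemma continuous_on_G [continuous_intros]:
  assumes "continuous_on A f" "continuous_on A h"
  shows "continuous_on A (\<lambda>x. G (f x) (h x))"
proof -
  have *: "continuous_on A (\<lambda>x. \<gamma> (k x))" if "continuous_on A k" for k
    using continuous_on_compose2[OF continuous_on_gamma[of UNIV] that] by simp
  then show ?thesis unfolding G_def g_def by (intro continuous_intros * assms)
qed

lemma sum_fun_upd:
  assumes "Suc k < N"
  shows "(\<Sum>i<N. G ((y(Suc k := x)) i) ((y(Suc k := x)) (Suc i))) =
    G x (y k) + G x (y (Suc (Suc k))) + (\<Sum>i\<in>{..<N} - {k, Suc k}. G (y i) (y (Suc i)))"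
proof -
  have "{..<N} = insert k (insert (Suc k) ({..<N} - {k, Suc k}))" using assms by auto
  then have "(\<Sum>i<N. G ((y(Suc k := x)) i) ((y(Suc k := x)) (Suc i))) =
    (\<Sum>i\<in>insert k (insert (Suc k) ({..<N} - {k, Suc k})). G ((y(Suc k := x)) i) ((y(Suc k := x)) (Suc i)))"
    by metis
  also have "\<dots> = G (y k) x + (G x (y (Suc (Suc k))) +
      (\<Sum>i\<in>{..<N} - {k, Suc k}. G ((y(Suc k := x)) i) ((y(Suc k := x)) (Suc i))))"
    by simp
  also have "(\<Sum>i\<in>{..<N} - {k, Suc k}. G ((y(Suc k := x)) i) ((y(Suc k := x)) (Suc i))) =
      (\<Sum>i\<in>{..<N} - {k, Suc k}. G (y i) (y (Suc i)))"
    by (rule sum.cong) auto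
  finally show ?thesis by (simp add: G_commute)
qed

text \<open>The action is maximized between the barriers given by two fixed points and one orbit. At a
  point of contact with a barrier the twist condition forces contact at the neighbouring points as
  well, so that the maximizer is an orbit strictly between the barriers.\<close>

lemma confined_orbit:
  assumes qm: "q < m" "m < q + l / 2" and Pq: "P q q = 0" and Pm: "P m m = 0"
    and less: "G q q < G m m"
    and a: "orbit a" "a 0 = q" "\<And>n. q < a (Suc n)" "\<And>n. n \<ge> 4 \<Longrightarrow> m \<le> a n"
  obtains N y where "N > 1" "y 0 = q" "y N = q" "q < y 1" "y 1 < a 1"
    "\<And>n. n < N \<Longrightarrow> \<bar>y n - y (Suc n)\<bar> < l / 2"
    "\<And>n. Suc n < N \<Longrightarrow> P (y (Suc n)) (y n) + P (y (Suc n)) (y (Suc (Suc n))) = 0"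
proof -
  \<comment> \<open>The 5 counts the edges of the competitor \<open>z\<close> below that do not rest
    at \<open>m\<close>; their nonnegative lengths are discarded. For \<open>N\<close> beyond this
    bound the remaining edges alone beat resting at \<open>q\<close>.\<close>
  obtain N0 :: nat where N0: "5 * G m m / (G m m - G q q) < real N0"
    using reals_Archimedean2 by blast
  define N where "N = N0 + 6"
  have N6: "N \<ge> 6" by (simp add: N_def)
  have "5 * G m m / (G m m - G q q) < real N" using N0 by (simp add: N_def)
  then have N: "real N * G q q < (real N - 5) * G m m"
    using less by (simp add: field_simps)
  \<comment> \<open>Pinning every index outside the segment to \<open>q\<close> makes the admissible
    sequences a compact product.\<close>
  define B where "B = (\<lambda>n. if n = 0 \<or> n \<ge> N then {q} else {q..min (a n) m})"
  define S where "S = PiE UNIV B"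
  define W where "W = (\<lambda>y :: nat \<Rightarrow> real. \<Sum>i<N. G (y i) (y (Suc i)))"
  have "compact (B n)" for n by (simp add: B_def)
  then have "compact S"
    using compactin_PiE[of "\<lambda>_. euclidean" UNIV B]
    by (simp add: S_def euclidean_product_topology)
  have inS: "y \<in> S \<longleftrightarrow> (\<forall>n. y n \<in> B n)" for y by (auto simp: S_def PiE_def Pi_def)
  \<comment> \<open>From index 4 on the barrier \<open>a\<close> is above \<open>m\<close>, so
    resting at \<open>m\<close> is admissible.\<close>
  define z where "z = (\<lambda>n. if 4 \<le> n \<and> n < N then m else q)"
  have aq: "q \<le> a n" for n using a(2,3) by (cases n) (auto simp: less_imp_le)
  have zS: "z \<in> S"
    unfolding inS using a(4) aq qm by (auto simp: z_def B_def)
  have Wz: "W z \<ge> (real N - 5) * G m m"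
  proof -
    have "(real N - 5) * G m m = (\<Sum>i\<in>{4..<N - 1}. G m m)"
      using N6 by (simp add: of_nat_diff)
    also have "\<dots> = (\<Sum>i\<in>{4..<N - 1}. G (z i) (z (Suc i)))"
      by (rule sum.cong) (auto simp: z_def)
    also have "\<dots> \<le> W z"
      unfolding W_def by (rule sum_mono2) (auto simp: G_def)
    finally show ?thesis .
  qed
  have "continuous_on S W"
    unfolding W_def by (intro continuous_intros continuous_on_subset[OF continuous_on_product_coordinates]) auto
  then obtain y where y: "y \<in> S" "\<And>x. x \<in> S \<Longrightarrow> W x \<le> W y"
    using continuous_attains_sup[OF \<open>compact S\<close>] zS by blast
  have yB: "y n \<in> B n" for n using y(1) inS by blast
  have y0: "y 0 = q" and yN: "y N = q" using yB[of 0] yB[of N] by (auto simp: B_def)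
  have yge: "q \<le> y n" and yle: "y n \<le> m" and yla: "y n \<le> a n" for n
    using yB[of n] qm aq[of n] by (auto simp: B_def split: if_splits)
  have near: "\<bar>y i - y j\<bar> < l / 2" for i j
    using yge[of i] yge[of j] yle[of i] yle[of j] qm by linarith
  define D where "D = (\<lambda>n. P (y (Suc n)) (y n) + P (y (Suc n)) (y (Suc (Suc n))))"
  have deriv: "((\<lambda>x. G x (y n) + G x (y (Suc (Suc n)))) has_real_derivative D n) (at (y (Suc n)))" for n
  proof -
    have "((\<lambda>x. G x (y k)) has_real_derivative 1 * P (y (Suc n)) (y k) + 0 * P (y k) (y (Suc n))) (at (y (Suc n)))" for k
      by (rule G_has_real_derivative[of "\<lambda>x. x" 1 "y (Suc n)" "\<lambda>_. y k" 0])
        (use g_add_nonzero[OF near] in auto)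
    then show ?thesis unfolding D_def by (intro DERIV_add) auto
  qed
  have opt: "G x (y n) + G x (y (Suc (Suc n))) \<le> G (y (Suc n)) (y n) + G (y (Suc n)) (y (Suc (Suc n)))"
    if "Suc n < N" "q \<le> x" "x \<le> a (Suc n)" "x \<le> m" for n x
  proof -
    have "x \<in> B (Suc n)" using that by (simp add: B_def)
    then have "y(Suc n := x) \<in> S" using yB by (simp add: inS)
    then have "W (y(Suc n := x)) \<le> W (y(Suc n := y (Suc n)))" using y(2) by simp
    then show ?thesis unfolding W_def sum_fun_upd[OF that(1)] by simp
  qed
  \<comment> \<open>Room to move on one side gives a one-sided critical inequality; where there is
    room on both sides the orbit equation follows.\<close>
  have down: "D n \<ge> 0" if "Suc n < N" "y (Suc n) > q" for n
  proof (rule ccontr)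
    let ?v = "y (Suc n)" and ?w = "y (Suc (Suc n))"
    assume "\<not> D n \<ge> 0"
    then obtain d where d: "d > 0" "\<And>h. 0 < h \<Longrightarrow> h < d \<Longrightarrow>
        G (?v - h) (y n) + G (?v - h) (?w) > G (?v) (y n) + G (?v) (?w)"
      using DERIV_neg_dec_left[OF deriv, of n] by auto
    define h where "h = min d (?v - q) / 2"
    have "0 < h" "h < d" "h \<le> ?v - q" using d(1) that(2) by (auto simp: h_def)
    then show False using d(2)[of h] opt[OF that(1), of "?v - h"] yla[of "Suc n"] yle[of "Suc n"] by auto
  qed
  have up: "D n \<le> 0" if "Suc n < N" "y (Suc n) < a (Suc n)" "y (Suc n) < m" for n
  proof (rule ccontr)
    let ?v = "y (Suc n)" and ?w = "y (Suc (Suc n))"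
    assume "\<not> D n \<le> 0"
    then obtain d where d: "d > 0" "\<And>h. 0 < h \<Longrightarrow> h < d \<Longrightarrow>
        G (?v + h) (y n) + G (?v + h) (?w) > G (?v) (y n) + G (?v) (?w)"
      using DERIV_pos_inc_right[OF deriv, of n] by auto
    define h where "h = min d (min (a (Suc n) - ?v) (m - ?v)) / 2"
    have "0 < h" "h < d" "h \<le> a (Suc n) - ?v" "h \<le> m - ?v" using d(1) that(2,3) by (auto simp: h_def)
    then show False using d(2)[of h] opt[OF that(1), of "?v + h"] yge[of "Suc n"] by auto
  qed
  \<comment> \<open>At \<open>q\<close> both terms of \<open>D n\<close> are nonnegative by the
    twist condition, while freedom to move up makes the sum nonpositive. Both neighbours are then at
    \<open>q\<close>.\<close>
  have y_q: "y n = q \<and> y (Suc (Suc n)) = q" if "Suc n < N" "y (Suc n) = q" for n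
  proof -
    have nq: "\<bar>q - y i\<bar> < l / 2" "\<bar>q - q\<bar> < l / 2" for i using yge[of i] yle[of i] qm by linarith+
    have "P q q \<le> P q (y i)" for i using P_le_iff[OF nq(2) nq(1)] yge[of i] by simp
    moreover have "D n \<le> 0" using up[OF that(1)] that(2) a(3)[of n] qm by simp
    ultimately have "P q (y n) = P q q" "P q (y (Suc (Suc n))) = P q q"
      unfolding D_def that(2) Pq by (smt (verit) Pq)+
    then show ?thesis using P_eq_iff[OF nq(1) nq(2)] by simp
  qed
  have y_m: "y n = m" if "Suc n < N" "y (Suc n) = m" for n
  proof -
    have nq: "\<bar>m - y i\<bar> < l / 2" "\<bar>m - m\<bar> < l / 2" for i using yge[of i] yle[of i] qm by linarith+
    have "P m (y i) \<le> P m m" for i using P_le_iff[OF nq(1) nq(2)] yle[of i] by simp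
    moreover have "D n \<ge> 0" using down[OF that(1)] that(2) qm by simp
    ultimately have "P m (y n) = P m m"
      unfolding D_def that(2) Pm by (smt (verit) Pm)
    then show ?thesis using P_eq_iff[OF nq(1) nq(2)] by simp
  qed
  have y_a: "y (Suc (Suc n)) = a (Suc (Suc n))" if "Suc n < N" "y (Suc n) = a (Suc n)" for n
  proof -
    have n1: "\<bar>a (Suc n) - y i\<bar> < l / 2" for i using near[of "Suc n" i] that(2) by simp
    have n2: "\<bar>a (Suc n) - a n\<bar> < l / 2" "\<bar>a (Suc n) - a (Suc (Suc n))\<bar> < l / 2"
      using orbit_step[OF a(1)] by auto
    have "P (a (Suc n)) (y n) \<le> P (a (Suc n)) (a n)" using P_le_iff[OF n1 n2(1)] yla by simp
    moreover have "P (a (Suc n)) (y (Suc (Suc n))) \<le> P (a (Suc n)) (a (Suc (Suc n)))"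
      using P_le_iff[OF n1 n2(2)] yla by simp
    moreover have "P (a (Suc n)) (a n) + P (a (Suc n)) (a (Suc (Suc n))) = 0" by (rule orbit_eq[OF a(1)])
    moreover have "D n \<ge> 0" using down[OF that(1)] that(2) a(3)[of n] by simp
    ultimately have "P (a (Suc n)) (y (Suc (Suc n))) = P (a (Suc n)) (a (Suc (Suc n)))"
      unfolding D_def that(2) by linarith
    then show ?thesis using P_eq_iff[OF n1 n2(2)] by simp
  qed
  \<comment> \<open>Contact with \<open>a\<close> propagates forward to the end, where the sequence
    is at \<open>q\<close> but \<open>a\<close> is above it.\<close>
  have not_a: "y (Suc n) \<noteq> a (Suc n)" if "Suc n < N" for n
  proof
    assume eq: "y (Suc n) = a (Suc n)"
    have "Suc n + k \<le> N \<Longrightarrow> y (Suc n + k) = a (Suc n + k)" for k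
    proof (induction k)
      case (Suc k)
      then show ?case using y_a[of "n + k"] by simp
    qed (use eq in simp)
    from this[of "N - Suc n"] have "y N = a N" using that by simp
    then show False using yN a(3)[of "N - 1"] N6 by simp
  qed
  \<comment> \<open>Contact with \<open>m\<close> propagates backward to the start.\<close>
  have not_m: "y n \<noteq> m" if "n < N" for n
    using that
  proof (induction n)
    case 0
    then show ?case using y0 qm by simp
  next
    case (Suc n)
    then show ?case using y_m[of n] by auto
  qed
  \<comment> \<open>Contact with \<open>q\<close> propagates both ways and makes the sequence
    constant, with less action than \<open>z\<close>.\<close>
  have not_q: "y (Suc n) \<noteq> q" if "Suc n < N" for n
  proof
    assume eq: "y (Suc n) = q"
    have up': "Suc n + k < N \<Longrightarrow> y (Suc n + k) = q" for k
    proof (induction k)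
      case (Suc k)
      then show ?case using y_q[of "n + k"] by simp
    qed (use eq in simp)
    have down': "k \<le> Suc n \<Longrightarrow> y (Suc n - k) = q" for k
    proof (induction k)
      case (Suc k)
      show ?case
      proof (cases "k = Suc n")
        case False
        then have "Suc (n - k) = Suc n - k" using Suc by auto
        then show ?thesis using Suc that y_q[of "n - k"] by simp
      qed (use Suc in simp)
    qed (use eq in simp)
    have "y i = q" if "i \<le> N" for i
    proof -
      consider "i \<le> Suc n" | "Suc n < i" "i < N" | "i = N" using \<open>i \<le> N\<close> by linarith
      then show ?thesis
      proof cases
        case 1 then show ?thesis using down'[of "Suc n - i"] by simp
      next
        case 2 then show ?thesis using up'[of "i - Suc n"] by simp
      next
        case 3 then show ?thesis using yN by simp
      qed
    qed
    then have "W y = real N * G q q" by (simp add: W_def)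
    then show False using Wz N y(2)[OF zS] by linarith
  qed
  show thesis
  proof
    show "N > 1" using N6 by simp
    show "y 0 = q" "y N = q" by fact+
    show "q < y 1" using not_q[of 0] yge[of 1] N6 by simp
    show "y 1 < a 1" using not_a[of 0] yla[of 1] N6 by simp
    show "\<And>n. n < N \<Longrightarrow> \<bar>y n - y (Suc n)\<bar> < l / 2" using near by blast
    show "P (y (Suc n)) (y n) + P (y (Suc n)) (y (Suc (Suc n))) = 0" if "Suc n < N" for n
    proof -
      have "q < y (Suc n)" "y (Suc n) < a (Suc n)" "y (Suc n) < m"
        using not_q[OF that] yge[of "Suc n"] not_a[OF that] yla[of "Suc n"] not_m[OF that] yle[of "Suc n"] by auto
      then show ?thesis using up[OF that] down[OF that] by (simp add: D_def)
    qed
  qed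
qed

text \<open>Monotonicity of the \<open>N\<close>-th point compares two members of the family: the
  constant orbit at \<open>t = q\<close> and the confined orbit at \<open>t = y 1 > q\<close>. Both
  are at \<open>q\<close> at time \<open>N\<close>.\<close>

lemma no_monotone_family:
  assumes qm: "q < m" "m < q + l / 2" and Pq: "P q q = 0" and Pm: "P m m = 0"
    and less: "G q q < G m m"
    and a: "orbit a" "a 0 = q" "\<And>n. q < a (Suc n)" "\<And>n. n \<ge> 4 \<Longrightarrow> m \<le> a n"
    and e: "e < q"
    and fam: "\<And>t. e < t \<Longrightarrow> t < a 1 \<Longrightarrow> \<exists>y. orbit y \<and> action_max y \<and> y 0 = q \<and> y 1 = t"
  shows False
proof -
  obtain N y where y: "N > 1" "y 0 = q" "y N = q" "q < y 1" "y 1 < a 1"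
    "\<And>n. n < N \<Longrightarrow> \<bar>y n - y (Suc n)\<bar> < l / 2"
    "\<And>n. Suc n < N \<Longrightarrow> P (y (Suc n)) (y n) + P (y (Suc n)) (y (Suc (Suc n))) = 0"
    using confined_orbit[OF qm Pq Pm less a] by metis
  define Y where "Y = (\<lambda>n t. (SOME y. orbit y \<and> action_max y \<and> y 0 = q \<and> y 1 = t) n)"
  have Y: "orbit (\<lambda>n. Y n t)" "action_max (\<lambda>n. Y n t)" "Y 0 t = q" "Y 1 t = t" if "t \<in> {e<..<a 1}" for t
    using someI_ex[OF fam[of t]] that unfolding Y_def by auto
  have ea: "e < a 1" using e a(3)[of 0] by simp
  have "Y (Suc (N - 1)) q < Y (Suc (N - 1)) (y 1)"
    by (rule orbit_family_increasing[OF ea Y]) (use y e in auto)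
  moreover have "Y n q = q \<and> Y (Suc n) q = q" for n
  proof (rule orbit_unique[of "\<lambda>n. Y n q" "\<lambda>_. q"])
    show "orbit (\<lambda>_. q)" using Pq l_pos by (simp add: orbit_def)
  qed (use Y[of q] e a(3)[of 0] in auto)
  moreover have "Suc n \<le> N \<Longrightarrow> Y n (y 1) = y n \<and> Y (Suc n) (y 1) = y (Suc n)" for n
  proof (induction n)
    case 0
    then show ?case using Y(3,4)[of "y 1"] y e by simp
  next
    case (Suc n)
    have o: "orbit (\<lambda>n. Y n (y 1))" using Y(1)[of "y 1"] y e by simp
    have IH: "Y n (y 1) = y n" "Y (Suc n) (y 1) = y (Suc n)" using Suc by auto
    have "P (y (Suc n)) (Y (Suc (Suc n)) (y 1)) = P (y (Suc n)) (y (Suc (Suc n)))"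
      using orbit_eq[OF o, of n] y(7)[of n] Suc IH by simp
    then show ?case
      using P_eq_iff[of "y (Suc n)" "Y (Suc (Suc n)) (y 1)" "y (Suc (Suc n))"]
        orbit_step(1)[OF o, of "Suc n"] y(6)[of "Suc n"] Suc IH by simp
  qed
  from this[of "N - 1"] have "Y N (y 1) = q" using y by simp
  ultimately show False using y(1) by simp
qed

end

section \<open>Trajectories and the invariant curve\<close>

context symmetric_table begin

lemma P_shift_nat: "P (a + real n * (l / 2)) (b + real n * (l / 2)) = P a b"
proof (induction n)
  case (Suc n)
  have "x + real (Suc n) * (l / 2) = x + real n * (l / 2) + l / 2" for x by (simp add: field_simps)
  then show ?case using Suc by (simp only: P_shift)
qed simp

lemma G_shift_nat: "G (a + real n * (l / 2)) (b + real n * (l / 2)) = G a b"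
proof (induction n)
  case (Suc n)
  have "x + real (Suc n) * (l / 2) = x + real n * (l / 2) + l / 2" for x by (simp add: field_simps)
  then show ?case using Suc by (simp only: G_shift)
qed simp

lemma P_periodic_int: "P (a + of_int k * l) (b + of_int k * l) = P a b"
  by (simp add: P_def g_def periodic_int velocity_periodic_int)

lemma orbit_shift: "orbit y \<Longrightarrow> orbit (\<lambda>n. y (n + k) + of_int j * l)"
  unfolding orbit_def P_periodic_int by (auto simp: P_periodic_int)

lemma chord_length_G:
  "chord_length \<gamma> (a + real n * (l / 2)) (b + real (Suc n) * (l / 2)) = G a b"
proof -
  have "b + real (Suc n) * (l / 2) = (b + real n * (l / 2)) + l / 2" by (simp add: algebra_simps)
  then have "chord_length \<gamma> (a + real n * (l / 2)) (b + real (Suc n) * (l / 2)) =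
    norm (\<gamma> ((b + real n * (l / 2)) + l / 2) - \<gamma> (a + real n * (l / 2)))"
    unfolding chord_length_def by (metis norm_minus_commute)
  also have "\<dots> = G (a + real n * (l / 2)) (b + real n * (l / 2))"
    unfolding gamma_diff_half norm_minus_cancel G_def ..
  also have "\<dots> = G a b" by (rule G_shift_nat)
  finally show ?thesis .
qed

text \<open>A billiard trajectory in terms of the reduced parameters, in which the half turn between
  successive reflection points is subtracted.\<close>

lemma trajectory_orbit:
  assumes traj: "\<And>n. p n \<in> \<A>" "\<And>n. p (Suc n) = T (p n)"
    and p0: "p 0 = ychord q t" "\<bar>q - t\<bar> < l / 2"
  obtains y where "orbit y" "y 0 = q" "y 1 = t"
    "\<And>n. p n = ychord (y n + real n * (l / 2)) (y (Suc n) + real n * (l / 2))"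
proof -
  define R where "R = (\<lambda>n (a, b). \<bar>a - b\<bar> < l / 2 \<and>
      p n = ychord (a + real n * (l / 2)) (b + real n * (l / 2)) \<and> (n = 0 \<longrightarrow> a = q \<and> b = t))"
  define Q where "Q = (\<lambda>(n::nat) (a, b) (a', b'). a' = b \<and> P b a + P b b' = 0)"
  have "\<exists>f. \<forall>n. R n (f n) \<and> Q n (f n) (f (Suc n))"
  proof (rule dependent_nat_choice)
    show "\<exists>x. R 0 x" using p0 by (auto simp: R_def)
    fix x :: "real \<times> real" and n assume "R n x"
    then obtain a b where ab: "x = (a, b)" "\<bar>a - b\<bar> < l / 2"
      "p n = ychord (a + real n * (l / 2)) (b + real n * (l / 2))" by (auto simp: R_def)
    define a' b' where "a' = a + real n * (l / 2)" and "b' = b + real n * (l / 2)"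
    have near: "\<bar>a' - b'\<bar> < l / 2" using ab(2) by (simp add: a'_def b'_def)
    have pn: "p n = ychord a' b'" using ab(3) by (simp add: a'_def b'_def)
    have "fst (p (Suc n)) = \<gamma> (b' + l / 2)"
      unfolding traj(2) pn using billiard_map_chord[OF ychord_ne[OF near]] by (simp add: ychord_def)
    then obtain d' where d': "\<bar>b' + l / 2 - d'\<bar> < l / 2" "p (Suc n) = ychord (b' + l / 2) d'"
      using phase_cylinder_ychord[OF traj(1)] by blast
    define d where "d = d' - l / 2 - real n * (l / 2)"
    have d'_eq: "d' = (d + real n * (l / 2)) + l / 2" by (simp add: d_def)
    have near': "\<bar>b' - (d + real n * (l / 2))\<bar> < l / 2" using d'(1) by (simp add: d'_eq)
    have "P b' a' + P b' (d + real n * (l / 2)) = 0"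
      using d'(2) billiard_map_ychord_eq_iff[OF near near'] by (simp add: traj(2) pn d'_eq)
    then have "P b a + P b d = 0" unfolding a'_def b'_def P_shift_nat .
    moreover have "R (Suc n) (b, d)"
    proof -
      have e: "x + real n * (l / 2) + l / 2 = x + real (Suc n) * (l / 2)" for x by (simp add: field_simps)
      have "\<bar>b - d\<bar> < l / 2" using near' by (simp add: b'_def)
      moreover have "p (Suc n) = ychord (b + real (Suc n) * (l / 2)) (d + real (Suc n) * (l / 2))"
        using d'(2) unfolding d'_eq b'_def e .
      ultimately show ?thesis by (simp add: R_def)
    qed
    ultimately show "\<exists>x'. R (Suc n) x' \<and> Q n x x'" by (intro exI[of _ "(b, d)"]) (auto simp: Q_def ab)
  qed
  then obtain f where f: "\<And>n. R n (f n)" "\<And>n. Q n (f n) (f (Suc n))" by blast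
  define y where "y = (\<lambda>n. fst (f n))"
  have snd_f: "snd (f n) = y (Suc n)" for n using f(2)[of n] by (auto simp: Q_def y_def split: prod.splits)
  have fn: "f n = (y n, y (Suc n))" for n using snd_f by (metis y_def prod.collapse)
  show thesis
  proof
    show "orbit y" using f unfolding orbit_def fn R_def Q_def by auto
    show "y 0 = q" "y 1 = t" using f(1)[of 0] unfolding fn by (auto simp: R_def)
    show "p n = ychord (y n + real n * (l / 2)) (y (Suc n) + real n * (l / 2))" for n
      using f(1)[of n] unfolding fn by (auto simp: R_def)
  qed
qed

text \<open>The configuration is read from the index of the given line onward. Its parameters differ
  from those of \<open>y\<close> by half turns and multiples of \<open>l\<close>, under which chord
  lengths become values of \<open>G\<close>.\<close>

lemma m_orbit_set_imp:
  assumes "ychord q t \<in> m_orbit_set \<gamma>" "\<bar>q - t\<bar> < l / 2"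
  obtains y where "orbit y" "action_max y" "y 0 = q" "y 1 = t"
proof -
  obtain O' where O': "m_orbit \<gamma> O'" "ychord q t \<in> range O'"
    using assms(1) by (auto simp: m_orbit_set_def)
  obtain k0 where k0: "O' k0 = ychord q t" using O'(2) by auto
  obtain s where orb: "billiard_orbit \<gamma> O'"
    and s: "\<And>n. \<gamma> (s n) = fst (O' n)" and max: "locally_maximizing \<gamma> s"
    using O'(1) by (auto simp: m_orbit_def)
  define p where "p = (\<lambda>n. O' (k0 + int n))"
  have "p n \<in> \<A>" "p (Suc n) = T (p n)" for n
  proof -
    have "k0 + int (Suc n) = (k0 + int n) + 1" by simp
    then show "p n \<in> \<A>" "p (Suc n) = T (p n)"
      using orb unfolding billiard_orbit_def p_def by metis+
  qed
  then obtain y where y: "orbit y" "y 0 = q" "y 1 = t"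
    "\<And>n. p n = ychord (y n + real n * (l / 2)) (y (Suc n) + real n * (l / 2))"
    using trajectory_orbit[of p q t] assms(2) k0 by (auto simp: p_def)
  have "\<gamma> (s (k0 + int n)) = \<gamma> (y n + real n * (l / 2))" for n
    using s[of "k0 + int n"] y(4)[of n] by (simp add: p_def ychord_altdef)
  then have "\<exists>j::int. s (k0 + int n) = y n + real n * (l / 2) + of_int j * l" for n
    using eq_iff by metis
  then obtain j :: "nat \<Rightarrow> int" where j: "\<And>n. s (k0 + int n) = y n + real n * (l / 2) + of_int (j n) * l"
    by metis
  have len: "chord_length \<gamma> (a + real n * (l / 2) + of_int i * l) (b + real (Suc n) * (l / 2) + of_int i' * l) = G a b"
    for a b n i i'
    using chord_length_G[of a n b] unfolding chord_length_def periodic_int by simp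
  have sum_int: "(\<Sum>n=k0..k0 + int N - 1. F n) = (\<Sum>n<N. F (k0 + int n))" for F :: "int \<Rightarrow> real" and N
    by (rule sum.reindex_bij_witness[of _ "\<lambda>n. k0 + int n" "\<lambda>n. nat (n - k0)"]) auto
  have "action_max y"
    unfolding action_max_def
  proof
    fix N
    let ?L = "\<lambda>r. \<Sum>n=k0..k0 + int N - 1. chord_length \<gamma> (r n) (r (n + 1))"
    let ?S = "\<lambda>r. \<Sum>n<N. G (r n) (r (Suc n))"
    show "\<exists>\<epsilon>>0. \<forall>r. r 0 = y 0 \<and> r N = y N \<and> (\<forall>n\<le>N. \<bar>r n - y n\<bar> < \<epsilon>) \<longrightarrow>
      ?S r \<le> ?S y"
    proof (cases "N = 0")
      case False
      then have "k0 < k0 + int N" by simp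
      from max[unfolded locally_maximizing_def, rule_format, OF this]
      obtain \<epsilon> where \<epsilon>: "\<epsilon> > 0" "\<And>r. r k0 = s k0 \<and> r (k0 + int N) = s (k0 + int N) \<and>
          (\<forall>n\<in>{k0..k0 + int N}. \<bar>r n - s n\<bar> < \<epsilon>) \<Longrightarrow>
          ?L r \<le>
          ?L s"
        by blast
      have "?S r \<le> ?S y"
        if r: "r 0 = y 0" "r N = y N" "\<And>n. n \<le> N \<Longrightarrow> \<bar>r n - y n\<bar> < \<epsilon>" for r
      proof -
        \<comment> \<open>Adding the displacement of \<open>y\<close> to \<open>s\<close> preserves
          fixed ends and the bound \<epsilon>.\<close>
        define R where "R = (\<lambda>k. s k + (r (nat (k - k0)) - y (nat (k - k0))))"
        have R: "R (k0 + int n) = r n + real n * (l / 2) + of_int (j n) * l" for n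
          using j[of n] by (simp add: R_def)
        have e: "k0 + int n + 1 = k0 + int (Suc n)" for n by simp
        have "?L R \<le>
          ?L s"
        proof (rule \<epsilon>(2), intro conjI)
          show "\<forall>n\<in>{k0..k0 + int N}. \<bar>R n - s n\<bar> < \<epsilon>"
            using r(3) by (auto simp: R_def nat_le_iff)
        qed (use r(1,2) in \<open>auto simp: R_def\<close>)
        then show ?thesis unfolding sum_int e R j len .
      qed
      then show ?thesis using \<epsilon>(1) by blast
    qed (auto intro: exI[of _ 1])
  qed
  then show thesis using that y by blast
qed

text \<open>The signed distance of the centre from the line, positive when the centre is on its
  left.\<close>

definition side :: "oriented_line \<Rightarrow> real"
  where "side p = cross (snd p) (c - fst p)"

text \<open>This is orientation of the triangle with vertices at \<open>a\<close>, \<open>b\<close>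
  and the point opposite to \<open>a\<close>, one side of which passes through the centre.\<close>

lemma cross_g_pos:
  assumes "a < b" "b < a + l / 2"
  shows "cross (g a) (g b) > 0"
proof -
  have "cross (\<gamma> b - \<gamma> a) (\<gamma> (a + l / 2) - \<gamma> a) > 0"
    by (rule cross_chords_pos) (use assms l_pos in auto)
  moreover have "\<gamma> b - \<gamma> a = g b - g a" "\<gamma> (a + l / 2) - \<gamma> a = - (g a + g a)"
    by (simp_all add: gamma_diff_half) (simp add: g_def)
  ultimately have "cross (g b - g a) (- (g a + g a)) > 0" by simp
  then show ?thesis by (simp add: cross_altdef algebra_simps)
qed

lemma side_ychord:
  assumes "\<bar>a - b\<bar> < l / 2"
  shows "side (ychord a b) > 0 \<longleftrightarrow> b < a" "side (ychord a b) < 0 \<longleftrightarrow> a < b"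
proof -
  have c_diff: "c - \<gamma> a = - g a" by (simp add: g_def)
  have eq: "side (ychord a b) = cross (g b) (g a) / G a b"
    unfolding side_def ychord_altdef fst_conv snd_conv c_diff
    by (simp add: sgn_div_norm cross.scaleR_left cross.minus_left cross.minus_right cross.add_left G_def divide_inverse)
  have G: "G a b > 0" by (rule G_pos[OF assms])
  have "b < a \<Longrightarrow> cross (g b) (g a) > 0" using cross_g_pos[of b a] assms by auto
  moreover have "a < b \<Longrightarrow> cross (g b) (g a) < 0"
    using cross_g_pos[of a b] assms cross_commute[of "g b" "g a"] by auto
  moreover have "a = b \<Longrightarrow> cross (g b) (g a) = 0" by simp
  ultimately have "cross (g b) (g a) > 0 \<longleftrightarrow> b < a" "cross (g b) (g a) < 0 \<longleftrightarrow> a < b"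
    by (smt (verit))+
  then show "side (ychord a b) > 0 \<longleftrightarrow> b < a" "side (ychord a b) < 0 \<longleftrightarrow> a < b"
    using G unfolding eq by (auto simp: zero_less_divide_iff divide_less_0_iff)
qed

lemma continuous_on_side: "continuous_on A side"
  unfolding side_def by (intro cross.continuous_on continuous_intros)

text \<open>If \<open>y 1 = y 0\<close>, the equations at indices 1 and 4, the latter translated by
  the period, give \<open>y 3 + l\<close> and \<open>y 2\<close> the same value of
  \<open>P (y 0)\<close>. The twist condition makes them equal, too far apart for one step of the
  orbit.\<close>

lemma orbit_not_through_centre:
  assumes y: "orbit y" and per: "\<And>n. y (n + 4) = y n - l"
  shows "y 1 \<noteq> y 0"
proof
  assume eq: "y 1 = y 0"
  have s: "P (a - l) (b - l) = P a b" for a b using P_periodic_int[of a "- 1" b] by simp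
  have y4: "y 4 = y 0 - l" "y 5 = y 1 - l" using per[of 0] per[of 1] by simp_all
  have "P (y 4) (y 3) + P (y 4) (y 5) = 0" using orbit_eq[OF y, of 3] by (simp add: eval_nat_numeral)
  then have "P (y 0) (y 3 + l) + P (y 0) (y 1) = 0"
    using s[of "y 0" "y 3 + l"] s[of "y 0" "y 1"] by (simp add: y4)
  moreover have "P (y 0) (y 1) + P (y 0) (y 2) = 0" using orbit_eq[OF y, of 0] eq by (simp add: eval_nat_numeral)
  ultimately have "P (y 0) (y 3 + l) = P (y 0) (y 2)" by simp
  moreover have "\<bar>y 0 - (y 3 + l)\<bar> < l / 2"
  proof -
    have "\<bar>y 4 - y 3\<bar> < l / 2" using orbit_step(2)[OF y, of 3] by (simp add: eval_nat_numeral)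
    then show ?thesis using y4(1) by linarith
  qed
  moreover have "\<bar>y 0 - y 2\<bar> < l / 2" using orbit_step(1)[OF y, of 1] eq by (simp add: eval_nat_numeral)
  ultimately have "y 3 + l = y 2" using P_eq_iff by blast
  then show False using orbit_step(1)[OF y, of 2] l_pos by (simp add: eval_nat_numeral)
qed

end

section \<open>The curve of 4-periodic orbits and its reversal\<close>

locale quarter_table = symmetric_table +
  fixes \<alpha> :: "oriented_line set"
  assumes invariant: "invariant_curve \<gamma> \<alpha>"
    and rotation: "curve_has_rotation_number \<gamma> l \<alpha> (1/4)"
    and periodic4: "\<And>p. p \<in> \<alpha> \<Longrightarrow> (T ^^ 4) p = p"
begin

lemma alpha_subset: "\<alpha> \<subseteq> \<A>"
  using invariant by (simp add: invariant_curve_def rotational_curve_def)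

lemma funpow_in_alpha: "p \<in> \<alpha> \<Longrightarrow> (T ^^ n) p \<in> \<alpha>"
  using invariant by (induction n) (auto simp: invariant_curve_def)

text \<open>Periodicity of the line gives \<open>y (n + 4) = y n + k * l\<close> for some integer
  \<open>k\<close>. Four true steps advance by \<open>(k + 2) * l\<close>, so rotation number 1/4
  leaves only \<open>k = - 1\<close>.\<close>

lemma alpha_orbit:
  assumes p: "p \<in> \<alpha>" and q: "fst p = \<gamma> q"
  obtains y where "orbit y" "y 0 = q"
    "\<And>n. (T ^^ n) p = ychord (y n + real n * (l / 2)) (y (Suc n) + real n * (l / 2))"
    "\<And>n. y (n + 4) = y n - l"
proof -
  obtain t where t: "\<bar>q - t\<bar> < l / 2" "p = ychord q t"
    using phase_cylinder_ychord[OF _ q] p alpha_subset by blast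
  have X: "(T ^^ n) p \<in> \<A>" for n
    using funpow_in_alpha[OF p] alpha_subset by blast
  obtain y where y: "orbit y" "y 0 = q" "y 1 = t"
    "\<And>n. (T ^^ n) p = ychord (y n + real n * (l / 2)) (y (Suc n) + real n * (l / 2))"
  proof (rule trajectory_orbit[of "\<lambda>n. (T ^^ n) p" q t])
    show "(T ^^ n) p \<in> \<A>" for n by (rule X)
    show "(T ^^ Suc n) p = T ((T ^^ n) p)" for n
      by (simp only: funpow.simps o_apply)
    show "(T ^^ 0) p = ychord q t" using t(2) by (simp only: funpow.simps id_apply)
    show "\<bar>q - t\<bar> < l / 2" by (rule t(1))
  qed (rule that)
  obtain s where s: "\<And>n. \<gamma> (s n) = fst ((T ^^ n) p)" "\<And>n. s n < s (Suc n)" "\<And>n. s (Suc n) < s n + l"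
    and lim: "(\<lambda>n. (s n - s 0) / (real n * l)) \<longlonglongrightarrow> 1 / 4"
    using bspec[OF rotation[unfolded curve_has_rotation_number_def] p]
    unfolding orbit_has_rotation_number_def by blast
  have "\<gamma> q = \<gamma> (s 0)" using s(1)[of 0] q by simp
  then obtain k0 :: int where k0: "s 0 = q + of_int k0 * l" using eq_iff by blast
  \<comment> \<open>From a common value both lifts advance by an amount strictly between 0 and
    \<open>l\<close> to parameters of the same point, so they agree at the next index too.\<close>
  have s_eq: "s n = y n + real n * (l / 2) + of_int k0 * l" for n
  proof (induction n)
    case (Suc n)
    define z where "z = y (Suc n) + real (Suc n) * (l / 2) + of_int k0 * l"
    have "\<gamma> (s (Suc n)) = \<gamma> z"
      using s(1)[of "Suc n"] y(4)[of "Suc n"] by (simp add: z_def periodic_int ychord_altdef)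
    moreover have "real (Suc n) * (l / 2) = real n * (l / 2) + l / 2" by (simp add: field_simps)
    then have "\<bar>s (Suc n) - z\<bar> < l"
      using s(2,3)[of n] orbit_step(1)[OF y(1), of n] unfolding Suc z_def by linarith
    ultimately show ?case using eq_imp_eq z_def by blast
  qed (use k0 y in simp)
  have p4: "ychord (y 4 + 2 * l) (y 5 + 2 * l) = ychord (y 0) (y 1)"
    using periodic4[OF p] y(4)[of 4] y(4)[of 0] by (simp add: eval_nat_numeral algebra_simps)
  then have "\<gamma> (y 0) = \<gamma> (y 4 + 2 * l)" by (simp add: ychord_altdef)
  then obtain k' :: int where k': "y 4 + 2 * l = y 0 + of_int k' * l" using eq_iff by blast
  define k where "k = k' - 2"
  have k: "y 4 = y 0 + of_int k * l" using k' by (simp add: k_def algebra_simps)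
  have y5: "y 5 = y 1 + of_int k * l"
  proof -
    have "ychord (y 0) (y 5 - of_int k * l) = ychord (y 4 + 2 * l) (y 5 + 2 * l)"
      using periodic_int[of "y 0" "k + 2"] periodic_int[of "y 5 - of_int k * l" "k + 2"]
      unfolding k by (simp add: ychord_altdef g_def algebra_simps)
    then have eq: "ychord (y 0) (y 5 - of_int k * l) = ychord (y 0) (y 1)" using p4 by simp
    have "\<bar>y 4 - y 5\<bar> < l / 2" "\<bar>y 0 - y 1\<bar> < l / 2"
      using orbit_step(1)[OF y(1), of 4] orbit_step(1)[OF y(1), of 0] by (simp_all add: eval_nat_numeral)
    then have near: "\<bar>y 0 - (y 5 - of_int k * l)\<bar> < l / 2" "\<bar>y 0 - y 1\<bar> < l / 2"
      using k by linarith+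
    have "y 5 - of_int k * l = y 1" by (rule ychord_eq_imp[OF near eq])
    then show ?thesis by simp
  qed
  have "y (n + 4) + of_int (- k) * l = y n" for n
  proof (rule conjunct1[OF orbit_unique[OF orbit_shift[OF y(1)] y(1)]])
    show "y (0 + 4) + of_int (- k) * l = y 0" "y (1 + 4) + of_int (- k) * l = y 1"
      using k y5 by simp_all
  qed
  then have per: "y (n + 4) = y n + of_int k * l" for n by (simp add: algebra_simps)
  have y4j: "y (4 * j) = y 0 + real j * of_int k * l" for j
  proof (induction j)
    case (Suc j)
    then show ?case using per[of "4 * j"] by (simp add: algebra_simps)
  qed simp
  have "s (4 * Suc j) - s 0 = real (4 * Suc j) * l * ((of_int k + 2) / 4)" for j
    unfolding s_eq y4j by (simp add: field_simps)
  then have "(s (4 * Suc j) - s 0) / (real (4 * Suc j) * l) = (of_int k + 2) / 4" for j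
    using l_pos by simp
  moreover have "(\<lambda>j. (s (4 * Suc j) - s 0) / (real (4 * Suc j) * l)) \<longlonglongrightarrow> 1 / 4"
    using LIMSEQ_subseq_LIMSEQ[OF lim, of "\<lambda>j. 4 * Suc j"] by (simp add: strict_mono_def o_def)
  ultimately have "(of_int k + 2) / 4 = (1 / 4 :: real)"
    using LIMSEQ_const_iff by (metis (no_types, lifting) LIMSEQ_unique tendsto_const ext)
  then have "real_of_int k = - 1" by (simp add: field_simps)
  then have "k = - 1" by linarith
  then have "y (n + 4) = y n - l" for n using per[of n] by simp
  then show thesis using that[OF y(1,2,4)] by blast
qed

lemma rotational:
  obtains f where "simple_path f" "pathfinish f = pathstart f" "path_image f = \<alpha>"
    "\<And>z. z \<in> K \<Longrightarrow> winding_number (fst \<circ> f) z = 1"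
  using invariant unfolding invariant_curve_def rotational_curve_def by blast

lemma connected_alpha: "connected \<alpha>"
proof -
  obtain f where f: "simple_path f" "path_image f = \<alpha>" by (rule rotational)
  then show ?thesis using connected_simple_path_image by blast
qed

text \<open>No line of \<alpha> passes through the centre, so \<open>side\<close> has constant sign
  on this connected set. Since \<open>y\<close> drops by \<open>l\<close> over four steps, some step
  is downward, and there the sign is positive.\<close>

lemma side_alpha:
  assumes "p \<in> \<alpha>"
  shows "side p > 0"
proof -
  have nz: "side x \<noteq> 0" if x: "x \<in> \<alpha>" for x
  proof -
    obtain q where "fst x = \<gamma> q" using phase_cylinder_base[OF subsetD[OF alpha_subset x]] .
    then obtain y where y: "orbit y" "y 0 = q"
        "\<And>n. (T ^^ n) x = ychord (y n + real n * (l / 2)) (y (Suc n) + real n * (l / 2))"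
        "\<And>n. y (n + 4) = y n - l"
      using alpha_orbit[OF x] by metis
    have "x = ychord (y 0) (y 1)" using y(3)[of 0] by simp
    then show ?thesis
      using side_ychord[OF orbit_step(1)[OF y(1), of 0]] orbit_not_through_centre[OF y(1,4)] by auto
  qed
  obtain q where "fst p = \<gamma> q" using phase_cylinder_base[OF subsetD[OF alpha_subset assms]] .
  then obtain y where y: "orbit y" "y 0 = q"
      "\<And>n. (T ^^ n) p = ychord (y n + real n * (l / 2)) (y (Suc n) + real n * (l / 2))"
      "\<And>n. y (n + 4) = y n - l"
    using alpha_orbit[OF assms] by metis
  have "\<exists>n. y (Suc n) < y n"
  proof (rule ccontr)
    assume "\<nexists>n. y (Suc n) < y n"
    then have "y n \<le> y (Suc n)" for n by (simp add: not_less)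
    then have "y 0 \<le> y 4" using lift_Suc_mono_le[of y 0 4] by blast
    then show False using y(4)[of 0] l_pos by simp
  qed
  then obtain n where n: "y (Suc n) < y n" by blast
  have "\<bar>(y n + real n * (l / 2)) - (y (Suc n) + real n * (l / 2))\<bar> < l / 2"
    using orbit_step(1)[OF y(1), of n] by simp
  from side_ychord(1)[OF this] n have pos: "side ((T ^^ n) p) > 0"
    unfolding y(3) by simp
  have "connected (side ` \<alpha>)" by (intro connected_continuous_image continuous_on_side connected_alpha)
  from connectedD_interval[OF this imageI[OF assms] imageI[OF funpow_in_alpha[OF assms, of n]]]
  have "0 \<in> side ` \<alpha>" if "side p \<le> 0"
    using that pos by simp
  then show ?thesis using nz by (metis imageE not_less)
qed

lemma alpha_decreasing:
  assumes "p \<in> \<alpha>" "fst p = \<gamma> q"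
  obtains y where "orbit y" "y 0 = q" "p = ychord (y 0) (y 1)"
    "\<And>n. y (n + 4) = y n - l" "\<And>n. y (Suc n) < y n"
    "T p = ychord (y 1 + l / 2) (y 2 + l / 2)"
proof -
  obtain y where y: "orbit y" "y 0 = q"
      "\<And>n. (T ^^ n) p = ychord (y n + real n * (l / 2)) (y (Suc n) + real n * (l / 2))"
      "\<And>n. y (n + 4) = y n - l"
    using alpha_orbit[OF assms] by metis
  have dec: "y (Suc n) < y n" for n
  proof -
    have "\<bar>(y n + real n * (l / 2)) - (y (Suc n) + real n * (l / 2))\<bar> < l / 2"
      using orbit_step(1)[OF y(1), of n] by simp
    from side_ychord(1)[OF this] show ?thesis
      using side_alpha[OF funpow_in_alpha[OF assms(1), of n]] unfolding y(3) by simp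
  qed
  show thesis
  proof (rule that[OF y(1,2)])
    show "p = ychord (y 0) (y 1)" using y(3)[of 0] by simp
    show "T p = ychord (y 1 + l / 2) (y 2 + l / 2)"
      using y(3)[of 1] by (simp add: eval_nat_numeral)
  qed (rule y(4) dec)+
qed

text \<open>If a boundary point were missed, a ball around it would join the interior to the
  exterior without meeting the projected loop, whose winding number about interior points would then
  be 0.\<close>

lemma fst_alpha: "fst ` \<alpha> = range \<gamma>"
proof
  show "fst ` \<alpha> \<subseteq> range \<gamma>" using alpha_subset by (force simp: phase_cylinder_def)
  show "range \<gamma> \<subseteq> fst ` \<alpha>"
  proof (rule ccontr)
    assume "\<not> range \<gamma> \<subseteq> fst ` \<alpha>"
    then obtain q where q: "\<gamma> q \<notin> fst ` \<alpha>" by blast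
    obtain f where f: "simple_path f" "pathfinish f = pathstart f" "path_image f = \<alpha>"
      "\<And>z. z \<in> K \<Longrightarrow> winding_number (fst \<circ> f) z = 1" by (rule rotational) blast
    obtain z where z: "z \<in> K" using jordan(3) by blast
    define S where "S = path_image (fst \<circ> f)"
    have S_eq: "S = fst ` \<alpha>" using f(3) by (simp add: S_def path_image_compose)
    have "path (fst \<circ> f)"
      by (intro path_continuous_image simple_path_imp_path f continuous_on_fst continuous_on_id)
    moreover have "pathfinish (fst \<circ> f) = pathstart (fst \<circ> f)" using f(2) by (simp add: pathfinish_compose pathstart_compose)
    moreover have "z \<in> outside S"
    proof -
      have Sr: "S \<subseteq> range \<gamma>" using \<open>fst ` \<alpha> \<subseteq> range \<gamma>\<close> S_eq by simp
      have "closed S" using \<open>path (fst \<circ> f)\<close> closed_path_image S_def by blast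
      then obtain e where e: "e > 0" "ball (\<gamma> q) e \<inter> S = {}"
        using q S_eq by (metis open_contains_ball open_Compl ComplI disjoint_eq_subset_Compl inf_commute)
      have "frontier (outside (range \<gamma>)) = range \<gamma>"
        using Jordan_inside_outside[OF simple] path_image_eq periodic[of 0] by (simp add: pathfinish_def pathstart_def)
      then have "\<gamma> q \<in> closure (outside (range \<gamma>))" by (metis frontier_def DiffE rangeI)
      then obtain w where w: "w \<in> outside (range \<gamma>)" "w \<in> ball (\<gamma> q) e"
        using e(1) unfolding closure_approachable by (auto simp: dist_commute)
      have "\<gamma> q \<in> closure K" by (rule gamma_in_closure)
      then obtain v where v: "v \<in> K" "v \<in> ball (\<gamma> q) e"
        using e(1) unfolding closure_approachable by (auto simp: dist_commute)
      have "connected K" using convex_K convex_connected by blast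
      have "connected (K \<union> ball (\<gamma> q) e)"
        using \<open>connected K\<close> v by (intro connected_Un) auto
      moreover have "(K \<union> ball (\<gamma> q) e) \<inter> S = {}" using e(2) Sr jordan(6) by blast
      ultimately have "K \<union> ball (\<gamma> q) e \<subseteq> connected_component_set (- S) w"
        by (intro connected_component_maximal) (use w in auto)
      then have cc: "connected_component (- S) w z" using z by auto
      have "w \<in> outside S" using w(1) outside_mono[OF Sr] by blast
      then show ?thesis using cc outside_same_component by blast
    qed
    ultimately have "winding_number (fst \<circ> f) z = 0"
      unfolding S_def by (rule winding_number_zero_in_outside)
    then show False using f(4)[OF z] by simp
  qed
qed

lemma reverse_ychord:
  assumes "\<bar>a - b\<bar> < l / 2"
  shows "reverse_line \<gamma> (ychord a b) = ychord (b + l / 2) (a + l / 2)"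
proof -
  have "reverse_line \<gamma> (ychord a b) = chord (b + l / 2) a"
    unfolding ychord_def by (rule reverse_line_chord[OF ychord_ne[OF assms]])
  also have "\<dots> = ychord (b + l / 2) (a + l / 2)"
  proof -
    have "a + l / 2 + l / 2 = a + l" by simp
    then show ?thesis unfolding ychord_def chord_def by (simp only: periodic)
  qed
  finally show ?thesis .
qed

definition \<alpha>' :: "oriented_line set" where "\<alpha>' = reverse_line \<gamma> ` \<alpha>"

lemma alpha'_cases:
  assumes "p \<in> \<alpha>'"
  obtains a b where "\<bar>a - b\<bar> < l / 2" "a < b" "p = ychord a b"
proof -
  obtain p0 where p0: "p0 \<in> \<alpha>" "p = reverse_line \<gamma> p0" using assms by (auto simp: \<alpha>'_def)
  obtain q where "fst p0 = \<gamma> q" using phase_cylinder_base[OF subsetD[OF alpha_subset p0(1)]] .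
  then obtain y where y: "orbit y" "p0 = ychord (y 0) (y 1)" "\<And>n. y (Suc n) < y n"
    using alpha_decreasing[OF p0(1)] by metis
  have near: "\<bar>y 0 - y 1\<bar> < l / 2" using orbit_step(1)[OF y(1), of 0] by simp
  show thesis
    by (rule that[of "y 1 + l / 2" "y 0 + l / 2"])
      (use near y(3)[of 0] p0(2) y(2) reverse_ychord[OF near] in auto)
qed

lemma side_alpha': "p \<in> \<alpha>' \<Longrightarrow> side p < 0"
  using alpha'_cases side_ychord(2) by metis

lemma alpha'_subset: "\<alpha>' \<subseteq> \<A>"
  using alpha'_cases ychord_in_phase_cylinder by (metis subsetI)

lemma fst_alpha': "fst ` \<alpha>' = range \<gamma>"
proof
  show "fst ` \<alpha>' \<subseteq> range \<gamma>" using alpha'_subset by (force simp: phase_cylinder_def)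
  show "range \<gamma> \<subseteq> fst ` \<alpha>'"
  proof
    fix x assume "x \<in> range \<gamma>"
    then have "x \<in> fst ` \<alpha>" by (simp only: fst_alpha)
    then obtain p1 where p1: "p1 \<in> \<alpha>" "fst p1 = x" by blast
    have "T ` \<alpha> = \<alpha>" using invariant by (simp only: invariant_curve_def)
    then have "p1 \<in> T ` \<alpha>" using p1(1) by simp
    then obtain p0 where p0: "p0 \<in> \<alpha>" "p1 = T p0" by blast
    have "fst p0 \<in> range \<gamma>" using imageI[OF p0(1), of fst] by (simp only: fst_alpha)
    then obtain q where q: "fst p0 = \<gamma> q" by blast
    obtain y where y: "orbit y" "p0 = ychord (y 0) (y 1)"
        "T p0 = ychord (y 1 + l / 2) (y 2 + l / 2)"
      by (rule alpha_decreasing[OF p0(1) q])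
    have "\<bar>y 0 - y 1\<bar> < l / 2" using orbit_step(1)[OF y(1), of 0] by simp
    then have "reverse_line \<gamma> p0 = ychord (y 1 + l / 2) (y 0 + l / 2)"
      unfolding y(2) by (rule reverse_ychord)
    moreover have "\<gamma> (y 1 + l / 2) = x"
      using p1(2) unfolding p0(2) y(3) by (simp only: ychord_altdef fst_conv)
    ultimately have "fst (reverse_line \<gamma> p0) = x"
      by (simp only: ychord_altdef fst_conv)
    then show "x \<in> fst ` \<alpha>'" using p0(1) unfolding \<alpha>'_def by blast
  qed
qed

text \<open>Reversal runs an orbit of \<alpha> backward in time and shifts it by half a
  period.\<close>

lemma alpha'_orbit:
  assumes p: "ychord q t \<in> \<alpha>'" "\<bar>q - t\<bar> < l / 2"
  obtains a where "orbit a" "a 0 = q" "a 1 = t" "\<And>n. a n < a (Suc n)" "\<And>n. a (n + 4) = a n + l"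
proof -
  obtain p0 where p0: "p0 \<in> \<alpha>" "ychord q t = reverse_line \<gamma> p0" using p by (auto simp: \<alpha>'_def)
  obtain q0 where "fst p0 = \<gamma> q0" using phase_cylinder_base[OF subsetD[OF alpha_subset p0(1)]] .
  then obtain y where y: "orbit y" "p0 = ychord (y 0) (y 1)" "\<And>n. y (n + 4) = y n - l" "\<And>n. y (Suc n) < y n"
    using alpha_decreasing[OF p0(1)] by metis
  have near: "\<bar>y 0 - y 1\<bar> < l / 2" using orbit_step(1)[OF y(1), of 0] by simp
  have eq: "ychord q t = ychord (y 1 + l / 2) (y 0 + l / 2)" using p0(2) y(2) reverse_ychord[OF near] by simp
  then have "\<gamma> (y 1 + l / 2) = \<gamma> q" by (simp add: ychord_altdef)
  then obtain k :: int where k: "q = y 1 + l / 2 + of_int k * l" using eq_iff by blast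
  have t: "t = y 0 + l / 2 + of_int k * l"
  proof (rule ychord_eq_imp[OF p(2)])
    show "\<bar>q - (y 0 + l / 2 + of_int k * l)\<bar> < l / 2" using near by (simp add: k abs_minus_commute)
    show "ychord q t = ychord q (y 0 + l / 2 + of_int k * l)"
      unfolding eq using periodic_int[of "y 1 + l / 2" k] periodic_int[of "y 0 + l / 2" k]
      by (simp add: k ychord_altdef g_def)
  qed
  \<comment> \<open>One step back equals three steps forward plus \<open>l\<close>: formally
    \<open>y (1 - n) = y (3 * n + 1) + n * l\<close>, which avoids negative indices.\<close>
  define a where "a = (\<lambda>n. y (3 * n + 1) + real n * l + l / 2 + of_int k * l)"
  have a0: "a n = y (3 * n + 5) + (l / 2 + of_int (int n + 1 + k) * l)" for n
    using y(3)[of "3 * n + 1"] by (simp add: a_def algebra_simps)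
  have a1: "a (Suc n) = y (3 * n + 4) + (l / 2 + of_int (int n + 1 + k) * l)" for n
    by (simp add: a_def algebra_simps)
  have a2: "a (Suc (Suc n)) = y (3 * n + 3) + (l / 2 + of_int (int n + 1 + k) * l)" for n
    using y(3)[of "3 * n + 3"] by (simp add: a_def algebra_simps)
  have sh: "P (x + (l / 2 + of_int j * l)) (z + (l / 2 + of_int j * l)) = P x z" for x z j
    using P_periodic_int[of "x + l / 2" j "z + l / 2"] by (simp add: P_shift add.assoc)
  show thesis
  proof
    show "orbit a"
      unfolding orbit_def
    proof (intro allI conjI)
      fix n
      have e: "3 * n + 5 = Suc (3 * n + 4)" "3 * n + 4 = Suc (3 * n + 3)" by simp_all
      show "\<bar>a n - a (Suc n)\<bar> < l / 2"
        unfolding a0[of n] a1[of n] using orbit_step(2)[OF y(1), of "3 * n + 4"] by (simp add: e(1))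
      have "P (y (3 * n + 4)) (y (3 * n + 3)) + P (y (3 * n + 4)) (y (3 * n + 5)) = 0"
        using orbit_eq[OF y(1), of "3 * n + 3"] by (simp add: e)
      then show "P (a (Suc n)) (a n) + P (a (Suc n)) (a (Suc (Suc n))) = 0"
        by (simp only: a2[of n] a1[of n] a0[of n] sh add.commute)
    qed
    show "a 0 = q" by (simp add: a_def k)
    show "a 1 = t" using y(3)[of 0] by (simp add: a_def t)
    show "a n < a (Suc n)" for n unfolding a0[of n] a1[of n] using y(4)[of "3 * n + 4"] by (simp add: eval_nat_numeral)
    show "a (n + 4) = a n + l" for n
      using y(3)[of "3 * n + 1"] y(3)[of "3 * n + 5"] y(3)[of "3 * n + 9"] by (simp add: a_def algebra_simps)
  qed
qed

end

section \<open>The topology of the phase cylinder\<close>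

lemma homeomorphism_locally_connected:
  fixes S :: "'a::metric_space set" and T :: "'b::metric_space set"
  assumes "homeomorphism S T f g" "locally connected S"
  shows "locally connected T"
  using homeomorphic_locally[of S T connected connected] assms homeomorphic_connectedness
  by (auto simp: homeomorphic_def)

lemma arc_continuous_image_inj:
  assumes "arc h" "continuous_on (path_image h) f" "inj_on f (path_image h)"
  shows "arc (f \<circ> h)"
  using assms unfolding arc_def path_image_def
  by (auto intro: path_continuous_image[unfolded path_image_def] comp_inj_on)

lemma simple_path_continuous_image_inj:
  assumes "simple_path h" "continuous_on (path_image h) f" "inj_on f (path_image h)"
  shows "simple_path (f \<circ> h)"
proof -
  have "path (f \<circ> h)" using assms by (simp add: path_continuous_image simple_path_imp_path)
  moreover have "loop_free (f \<circ> h)"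
    unfolding loop_free_def
  proof (intro ballI impI)
    fix x y :: real assume xy: "x \<in> {0..1}" "y \<in> {0..1}" "(f \<circ> h) x = (f \<circ> h) y"
    then have "h x = h y" using assms(3) unfolding inj_on_def path_image_def by auto
    then show "x = y \<or> x = 0 \<and> y = 1 \<or> x = 1 \<and> y = 0"
      using assms(1) xy unfolding simple_path_def loop_free_def by blast
  qed
  ultimately show ?thesis by (simp add: simple_path_def)
qed

text \<open>The chart onto an open planar set transports local connectedness and two facts of plane
  topology: an arc does not separate, and Janiszewski's theorem.\<close>

locale charted =
  fixes X :: "'a::real_normed_vector set" and W :: "complex set" and \<Psi> :: "complex \<Rightarrow> 'a" and \<Phi> :: "'a \<Rightarrow> complex"
  assumes openW: "open W" and homeo: "homeomorphism W X \<Psi> \<Phi>"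
begin

lemma component_openin:
  assumes "open O'"
  shows "openin (top_of_set (X \<inter> O')) (connected_component_set (X \<inter> O') x)"
proof -
  have "locally connected X"
    using homeomorphism_locally_connected[OF homeo] open_imp_locally_connected[OF openW] by blast
  then have "locally connected (X \<inter> O')"
    by (rule locally_open_subset) (use assms in \<open>auto simp: openin_open\<close>)
  then show ?thesis by (rule openin_connected_component_locally_connected)
qed

text \<open>Removing a subarc of \<open>\<alpha>\<close> instead of the whole curve does not disconnect \<open>a\<close> from \<open>p0\<close>, by
  Janiszewski's theorem; hence the component of \<open>p0\<close> reaches every neighbourhood of \<open>a\<close>.\<close>

lemma curve_subset_closure_component:
  assumes f: "simple_path f" "pathfinish f = pathstart f" "path_image f = \<alpha>"
    and sub: "\<alpha> \<subseteq> X" and \<beta>: "compact \<beta>" "\<beta> \<subseteq> X"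
    and A: "connected A" "A \<subseteq> X - \<beta>" "p0 \<in> A" "\<alpha> \<subseteq> A" and p0: "p0 \<notin> \<alpha>"
  shows "\<alpha> \<subseteq> closure (connected_component_set (X - (\<alpha> \<union> \<beta>)) p0)"
proof
  define C where "C = connected_component_set (X - (\<alpha> \<union> \<beta>)) p0"
  fix a assume a: "a \<in> \<alpha>"
  show "a \<in> closure (connected_component_set (X - (\<alpha> \<union> \<beta>)) p0)"
  proof (rule ccontr)
    assume "a \<notin> closure (connected_component_set (X - (\<alpha> \<union> \<beta>)) p0)"
    then obtain U where U: "open U" "a \<in> U" "U \<inter> C = {}"
      unfolding C_def[symmetric] using open_Int_closure_eq_empty[of "- closure C" C]
      by (meson Compl_iff closure_subset disjoint_eq_subset_Compl compl_le_compl_iff open_Compl closed_closure)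
    obtain s where s: "s \<in> {0..1}" "f s = a" using a f(3) by (auto simp: path_image_def)
    \<comment> \<open>Starting the loop at \<open>a\<close> makes the part near \<open>a\<close> the
      two end pieces; the arc \<open>k\<close> between them misses \<open>a\<close>, and the rest of
      \<alpha> lies in \<open>U\<close>.\<close>
    define h where "h = shiftpath s f"
    have h: "simple_path h" "path_image h = \<alpha>"
      using simple_path_shiftpath[OF f(1,2)] path_image_shiftpath[OF _ f(2)] s f(3) by (auto simp: h_def)
    have h01: "h 0 = a" "h 1 = a"
      using s f(2) by (auto simp: h_def shiftpath_def pathfinish_def pathstart_def)
    have hc: "continuous_on {0..1} h" using h(1) by (simp add: simple_path_def path_def)
    have "openin (top_of_set {0..1}) ({0..1} \<inter> h -` U)"
      using continuous_openin_preimage_gen[OF hc U(1)] .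
    then obtain V where V: "open V" "{0..1} \<inter> h -` U = {0..1} \<inter> V" by (auto simp: openin_open)
    have "0 \<in> {0..1} \<inter> h -` U" "1 \<in> {0..1} \<inter> h -` U" using h01 U(2) by auto
    then have "0 \<in> V" "1 \<in> V" using V(2) by auto
    then obtain d0 d1 where d0: "d0 > 0" "ball 0 d0 \<subseteq> V" and d1: "d1 > 0" "ball 1 d1 \<subseteq> V"
      using V(1) open_contains_ball by metis
    define d where "d = min (min d0 d1) (1/2) / 2"
    have d: "0 < d" "d < d0" "d < d1" "d < 1 / 2" using d0(1) d1(1) by (auto simp: d_def)
    have endU: "h t \<in> U" if "t \<in> {0..1}" "t \<le> d \<or> 1 - d \<le> t" for t
    proof -
      have "t \<in> V" using that d d0(2) d1(2) by (auto simp: subset_iff dist_real_def)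
      then have "t \<in> {0..1} \<inter> V" using that(1) by simp
      then have "t \<in> {0..1} \<inter> h -` U" by (simp only: V(2))
      then show ?thesis by simp
    qed
    define k where "k = subpath d (1 - d) h"
    have k: "arc k" unfolding k_def
      by (rule arc_simple_path_subpath_interior[OF h(1)]) (use d in auto)
    have ki: "path_image k = h ` {d..1 - d}" unfolding k_def using path_image_subpath[of d "1 - d" h] d by auto
    have kX: "path_image k \<subseteq> \<alpha>" using ki h(2) d by (auto simp: path_image_def)
    have ak: "a \<notin> path_image k"
    proof
      assume "a \<in> path_image k"
      then obtain t where "t \<in> {d..1 - d}" "h t = h 0" using ki h01 by auto
      then show False using h(1) d unfolding simple_path_def loop_free_def by force
    qed
    have rest: "\<alpha> - path_image k \<subseteq> U"
    proof
      fix x assume x: "x \<in> \<alpha> - path_image k"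
      then obtain t where t: "t \<in> {0..1}" "x = h t" using h(2) by (auto simp: path_image_def)
      then have "t \<notin> {d..1 - d}" using x ki by auto
      then show "x \<in> U" using endU[OF t(1)] t by auto
    qed
    have \<Psi>: "continuous_on W \<Psi>" "\<Psi> ` W = X"
      and \<Psi>\<Phi>: "\<And>x. x \<in> X \<Longrightarrow> \<Psi> (\<Phi> x) = x" and \<Phi>\<Psi>: "\<And>x. x \<in> W \<Longrightarrow> \<Phi> (\<Psi> x) = x"
      using homeo unfolding homeomorphism_def by simp_all
    have "inj_on \<Phi> X" by (rule inj_on_inverseI[where g = \<Psi>]) (rule \<Psi>\<Phi>)
    then have \<Phi>: "continuous_on X \<Phi>" "inj_on \<Phi> X" "\<Phi> ` X = W"
      using homeo unfolding homeomorphism_def by simp_all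
    define S where "S = path_image (\<Phi> \<circ> k)"
    have S_eq: "S = \<Phi> ` path_image k" by (simp add: S_def path_image_compose)
    have "arc (\<Phi> \<circ> k)"
      by (rule arc_continuous_image_inj[OF k continuous_on_subset[OF \<Phi>(1)] inj_on_subset[OF \<Phi>(2)]])
        (use kX sub in auto)
    then have S: "compact S" "connected (- S)"
      unfolding S_def using connected_arc_complement[of "\<Phi> \<circ> k"] by (auto simp: compact_arc_image)
    \<comment> \<open>The second closed set for Janiszewski's theorem: everything outside the chart
      together with \<beta>. It is disjoint from the arc \<open>S\<close>, so the intersection is
      trivially connected.\<close>
    define T where "T = - (W - \<Phi> ` \<beta>)"
    have "compact (\<Phi> ` \<beta>)" by (rule compact_continuous_image[OF continuous_on_subset[OF \<Phi>(1) \<beta>(2)] \<beta>(1)])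
    then have "open (W - \<Phi> ` \<beta>)" using openW compact_imp_closed by blast
    then have "closed T" unfolding T_def by (rule closed_Compl)
    have aX: "a \<in> X" "p0 \<in> X" using a sub A by auto
    have \<Phi>T: "\<Phi> x \<notin> T" if "x \<in> X - \<beta>" for x
      using that \<Phi>(2,3) \<beta>(2) unfolding T_def inj_on_def by blast
    have "path_image k \<subseteq> X - \<beta>" using kX A by blast
    then have "S \<inter> T = {}" unfolding S_eq using \<Phi>T by blast
    then have 1: "connected (S \<inter> T)" by simp
    have "\<Phi> a \<notin> S" "\<Phi> p0 \<notin> S"
      using aX ak p0 kX sub \<Phi>(2) unfolding S_eq inj_on_def by blast+
    then have 2: "connected_component (- S) (\<Phi> a) (\<Phi> p0)"
      unfolding connected_component_def using S(2) by (intro exI[of _ "- S"]) auto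
    have 3: "connected_component (- T) (\<Phi> a) (\<Phi> p0)"
      unfolding connected_component_def
    proof (intro exI[of _ "\<Phi> ` A"] conjI)
      show "connected (\<Phi> ` A)"
        by (rule connected_continuous_image[OF continuous_on_subset[OF \<Phi>(1)] A(1)]) (use A(2) in auto)
      show "\<Phi> ` A \<subseteq> - T" using A(2) \<Phi>T by blast
    qed (use A a in auto)
    have "connected_component (- (S \<union> T)) (\<Phi> a) (\<Phi> p0)"
      by (rule Janiszewski[OF S(1) \<open>closed T\<close> 1 2 3])
    then obtain D0 where D0: "connected D0" "D0 \<subseteq> - (S \<union> T)" "\<Phi> a \<in> D0" "\<Phi> p0 \<in> D0"
      unfolding connected_component_def by blast
    then have D0W: "D0 \<subseteq> W - \<Phi> ` \<beta>" by (auto simp: T_def)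
    define D where "D = \<Psi> ` D0"
    have D: "connected D" "a \<in> D" "p0 \<in> D" "D \<subseteq> X"
    proof -
      show "connected D" unfolding D_def
        by (rule connected_continuous_image[OF continuous_on_subset[OF \<Psi>(1)] D0(1)]) (use D0W in blast)
      show "a \<in> D" unfolding D_def using imageI[OF D0(3), of \<Psi>] \<Psi>\<Phi>[OF aX(1)] by simp
      show "p0 \<in> D" unfolding D_def using imageI[OF D0(4), of \<Psi>] \<Psi>\<Phi>[OF aX(2)] by simp
      show "D \<subseteq> X" unfolding D_def \<Psi>(2)[symmetric] using D0W by blast
    qed
    have D': "x \<notin> path_image k" "x \<notin> \<beta>" if x: "x \<in> D" for x
    proof -
      obtain w where w: "w \<in> D0" "x = \<Psi> w" using x unfolding D_def by blast
      have "w \<in> W" "w \<notin> S" "w \<notin> \<Phi> ` \<beta>" using w(1) D0(2) D0W by blast+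
      moreover have "\<Phi> x = w" using \<Phi>\<Psi>[OF \<open>w \<in> W\<close>] w(2) by simp
      ultimately show "x \<notin> path_image k" "x \<notin> \<beta>" unfolding S_eq by blast+
    qed
    define O' where "O' = - (\<alpha> \<union> \<beta>)"
    have "closed \<alpha>" using closed_path_image[OF simple_path_imp_path[OF f(1)]] f(3) by simp
    from closed_Un[OF this compact_imp_closed[OF \<beta>(1)]] have O': "open O'"
      unfolding O'_def by (rule open_Compl)
    have XO: "X - (\<alpha> \<union> \<beta>) = X \<inter> O'" by (auto simp: O'_def)
    have "openin (top_of_set (X \<inter> O')) C" unfolding C_def XO by (rule component_openin[OF O'])
    then obtain V1 where V1: "open V1" "C = (X \<inter> O') \<inter> V1" by (auto simp: openin_open)
    have "closedin (top_of_set (X \<inter> O')) C" unfolding C_def XO by (rule closedin_connected_component)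
    then obtain V2 where V2: "closed V2" "C = (X \<inter> O') \<inter> V2" by (auto simp: closedin_closed)
    have p0C: "p0 \<in> C" unfolding C_def using A p0 by auto
    \<comment> \<open>These split \<open>D\<close> into its part in \<open>C\<close> and the
      remainder; what \<open>D\<close> contains of \<alpha> avoids \<open>k\<close>, lies in
      \<open>U\<close>, and so belongs to the second set.\<close>
    define E1 E2 where "E1 = O' \<inter> V1" and "E2 = U \<union> (O' \<inter> - V2)"
    have "open E1" "open E2" using O' V1(1) V2(1) U(1) by (auto simp: E1_def E2_def)
    moreover have "D \<subseteq> E1 \<union> E2"
    proof
      fix x assume x: "x \<in> D"
      show "x \<in> E1 \<union> E2"
      proof (cases "x \<in> \<alpha>")
        case True
        then show ?thesis using rest D'[OF x] by (auto simp: E2_def)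
      next
        case False
        then have "x \<in> X \<inter> O'" using x D(4) D'[OF x] by (auto simp: O'_def)
        then show ?thesis using V1(2) V2(2) by (auto simp: E1_def E2_def)
      qed
    qed
    moreover have "E1 \<inter> E2 \<inter> D = {}"
    proof -
      have "x \<in> C" if "x \<in> E1" "x \<in> D" for x using that D(4) V1(2) by (auto simp: E1_def)
      moreover have "x \<notin> C" if "x \<in> E2" for x using that U(3) V2(2) by (auto simp: E2_def)
      ultimately show ?thesis by blast
    qed
    moreover have "E1 \<inter> D \<noteq> {}" using p0C D(3) V1(2) by (auto simp: E1_def)
    moreover have "E2 \<inter> D \<noteq> {}" using D(2) U(2) by (auto simp: E2_def)
    ultimately show False using D(1) unfolding connected_def by blast
  qed
qed

text \<open>The component is relatively closed off the two curves and open, so its frontier lies in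
  their union; the closure lemma gives the converse, with \<open>A\<close> and \<open>B\<close>
  joining \<open>p0\<close> to one curve while avoiding the other.\<close>

lemma component_subset_region:
  assumes f: "simple_path f" "pathfinish f = pathstart f" "path_image f = \<alpha>"
    and h: "simple_path h" "pathfinish h = pathstart h" "path_image h = \<beta>"
    and A: "connected A" "A \<subseteq> X - \<beta>" "p0 \<in> A" "\<alpha> \<subseteq> A"
    and B: "connected B" "B \<subseteq> X - \<alpha>" "p0 \<in> B" "\<beta> \<subseteq> B"
  shows "connected_component_set (X - (\<alpha> \<union> \<beta>)) p0 \<subseteq> region_bounded_by X \<alpha> \<beta>"
    and "openin (top_of_set X) (connected_component_set (X - (\<alpha> \<union> \<beta>)) p0)"
proof -
  define C where "C = connected_component_set (X - (\<alpha> \<union> \<beta>)) p0"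
  have cpt: "compact \<alpha>" "compact \<beta>" using f h compact_simple_path_image by metis+
  have p0: "p0 \<in> X" "p0 \<notin> \<alpha>" "p0 \<notin> \<beta>" using A B by auto
  define O' where "O' = - (\<alpha> \<union> \<beta>)"
  have O': "open O'" unfolding O'_def by (intro open_Compl closed_Un compact_imp_closed cpt)
  have XO: "X - (\<alpha> \<union> \<beta>) = X \<inter> O'" by (auto simp: O'_def)
  have "openin (top_of_set (X \<inter> O')) C" unfolding C_def XO by (rule component_openin[OF O'])
  then obtain V1 where V1: "open V1" "C = (X \<inter> O') \<inter> V1" by (auto simp: openin_open)
  then have C_eq: "C = X \<inter> (O' \<inter> V1)" by blast
  have op: "openin (top_of_set X) C" unfolding C_eq by (intro openin_open_Int open_Int O' V1(1))
  then show "openin (top_of_set X) (connected_component_set (X - (\<alpha> \<union> \<beta>)) p0)" unfolding C_def .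
  have "closedin (top_of_set (X \<inter> O')) C" unfolding C_def XO by (rule closedin_connected_component)
  then obtain V2 where V2: "closed V2" "C = (X \<inter> O') \<inter> V2" by (auto simp: closedin_closed)
  have "C \<subseteq> X" using V2(2) by auto
  have clo: "top_of_set X closure_of C = X \<inter> closure C"
    using \<open>C \<subseteq> X\<close> by (simp add: closure_of_subtopology inf.absorb2)
  have "\<alpha> \<subseteq> closure C" unfolding C_def
    by (rule curve_subset_closure_component[OF f _ cpt(2) _ A p0(2)]) (use A B in auto)
  moreover have "\<beta> \<subseteq> closure C" unfolding C_def
    using curve_subset_closure_component[OF h _ cpt(1) _ B p0(3)] A B by (auto simp: Un_commute)
  ultimately have "\<alpha> \<union> \<beta> \<subseteq> X \<inter> closure C" using A B by auto
  moreover have "(\<alpha> \<union> \<beta>) \<inter> C = {}" using V2(2) by (auto simp: O'_def)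
  moreover have "X \<inter> closure C - C \<subseteq> \<alpha> \<union> \<beta>"
  proof
    fix x assume x: "x \<in> X \<inter> closure C - C"
    have "closure C \<subseteq> V2" by (rule closure_minimal) (use V2 in auto)
    then show "x \<in> \<alpha> \<union> \<beta>" using x V2(2) by (auto simp: O'_def)
  qed
  ultimately have "top_of_set X frontier_of C = \<alpha> \<union> \<beta>"
    unfolding frontier_of_def clo interior_of_openin[OF op] by blast
  moreover have "C \<in> components (X - (\<alpha> \<union> \<beta>))"
    unfolding C_def by (rule componentsI) (use p0 in auto)
  moreover have "C \<subseteq> top_of_set X closure_of C" unfolding clo using \<open>C \<subseteq> X\<close> closure_subset by auto
  ultimately show "connected_component_set (X - (\<alpha> \<union> \<beta>)) p0 \<subseteq> region_bounded_by X \<alpha> \<beta>"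
    unfolding region_bounded_by_def C_def[symmetric] by blast
qed

end

section \<open>An annulus as a chart of the phase cylinder\<close>

lemma Arg_sgn:
  assumes "z \<noteq> 0"
  shows "Arg (sgn z) = Arg z"
proof -
  have "sgn z = of_real (inverse (norm z)) * z" by (simp add: sgn_div_norm scaleR_conv_of_real)
  moreover have "0 < inverse (norm z)" using assms by simp
  ultimately show ?thesis by (metis Arg_times_of_real)
qed

text \<open>The jump of \<open>Arg\<close> is a multiple of \<open>2 * pi\<close> and is absorbed by
  the period \<open>l\<close> of \<open>f\<close>. Near \<open>z0\<close> the continuous branch
  \<open>Arg (z / z0) + Arg z0\<close> can be used instead.\<close>

lemma continuous_on_periodic_Arg:
  fixes f :: "real \<Rightarrow> 'a::topological_space"
  assumes f: "continuous_on UNIV f" "\<And>(k::int) x. f (x + of_int k * l) = f x"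
    and r: "continuous_on S r" and S: "0 \<notin> S"
  shows "continuous_on S (\<lambda>z. f (l * Arg z / (2 * pi) + r z))"
  unfolding continuous_on_eq_continuous_within
proof
  fix z0 assume z0: "z0 \<in> S"
  then have "z0 \<noteq> 0" using S by auto
  define A where "A = (\<lambda>z. Arg (z / z0) + Arg z0)"
  have eq: "f (l * Arg z / (2 * pi) + r z) = f (l * A z / (2 * pi) + r z)" if "z \<in> S" for z
  proof -
    have "z \<noteq> 0" using that S by auto
    define w where "w = Ln (z / z0) + Ln z0"
    have "exp w = z" using \<open>z \<noteq> 0\<close> \<open>z0 \<noteq> 0\<close> by (simp add: w_def exp_add)
    moreover have "Im w = A z" using \<open>z \<noteq> 0\<close> \<open>z0 \<noteq> 0\<close> by (simp add: w_def A_def Arg_eq_Im_Ln)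
    ultimately obtain k :: int where "A z - of_int k * (2 * pi) = Arg z" using Arg_exp_diff_2pi[of w] by auto
    then have "A z = Arg z + of_int k * (2 * pi)" by simp
    then have "l * A z / (2 * pi) + r z = (l * Arg z / (2 * pi) + r z) + of_int k * l"
      by (simp add: field_simps)
    then show ?thesis using f(2) by metis
  qed
  have "z0 / z0 \<notin> \<real>\<^sub>\<le>\<^sub>0" using \<open>z0 \<noteq> 0\<close> by simp
  then have "isCont Arg (z0 / z0)" by (rule continuous_at_Arg)
  moreover have "isCont (\<lambda>z. z / z0) z0" using \<open>z0 \<noteq> 0\<close> by (intro continuous_intros)
  ultimately have "isCont (\<lambda>z. Arg (z / z0)) z0" by (rule isCont_o2[rotated])
  then have Argc: "continuous (at z0 within S) (\<lambda>z. Arg (z / z0))"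
    by (rule continuous_at_imp_continuous_within)
  have rc: "continuous (at z0 within S) r"
    using r z0 by (simp add: continuous_on_eq_continuous_within)
  have "continuous (at z0 within S) (\<lambda>z. l / (2 * pi) * (Arg (z / z0) + Arg z0) + r z)"
    by (rule continuous_add[OF continuous_mult[OF continuous_const continuous_add[OF Argc continuous_const]] rc])
  then have "continuous (at z0 within S) (\<lambda>z. l * A z / (2 * pi) + r z)"
    by (simp only: A_def times_divide_eq_left)
  moreover have "isCont f x" for x using f(1) by (simp add: continuous_on_eq_continuous_at)
  ultimately have "continuous (at z0 within S) (\<lambda>z. f (l * A z / (2 * pi) + r z))"
    by (rule continuous_within_compose3[rotated])
  then show "continuous (at z0 within S) (\<lambda>z. f (l * Arg z / (2 * pi) + r z))"
    by (rule continuous_transform_within[OF _ zero_less_one z0]) (simp only: eq)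
qed

context symmetric_table begin

definition arg_param :: "complex \<Rightarrow> real" where "arg_param z = l * Arg z / (2 * pi)"

text \<open>Log-polar coordinates: the argument is the rescaled entry parameter, and
  \<open>ln (norm z)\<close> is the reduced increment \<open>b - a\<close>, whose range gives the
  two radii.\<close>

definition annulus :: "complex set" where "annulus = {z. exp (- l / 2) < norm z \<and> norm z < exp (l / 2)}"

lemma open_annulus: "open annulus"
  unfolding annulus_def by (intro open_Collect_conj open_Collect_less continuous_intros)

definition annulus_line :: "complex \<Rightarrow> oriented_line"
  where "annulus_line z = ychord (arg_param z) (arg_param z + ln (norm z))"

lemma arg_param_eq:
  assumes "\<gamma> (arg_param z) = \<gamma> (arg_param z')"
  shows "Arg z = Arg z'"
proof -
  have "\<bar>Arg z - Arg z'\<bar> < 2 * pi" using mpi_less_Arg[of z] Arg_le_pi[of z] mpi_less_Arg[of z'] Arg_le_pi[of z'] by linarith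
  then have "l * \<bar>Arg z - Arg z'\<bar> < l * (2 * pi)" using l_pos by simp
  moreover have "l * \<bar>Arg z - Arg z'\<bar> / (2 * pi) = \<bar>arg_param z - arg_param z'\<bar>"
  proof -
    have "arg_param z - arg_param z' = l * (Arg z - Arg z') / (2 * pi)"
      by (simp add: arg_param_def algebra_simps diff_divide_distrib)
    then show ?thesis using l_pos by (simp add: abs_mult)
  qed
  ultimately have "\<bar>arg_param z - arg_param z'\<bar> < l" using pi_gt_zero by (simp add: field_simps)
  then have "arg_param z = arg_param z'" by (rule eq_imp_eq[OF assms])
  then show ?thesis using l_pos by (simp add: arg_param_def)
qed

lemma ln_annulus: "z \<in> annulus \<Longrightarrow> \<bar>ln (norm z)\<bar> < l / 2" and annulus_nonzero: "z \<in> annulus \<Longrightarrow> z \<noteq> 0"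
proof -
  assume z: "z \<in> annulus"
  then have "norm z > 0" using exp_gt_zero less_trans unfolding annulus_def by blast
  then show "z \<noteq> 0" by simp
  have "- l / 2 < ln (norm z)" "ln (norm z) < l / 2"
    using z \<open>norm z > 0\<close> ln_less_cancel_iff[of "exp (- l / 2)" "norm z"] ln_less_cancel_iff[of "norm z" "exp (l / 2)"]
    by (auto simp: annulus_def)
  then show "\<bar>ln (norm z)\<bar> < l / 2" by linarith
qed

lemma continuous_on_arg_param:
  assumes "continuous_on UNIV f" "\<And>(k::int) x. f (x + of_int k * l) = f x" "continuous_on S r" "S \<subseteq> annulus"
  shows "continuous_on S (\<lambda>z. f (arg_param z + r z))"
  unfolding arg_param_def
  by (rule continuous_on_periodic_Arg[OF assms(1-3)]) (use annulus_nonzero assms(4) in auto)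

lemma continuous_on_ychord_arg:
  assumes "continuous_on annulus r" "continuous_on annulus r'" "\<And>z. z \<in> annulus \<Longrightarrow> \<bar>r z - r' z\<bar> < l / 2"
  shows "continuous_on annulus (\<lambda>z. ychord (arg_param z + r z) (arg_param z + r' z))"
proof -
  have g: "continuous_on annulus (\<lambda>z. g (arg_param z + r z))" if "continuous_on annulus r" for r
    by (rule continuous_on_arg_param[OF _ _ that])
      (auto simp: g_def periodic_int intro!: continuous_intros continuous_on_gamma)
  have "continuous_on annulus (\<lambda>z. \<gamma> (arg_param z + r z))"
    by (rule continuous_on_arg_param[OF continuous_on_gamma periodic_int assms(1)]) auto
  moreover have "continuous_on annulus (\<lambda>z. - sgn (g (arg_param z + r z) + g (arg_param z + r' z)))"
    by (intro continuous_intros continuous_on_sgn g assms(1,2)) (use g_add_nonzero assms(3) in force)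
  ultimately show ?thesis unfolding ychord_altdef by (rule continuous_on_Pair)
qed

lemma continuous_on_ln_norm: "continuous_on annulus (\<lambda>z. ln (norm z))"
  using annulus_nonzero by (intro continuous_intros) auto

lemma inj_on_annulus:
  assumes "z \<in> annulus" "z' \<in> annulus" "\<gamma> (arg_param z) = \<gamma> (arg_param z')"
    "P (arg_param z) (arg_param z + ln (norm z)) = P (arg_param z') (arg_param z' + ln (norm z'))"
  shows "z = z'"
proof -
  have Arg: "Arg z = Arg z'" by (rule arg_param_eq[OF assms(3)])
  then have "arg_param z = arg_param z'" by (simp add: arg_param_def)
  then have "ln (norm z) = ln (norm z')"
    using assms(4) P_eq_iff[of "arg_param z'" "arg_param z' + ln (norm z)" "arg_param z' + ln (norm z')"]
      ln_annulus[OF assms(1)] ln_annulus[OF assms(2)] by simp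
  then have "norm z = norm z'" using annulus_nonzero assms(1,2) by (metis ln_inj_iff zero_less_norm_iff)
  then show ?thesis using Arg annulus_nonzero[OF assms(1)] annulus_nonzero[OF assms(2)] by (metis Arg_eq)
qed

lemma annulus_line_image: "annulus_line ` annulus = \<A>"
proof
  show "annulus_line ` annulus \<subseteq> \<A>"
    using ychord_in_phase_cylinder ln_annulus by (auto simp: annulus_line_def)
  show "\<A> \<subseteq> annulus_line ` annulus"
  proof
    fix p assume p: "p \<in> \<A>"
    then obtain s where s: "fst p = \<gamma> s" by (rule phase_cylinder_base)
    define k where "k = \<lfloor>s / l + 1 / 2\<rfloor>"
    define a where "a = s - of_int k * l"
    have "of_int k \<le> s / l + 1 / 2" "s / l + 1 / 2 < of_int k + 1" by (auto simp: k_def)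
    then have "of_int k * l \<le> (s / l + 1 / 2) * l" "(s / l + 1 / 2) * l < (of_int k + 1) * l"
      using mult_right_mono[of "of_int k" "s / l + 1 / 2" l]
        mult_strict_right_mono[of "s / l + 1 / 2" "of_int k + 1" l] l_pos by auto
    moreover have "(s / l + 1 / 2) * l = s + l / 2" "(of_int k + 1) * l = of_int k * l + l"
      using l_pos by (simp_all add: field_simps)
    ultimately have a: "- l / 2 \<le> a" "a < l / 2" unfolding a_def by linarith+
    have sa: "fst p = \<gamma> a" using s periodic_int[of a k] by (simp add: a_def)
    \<comment> \<open>The half-open interval is turned around to match the range of
      \<open>Arg\<close>, which contains \<open>pi\<close> but not \<open>- pi\<close>.\<close>
    obtain t where t: "- l / 2 < t" "t \<le> l / 2" "fst p = \<gamma> t"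
    proof (cases "a = - l / 2")
      case True
      then show thesis using that[of "l / 2"] sa periodic[of a] l_pos by simp
    qed (use a sa that[of a] in auto)
    obtain b where b: "\<bar>t - b\<bar> < l / 2" "p = ychord t b" using phase_cylinder_ychord[OF p t(3)] .
    define z where "z = of_real (exp (b - t)) * cis (2 * pi * t / l)"
    have nz: "norm z = exp (b - t)" by (simp add: z_def norm_mult)
    have "Arg z = 2 * pi * t / l"
    proof -
      have "- 1 < 2 * t / l" "2 * t / l \<le> 1" using t l_pos by (simp_all add: field_simps)
      then have "pi * - 1 < pi * (2 * t / l)" "pi * (2 * t / l) \<le> pi * 1"
        by (intro mult_strict_left_mono mult_left_mono; simp)+
      then have "- pi < 2 * pi * t / l" "2 * pi * t / l \<le> pi" by (simp_all add: ac_simps)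
      then show ?thesis by (simp add: z_def Arg_times_of_real2 Arg_cis)
    qed
    then have "arg_param z = t" using l_pos by (simp add: arg_param_def)
    moreover have "- l / 2 < b - t" "b - t < l / 2" using b(1) by linarith+
    then have "z \<in> annulus" by (simp add: annulus_def nz)
    ultimately show "p \<in> annulus_line ` annulus" using b(2) nz by (intro image_eqI[of _ _ z]) (auto simp: annulus_line_def)
  qed
qed

text \<open>Continuity of the inverse comes from invariance of domain, applied to the coordinates
  \<open>(cos \<delta>, s)\<close> placed in the plane as polar coordinates.\<close>

lemma annulus_chart:
  obtains \<Phi> where "homeomorphism annulus (\<A>) annulus_line \<Phi>"
proof -
  let ?P = "\<lambda>z. P (arg_param z) (arg_param z + ln (norm z))"
  have cont: "continuous_on annulus annulus_line"
    unfolding annulus_line_def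
    using continuous_on_ychord_arg[OF continuous_on_const[of _ 0] continuous_on_ln_norm] ln_annulus by simp
  define E where "E = (\<lambda>z. \<gamma> (arg_param z))"
  have sph: "sphere 0 1 \<subseteq> annulus" using l_pos by (auto simp: annulus_def)
  have Ec: "continuous_on (sphere 0 1) E"
    unfolding E_def using continuous_on_arg_param[OF continuous_on_gamma periodic_int continuous_on_const[of _ 0] sph] by simp
  have Einj: "inj_on E (sphere 0 1)"
  proof (rule inj_onI)
    fix z z' assume z: "z \<in> sphere 0 1" "z' \<in> sphere (0::complex) 1" "E z = E z'"
    have "Arg z = Arg z'" by (rule arg_param_eq) (use z in \<open>simp add: E_def\<close>)
    moreover have "norm z = 1" "norm z' = 1" using z by auto
    moreover have "z \<noteq> 0" "z' \<noteq> 0" using z by auto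
    ultimately show "z = z'" using Arg_eq by metis
  qed
  have Esgn: "E (sgn z) = \<gamma> (arg_param z)" if "z \<in> annulus" for z
  proof -
    have "Arg (sgn z) = Arg z" by (rule Arg_sgn[OF annulus_nonzero[OF that]])
    then show ?thesis by (simp add: E_def arg_param_def)
  qed
  obtain F where F: "homeomorphism (sphere 0 1) (E ` sphere 0 1) E F"
    using homeomorphism_compact[OF compact_sphere Ec refl Einj] by blast
  \<comment> \<open>A continuous planar image of the cylinder: position on the unit circle, radius
    the exponential of \<open>cos \<delta>\<close>. On a chart point that cosine is
    \<open>- P\<close>, so the twist condition makes the composite injective.\<close>
  define \<Theta> where "\<Theta> = (\<lambda>(x, u). of_real (exp (u \<bullet> \<tau> (arg_param (F x)))) * F x)"
  have \<Theta>_eq: "\<Theta> (annulus_line z) = of_real (exp (- ?P z)) * sgn z"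
    if z: "z \<in> annulus" for z
  proof -
    have sg: "sgn z \<in> sphere 0 1" using annulus_nonzero[OF z] by (simp add: norm_sgn)
    then have Fz: "F (\<gamma> (arg_param z)) = sgn z"
      using F Esgn[OF z] unfolding homeomorphism_def by metis
    have "arg_param (sgn z) = arg_param z"
      by (simp add: arg_param_def Arg_sgn[OF annulus_nonzero[OF z]])
    then show ?thesis by (simp add: \<Theta>_def annulus_line_def ychord_altdef Fz P_def inner_commute)
  qed
  have img: "x \<in> E ` sphere 0 1" if "(x, u) \<in> \<A>" for x u
  proof -
    obtain z where z: "z \<in> annulus" "(x, u) = annulus_line z" using \<open>(x, u) \<in> \<A>\<close> annulus_line_image by auto
    then have "x = E (sgn z)" using Esgn by (simp add: annulus_line_def ychord_altdef)
    moreover have "sgn z \<in> sphere 0 1" using annulus_nonzero[OF z(1)] by (simp add: norm_sgn)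
    ultimately show ?thesis by blast
  qed
  have \<Theta>c: "continuous_on (\<A>) \<Theta>"
  proof -
    have Fc: "continuous_on (E ` sphere 0 1) F" and Fi: "F ` (E ` sphere 0 1) = sphere 0 1"
      using F by (auto simp: homeomorphism_def)
    have 1: "continuous_on (\<A>) (\<lambda>p. F (fst p))"
      by (rule continuous_on_compose2[OF Fc continuous_on_fst[OF continuous_on_id]]) (use img in auto)
    have "continuous_on (sphere 0 1) (\<lambda>z. \<tau> (arg_param z))"
      using continuous_on_arg_param[OF continuous_on_velocity velocity_periodic_int continuous_on_const[of _ 0] sph] by simp
    then have 2: "continuous_on (\<A>) (\<lambda>p. \<tau> (arg_param (F (fst p))))"
    proof (rule continuous_on_compose2[OF _ 1])
      show "(\<lambda>p. F (fst p)) ` \<A> \<subseteq> sphere 0 1"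
        using img Fi by (metis (mono_tags, lifting) image_eqI image_subsetI prod.collapse)
    qed
    show ?thesis unfolding \<Theta>_def case_prod_unfold by (intro continuous_intros 1 2)
  qed
  have inj: "inj_on (\<Theta> \<circ> annulus_line) annulus"
  proof (rule inj_onI)
    fix z z' assume z: "z \<in> annulus" "z' \<in> annulus" and "(\<Theta> \<circ> annulus_line) z = (\<Theta> \<circ> annulus_line) z'"
    then have eq: "of_real (exp (- ?P z)) * sgn z =
        of_real (exp (- ?P z')) * sgn z'" (is "of_real ?a * _ = of_real ?b * _")
      using \<Theta>_eq by simp
    have n: "norm (sgn z) = 1" "norm (sgn z') = 1" using annulus_nonzero z by (auto simp: norm_sgn)
    have ab: "?a = ?b" using arg_cong[OF eq, of norm] n by (simp add: norm_mult)
    then have "sgn z = sgn z'" using eq by simp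
    then have "\<gamma> (arg_param z) = \<gamma> (arg_param z')" using Esgn z by metis
    then show "z = z'" using inj_on_annulus[OF z] ab by simp
  qed
  have "continuous_on annulus (\<Theta> \<circ> annulus_line)"
    by (rule continuous_on_compose[OF cont]) (simp add: annulus_line_image \<Theta>c)
  then obtain G' where G': "homeomorphism annulus ((\<Theta> \<circ> annulus_line) ` annulus) (\<Theta> \<circ> annulus_line) G'"
    using invariance_of_domain_homeomorphism[OF open_annulus _ _ inj] by auto
  have "homeomorphism annulus (\<A>) annulus_line (G' \<circ> \<Theta>)"
  proof (rule homeomorphismI)
    show "continuous_on annulus annulus_line" by (rule cont)
    have GG: "G' (\<Theta> (annulus_line z)) = z" if "z \<in> annulus" for z
      using G' that by (auto simp: homeomorphism_def)
    have "(\<Theta> \<circ> annulus_line) ` annulus = \<Theta> ` \<A>"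
      by (simp only: image_comp[symmetric] annulus_line_image)
    then have "continuous_on (\<Theta> ` \<A>) G'"
      using homeomorphism_cont2[OF G'] by simp
    then show "continuous_on (\<A>) (G' \<circ> \<Theta>)" by (rule continuous_on_compose[OF \<Theta>c])
    show "annulus_line ` annulus \<subseteq> \<A>" using annulus_line_image by simp
    show "(G' \<circ> \<Theta>) ` \<A> \<subseteq> annulus"
      unfolding annulus_line_image[symmetric] using GG by auto
    show "(G' \<circ> \<Theta>) (annulus_line z) = z" if "z \<in> annulus" for z using GG[OF that] by simp
    show "annulus_line ((G' \<circ> \<Theta>) p) = p" if "p \<in> \<A>" for p
      using that GG unfolding annulus_line_image[symmetric] by auto
  qed
  then show thesis by (rule that)
qed

text \<open>The exit parameter is a mere choice and need not be continuous. In the chart, however,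
  reversal takes reduced parameters \<open>(a, b)\<close> to
  \<open>(b + l / 2, a + l / 2)\<close>.\<close>

lemma continuous_on_reverse_line: "continuous_on (\<A>) (reverse_line \<gamma>)"
proof -
  obtain \<Phi> where \<Phi>: "homeomorphism annulus (\<A>) annulus_line \<Phi>" by (rule annulus_chart)
  have "continuous_on annulus (\<lambda>z. ychord (arg_param z + (ln (norm z) + l / 2)) (arg_param z + l / 2))"
    by (rule continuous_on_ychord_arg) (use ln_annulus in \<open>auto intro!: continuous_intros continuous_on_ln_norm\<close>)
  then have "continuous_on (\<A>) (\<lambda>p. ychord (arg_param (\<Phi> p) + (ln (norm (\<Phi> p)) + l / 2)) (arg_param (\<Phi> p) + l / 2))"
    by (rule continuous_on_compose2) (use \<Phi> in \<open>auto simp: homeomorphism_def\<close>)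
  then show ?thesis
  proof (rule continuous_on_eq)
    fix p assume p: "p \<in> \<A>"
    let ?a = "arg_param (\<Phi> p)" and ?r = "ln (norm (\<Phi> p))"
    from p have z: "\<Phi> p \<in> annulus" "annulus_line (\<Phi> p) = p" using \<Phi> by (auto simp: homeomorphism_def)
    have near: "\<bar>?a - (?a + ?r)\<bar> < l / 2"
      using ln_annulus[OF z(1)] by simp
    have "reverse_line \<gamma> (annulus_line (\<Phi> p)) = chord (?a + ?r + l / 2) (?a)"
      unfolding annulus_line_def ychord_def by (rule reverse_line_chord[OF ychord_ne[OF near]])
    also have "\<dots> = ychord (?a + (?r + l / 2)) (?a + l / 2)"
      using periodic[of "?a"] by (simp add: chord_def ychord_def add.assoc)
    finally show "ychord (?a + (?r + l / 2)) (?a + l / 2) = reverse_line \<gamma> p"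
      using z(2) by simp
  qed
qed

lemma reverse_line_reverse_line:
  assumes "p \<in> \<A>"
  shows "reverse_line \<gamma> (reverse_line \<gamma> p) = p"
proof -
  obtain s where "fst p = \<gamma> s" using phase_cylinder_base[OF assms] .
  then obtain t where t: "s < t" "t < s + l" "p = chord s t" using phase_cylinder_chord[OF assms] by metis
  have ne: "\<gamma> s \<noteq> \<gamma> t" "\<gamma> t \<noteq> \<gamma> s" using gamma_neq[OF t(1,2)] by auto
  show ?thesis unfolding t(3) reverse_line_chord[OF ne(1)] reverse_line_chord[OF ne(2)] ..
qed

end

section \<open>The two directions\<close>

context symmetric_table begin

lemma continuous_on_ychord:
  assumes "continuous_on S A" "continuous_on S B" "\<And>x. x \<in> S \<Longrightarrow> \<bar>A x - B x\<bar> < l / 2"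
  shows "continuous_on S (\<lambda>x. ychord (A x) (B x))"
proof -
  have \<gamma>: "continuous_on S (\<lambda>x. \<gamma> (f x))" if "continuous_on S f" for f
    using continuous_on_compose2[OF continuous_on_gamma[of UNIV] that] by simp
  then have g: "continuous_on S (\<lambda>x. g (f x))" if "continuous_on S f" for f
    unfolding g_def using that by (intro continuous_intros \<gamma>)
  have "continuous_on S (\<lambda>x. - sgn (g (A x) + g (B x)))"
    by (intro continuous_intros continuous_on_sgn g assms(1,2) ballI) (use g_add_nonzero assms(3) in force)
  then show ?thesis unfolding ychord_altdef by (intro continuous_on_Pair \<gamma> assms(1))
qed

text \<open>The centre is the midpoint of a chord and hence interior, so each ray from it meets the
  curve, necessarily at distance \<open>r\<close>.\<close>

lemma circle_of_constant_distance:
  assumes "\<And>s. norm (g s) = r"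
  shows "is_circle (range \<gamma>)"
proof -
  have h: "\<gamma> 0 \<noteq> \<gamma> (l / 2)" using gamma_neq[of 0 "l / 2"] l_pos by simp
  have "g 0 \<noteq> 0"
  proof
    assume "g 0 = 0"
    then show False using h g_half[of 0] by (simp add: g_def)
  qed
  then have r: "r > 0" using assms[of 0] by auto
  have "c = midpoint (\<gamma> 0) (\<gamma> (l / 2))"
    using half[of 0] by (simp add: midpoint_def complex_eq_iff)
  then have cK: "c \<in> K"
    using open_segment_subset_inside[OF h] midpoint_in_open_segment[of "\<gamma> 0" "\<gamma> (l / 2)"] h by auto
  have "sphere c r \<subseteq> range \<gamma>"
  proof
    fix x assume x: "x \<in> sphere c r"
    then have nx: "norm (x - c) = r" by (simp add: dist_norm norm_minus_commute)
    then have "x - c \<noteq> 0" using r by auto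
    then obtain d where d: "d > 0" "c + d *\<^sub>R (x - c) \<in> frontier K"
      using ray_to_frontier[OF jordan(2), of c "x - c"] cK jordan(1) by (auto simp: interior_open)
    then obtain s where s: "\<gamma> s = c + d *\<^sub>R (x - c)" using jordan(4) by auto
    then have "g s = d *\<^sub>R (x - c)" by (simp add: g_def)
    then have "d * r = r" using assms[of s] nx d(1) by simp
    then have "d = 1" using r by simp
    then show "x \<in> range \<gamma>" using s by (metis add_diff_cancel_left' add.commute diff_add_cancel rangeI scaleR_one)
  qed
  moreover have "range \<gamma> \<subseteq> sphere c r"
    using assms by (auto simp: g_def dist_norm norm_minus_commute)
  ultimately show ?thesis using r unfolding is_circle_def by blast
qed

end

context quarter_table begin

lemma alpha'_path:
  obtains f where "simple_path f" "pathfinish f = pathstart f" "path_image f = \<alpha>'"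
proof -
  obtain f where f: "simple_path f" "pathfinish f = pathstart f" "path_image f = \<alpha>" by (rule rotational)
  have inj: "inj_on (reverse_line \<gamma>) (path_image f)"
    using f(3) alpha_subset reverse_line_reverse_line by (intro inj_on_inverseI[of _ "reverse_line \<gamma>"]) auto
  have cont: "continuous_on (path_image f) (reverse_line \<gamma>)"
    using continuous_on_subset[OF continuous_on_reverse_line] alpha_subset f(3) by simp
  show thesis
  proof
    show "simple_path (reverse_line \<gamma> \<circ> f)" by (rule simple_path_continuous_image_inj[OF f(1) cont inj])
    show "pathfinish (reverse_line \<gamma> \<circ> f) = pathstart (reverse_line \<gamma> \<circ> f)"
      using f(2) by (simp add: pathfinish_def pathstart_def)
    show "path_image (reverse_line \<gamma> \<circ> f) = \<alpha>'" using f(3) by (simp add: path_image_compose \<alpha>'_def)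
  qed
qed

definition centre_component :: "real \<Rightarrow> oriented_line set"
  where "centre_component q = connected_component_set (\<A> - (\<alpha> \<union> \<alpha>')) (ychord q q)"

text \<open>The sets \<open>S (- 1)\<close> and \<open>S 1\<close> are the two closed halves of the
  cylinder, images of connected strips. Both contain the diameters; by the sign of
  \<open>side\<close> each contains one curve and misses the other.\<close>

lemma centre_component:
  shows "centre_component q \<subseteq> region_bounded_by (\<A>) \<alpha> \<alpha>'"
    and "openin (top_of_set (\<A>)) (centre_component q)"
proof -
  obtain \<Phi> where "homeomorphism annulus (\<A>) annulus_line \<Phi>" by (rule annulus_chart)
  then interpret charted "\<A>" annulus annulus_line \<Phi>
    by unfold_locales (rule open_annulus)
  obtain f where f: "simple_path f" "pathfinish f = pathstart f" "path_image f = \<alpha>" by (rule rotational)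
  obtain h where h: "simple_path h" "pathfinish h = pathstart h" "path_image h = \<alpha>'" by (rule alpha'_path)
  define S where "S = (\<lambda>\<sigma>. (\<lambda>(a, \<rho>). ychord a (a + \<sigma> * \<rho>)) ` (UNIV \<times> {0..<l / 2}))"
  have conn: "connected (S \<sigma>)" if "\<bar>\<sigma>\<bar> = 1" for \<sigma>
    unfolding S_def case_prod_unfold
  proof (rule connected_continuous_image)
    show "continuous_on (UNIV \<times> {0..<l / 2}) (\<lambda>p. ychord (fst p) (fst p + \<sigma> * snd p))"
      by (rule continuous_on_ychord) (use that in \<open>auto intro!: continuous_intros simp: abs_mult\<close>)
    show "connected (UNIV \<times> {0..<l / 2} :: (real \<times> real) set)" by (intro connected_Times) auto
  qed
  have q: "ychord q q \<in> S \<sigma>" for \<sigma>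
    unfolding S_def using l_pos by (intro image_eqI[of _ _ "(q, 0)"]) auto
  have SX: "S \<sigma> \<subseteq> \<A>" if "\<bar>\<sigma>\<bar> = 1" for \<sigma>
    unfolding S_def using that by (auto simp: abs_mult intro!: ychord_in_phase_cylinder)
  have "side p \<ge> 0" if pS: "p \<in> S (- 1)" for p
  proof -
    obtain a \<rho> where p: "p = ychord a (a - \<rho>)" "0 \<le> \<rho>" "\<rho> < l / 2" using pS by (auto simp: S_def)
    then have near: "\<bar>a - (a - \<rho>)\<bar> < l / 2" by simp
    show ?thesis using side_ychord(2)[OF near] p(2) unfolding p(1) by linarith
  qed
  then have A: "S (- 1) \<subseteq> \<A> - \<alpha>'" using SX[of "- 1"] side_alpha' by fastforce
  have "side p \<le> 0" if pS: "p \<in> S 1" for p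
  proof -
    obtain a \<rho> where p: "p = ychord a (a + \<rho>)" "0 \<le> \<rho>" "\<rho> < l / 2" using pS by (auto simp: S_def)
    then have near: "\<bar>a - (a + \<rho>)\<bar> < l / 2" by simp
    show ?thesis using side_ychord(1)[OF near] p(2) unfolding p(1) by linarith
  qed
  then have A': "S 1 \<subseteq> \<A> - \<alpha>" using SX[of 1] side_alpha by fastforce
  have \<alpha>S: "\<alpha> \<subseteq> S (- 1)"
  proof
    fix p assume p: "p \<in> \<alpha>"
    then have "fst p \<in> range \<gamma>" using fst_alpha by blast
    then obtain a where "fst p = \<gamma> a" by blast
    then obtain b where b: "\<bar>a - b\<bar> < l / 2" "p = ychord a b"
      using phase_cylinder_ychord[of p a] p alpha_subset by blast
    have "b < a" using side_alpha[OF p] side_ychord(1)[OF b(1)] b(2) by simp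
    then show "p \<in> S (- 1)" unfolding S_def using b by (intro image_eqI[of _ _ "(a, a - b)"]) auto
  qed
  have \<alpha>'S: "\<alpha>' \<subseteq> S 1"
  proof
    fix p assume "p \<in> \<alpha>'"
    then obtain a b where b: "\<bar>a - b\<bar> < l / 2" "a < b" "p = ychord a b" by (rule alpha'_cases)
    then show "p \<in> S 1" unfolding S_def by (intro image_eqI[of _ _ "(a, b - a)"]) auto
  qed
  show "centre_component q \<subseteq> region_bounded_by (\<A>) \<alpha> \<alpha>'"
    unfolding centre_component_def
    by (rule component_subset_region(1)[OF f h conn[of "- 1"] A q \<alpha>S conn[of 1] A' q \<alpha>'S]) auto
  show "openin (top_of_set (\<A>)) (centre_component q)"
    unfolding centre_component_def
    by (rule component_subset_region(2)[OF f h conn[of "- 1"] A q \<alpha>S conn[of 1] A' q \<alpha>'S]) auto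
qed

lemma compact_alpha': "compact \<alpha>'"
  using alpha'_path compact_simple_path_image by metis

text \<open>Here \<open>b\<close> is the lowest parameter at or above \<open>q\<close> where the
  fibre over \<open>\<gamma> q\<close> meets the reversed curve. Between \<open>q\<close> and
  \<open>b\<close> the fibre avoids \<alpha> by the sign of \<open>side\<close>; \<open>e\<close>
  comes from relative openness of the component.\<close>

lemma vertical_segment:
  obtains e b where "e < q" "q < b" "b < q + l / 2" "ychord q b \<in> \<alpha>'"
    "\<And>t. e < t \<Longrightarrow> t < b \<Longrightarrow> \<bar>q - t\<bar> < l / 2 \<and> ychord q t \<in> centre_component q"
proof -
  have "\<gamma> q \<in> fst ` \<alpha>'" by (simp add: fst_alpha')
  then obtain p where p: "p \<in> \<alpha>'" "fst p = \<gamma> q" by force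
  obtain t1 where t1: "\<bar>q - t1\<bar> < l / 2" "p = ychord q t1"
    using phase_cylinder_ychord[OF _ p(2)] p(1) alpha'_subset by blast
  have qt1: "q < t1" using side_alpha'[OF p(1)] side_ychord(2)[OF t1(1)] t1(2) by simp
  define S where "S = {q..t1} \<inter> (\<lambda>t. ychord q t) -` \<alpha>'"
  have near: "\<bar>q - t\<bar> < l / 2" if "t \<in> {q..t1}" for t using that t1(1) by auto
  have "continuous_on {q..t1} (\<lambda>t. ychord q t)"
    by (rule continuous_on_ychord) (use near in \<open>auto intro: continuous_intros\<close>)
  then have "closed S" unfolding S_def
    by (rule continuous_closed_preimage) (auto simp: compact_imp_closed compact_alpha')
  moreover have "{q..t1} \<inter> S = S" by (auto simp: S_def)
  ultimately have "compact S" using compact_Int_closed[OF compact_Icc, of S q t1] by simp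
  moreover have "t1 \<in> S" using p(1) t1(2) qt1 by (auto simp: S_def)
  ultimately obtain b where b: "b \<in> S" "\<And>t. t \<in> S \<Longrightarrow> b \<le> t" using compact_attains_inf[of S] by blast
  have b': "q \<le> b" "b \<le> t1" "ychord q b \<in> \<alpha>'" using b(1) by (auto simp: S_def)
  have nearb: "\<bar>q - b\<bar> < l / 2" using near b' by auto
  have "q < b" using side_alpha'[OF b'(3)] side_ychord(2)[OF nearb] by simp
  have seg: "ychord q t \<in> centre_component q" if t: "q \<le> t" "t < b" for t
  proof -
    define D where "D = ychord q ` {q..t}"
    have n: "\<bar>q - s\<bar> < l / 2" if "s \<in> {q..t}" for s using that t b'(2) near by auto
    have "connected D" unfolding D_def
      by (intro connected_continuous_image continuous_on_ychord) (use n in \<open>auto intro: continuous_intros\<close>)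
    moreover have "D \<subseteq> \<A> - (\<alpha> \<union> \<alpha>')"
    proof
      fix x assume "x \<in> D"
      then obtain s where s: "s \<in> {q..t}" "x = ychord q s" by (auto simp: D_def)
      have "x \<notin> \<alpha>'" using b(2)[of s] s t b'(2) by (auto simp: S_def)
      moreover have "x \<notin> \<alpha>" using side_alpha[of x] side_ychord(1)[OF n[OF s(1)]] s by auto
      moreover have "x \<in> \<A>" using ychord_in_phase_cylinder[OF n[OF s(1)]] s(2) by simp
      ultimately show "x \<in> \<A> - (\<alpha> \<union> \<alpha>')" by blast
    qed
    moreover have "ychord q q \<in> D" "ychord q t \<in> D" using t by (auto simp: D_def)
    ultimately show ?thesis unfolding centre_component_def
      using connected_component_maximal by blast
  qed
  have qC: "ychord q q \<in> centre_component q" using seg[of q] \<open>q < b\<close> by simp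
  obtain V where V: "open V" "centre_component q = \<A> \<inter> V"
    using centre_component(2)[of q] by (auto simp: openin_open)
  define I where "I = {q - l / 2<..<q + l / 2}"
  have nI: "\<bar>q - t\<bar> < l / 2" if "t \<in> I" for t
    using that unfolding I_def greaterThanLessThan_iff by linarith
  have "continuous_on I (\<lambda>t. ychord q t)"
    by (rule continuous_on_ychord) (use nI in \<open>auto intro: continuous_intros\<close>)
  then have "open (I \<inter> (\<lambda>t. ychord q t) -` V)"
    using continuous_open_preimage[of I _ V] V(1) by (auto simp: I_def)
  moreover have "q \<in> I \<inter> (\<lambda>t. ychord q t) -` V" using qC V(2) l_pos by (auto simp: I_def)
  ultimately obtain d where d: "d > 0" "ball q d \<subseteq> I \<inter> (\<lambda>t. ychord q t) -` V"
    using open_contains_ball by metis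
  show thesis
  proof (rule that[of "q - d" b])
    show "q - d < q" "q < b" "ychord q b \<in> \<alpha>'" using d(1) \<open>q < b\<close> b'(3) by auto
    show "b < q + l / 2" using nearb by linarith
    fix t assume t: "q - d < t" "t < b"
    show "\<bar>q - t\<bar> < l / 2 \<and> ychord q t \<in> centre_component q"
    proof (cases "q \<le> t")
      case True
      then show ?thesis using seg t near b'(2) by auto
    next
      case False
      then have "t \<in> ball q d" using t by (simp add: dist_real_def)
      then have "t \<in> I" "ychord q t \<in> V" using d(2) by auto
      then show ?thesis using nI V(2) ychord_in_phase_cylinder by blast
    qed
  qed
qed

text \<open>On the diagonal \<open>G x x\<close> is twice \<open>norm (g x)\<close> and has
  derivative \<open>2 * P x x\<close>, so the extrema of the distance are constant orbits and can
  serve as \<open>q\<close> and \<open>m\<close>.\<close>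

lemma constant_distance:
  assumes max: "region_bounded_by (\<A>) \<alpha> \<alpha>' \<subseteq> m_orbit_set \<gamma>"
  shows "norm (g s) = norm (g t)"
proof (rule ccontr)
  assume ne: "norm (g s) \<noteq> norm (g t)"
  have cont: "continuous_on A (\<lambda>s. norm (g s))" for A
    unfolding g_def by (intro continuous_intros continuous_on_gamma)
  have shift: "norm (g (x + of_int k * (l / 2))) = norm (g x)" for x k
  proof (induction k rule: int_induct[where k = 0])
    case (step1 i)
    then show ?case using g_half[of "x + of_int i * (l / 2)"] by (simp add: algebra_simps add_divide_distrib)
  next
    case (step2 i)
    then show ?case using g_half_minus[of "x + of_int i * (l / 2)"] by (simp add: algebra_simps diff_divide_distrib)
  qed simp
  have reduce: "\<exists>y\<in>{a..<a + l / 2}. norm (g y) = norm (g x)" for a x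
  proof -
    define k where "k = - \<lfloor>(x - a) / (l / 2)\<rfloor>"
    have "of_int \<lfloor>(x - a) / (l / 2)\<rfloor> * (l / 2) \<le> x - a" "x - a < (of_int \<lfloor>(x - a) / (l / 2)\<rfloor> + 1) * (l / 2)"
      using l_pos by (simp_all only: flip: pos_le_divide_eq pos_divide_less_eq) auto
    then have "x + of_int k * (l / 2) \<in> {a..<a + l / 2}" by (auto simp: k_def algebra_simps)
    then show ?thesis using shift by blast
  qed
  obtain q where q0: "q \<in> {0..l / 2}" "\<And>y. y \<in> {0..l / 2} \<Longrightarrow> norm (g q) \<le> norm (g y)"
    using continuous_attains_inf[OF compact_Icc _ cont, of 0 "l / 2"] l_pos by auto
  have q: "norm (g q) \<le> norm (g x)" for x
    using reduce[of 0 x] q0(2) by fastforce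
  obtain m0 where m0: "m0 \<in> {0..l / 2}" "\<And>y. y \<in> {0..l / 2} \<Longrightarrow> norm (g y) \<le> norm (g m0)"
    using continuous_attains_sup[OF compact_Icc _ cont, of 0 "l / 2"] l_pos by auto
  \<comment> \<open>The distance has period \<open>l / 2\<close>, so the maximum can be moved into
    the half period beginning at \<open>q\<close>; it differs from \<open>q\<close> because the
    values differ.\<close>
  obtain m where m: "m \<in> {q..<q + l / 2}" "norm (g m) = norm (g m0)" using reduce by blast
  have mx: "norm (g x) \<le> norm (g m)" for x
    using reduce[of 0 x] m0(2) m(2) by fastforce
  have lt: "norm (g q) < norm (g m)" using q[of s] q[of t] mx[of s] mx[of t] ne by linarith
  have Gxx: "G x x = 2 * norm (g x)" for x
    unfolding G_def mult_2[symmetric] norm_mult by simp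
  have deriv: "((\<lambda>x. G x x) has_real_derivative 2 * P x x) (at x)" for x
    using G_has_real_derivative[OF DERIV_ident DERIV_ident, of x] g_add_nonzero[of x x] l_pos by simp
  have "2 * P q q = 0"
    by (rule DERIV_local_min[OF deriv, of 1]) (use q in \<open>auto simp: Gxx\<close>)
  then have Pq: "P q q = 0" by simp
  have "2 * P m m = 0"
    by (rule DERIV_local_max[OF deriv, of 1]) (use mx in \<open>auto simp: Gxx\<close>)
  then have Pm: "P m m = 0" by simp
  have qm: "q < m" "m < q + l / 2" using m(1) lt by (auto simp: less_le)
  obtain e b where e: "e < q" "q < b" "b < q + l / 2" "ychord q b \<in> \<alpha>'"
    "\<And>t. e < t \<Longrightarrow> t < b \<Longrightarrow> \<bar>q - t\<bar> < l / 2 \<and> ychord q t \<in> centre_component q"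
    using vertical_segment[of q] by blast
  have nb: "\<bar>q - b\<bar> < l / 2" using e(2,3) by simp
  obtain a where a: "orbit a" "a 0 = q" "a 1 = b" "\<And>n. a n < a (Suc n)" "\<And>n. a (n + 4) = a n + l"
    using alpha'_orbit[OF e(4) nb] by blast
  have sm: "strict_mono a" using a(4) by (simp add: strict_mono_Suc_iff)
  show False
  proof (rule no_monotone_family[OF qm Pq Pm _ a(1,2) _ _ e(1)])
    show "G q q < G m m" using lt by (simp add: Gxx)
    show "q < a (Suc n)" for n using strict_monoD[OF sm, of 0 "Suc n"] a(2) by simp
    show "m \<le> a n" if "n \<ge> 4" for n
    proof -
      have "a 4 \<le> a n" using that by (rule monoD[OF strict_mono_mono[OF sm]])
      then show ?thesis using a(5)[of 0] a(2) qm l_pos by simp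
    qed
    fix t assume t: "e < t" "t < a 1"
    then have tt: "\<bar>q - t\<bar> < l / 2" "ychord q t \<in> centre_component q" using e(5) a(3) by auto
    then have "ychord q t \<in> m_orbit_set \<gamma>" using centre_component(1) max by blast
    then show "\<exists>y. orbit y \<and> action_max y \<and> y 0 = q \<and> y 1 = t"
      using m_orbit_set_imp[OF _ tt(1)] by blast
  qed
qed

end

section \<open>The circular table\<close>

lemma cos_le_tangent:
  fixes x y :: real
  assumes "\<bar>x\<bar> \<le> pi / 2" "\<bar>y\<bar> \<le> pi / 2"
  shows "cos x \<le> cos y - sin y * (x - y)"
proof -
  have D: "(cos has_real_derivative - sin z) (at z)" for z :: real by (auto intro!: derivative_eq_intros)
  consider "x < y" | "x = y" | "y < x" by linarith
  then show ?thesis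
  proof cases
    case 1
    then obtain z where z: "x < z" "z < y" "cos y - cos x = (y - x) * - sin z"
      using MVT2[OF 1 D] by blast
    have "sin z \<le> sin y" using z assms by (intro sin_monotone_2pi_le) auto
    then have "(y - x) * sin z \<le> (y - x) * sin y" using 1 by (intro mult_left_mono) auto
    then show ?thesis using z(3) by (simp add: algebra_simps)
  next
    case 3
    then obtain z where z: "y < z" "z < x" "cos x - cos y = (x - y) * - sin z"
      using MVT2[OF 3 D] by blast
    have "sin y \<le> sin z" using z assms by (intro sin_monotone_2pi_le) auto
    then have "(x - y) * sin y \<le> (x - y) * sin z" using 3 by (intro mult_left_mono) auto
    then show ?thesis using z(3) by (simp add: algebra_simps)
  qed simp
qed

lemma sum_telescope_int:
  fixes f :: "int \<Rightarrow> real"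
  assumes "M \<le> N"
  shows "(\<Sum>n=M..N-1. f (n + 1) - f n) = f N - f M"
  using assms
proof (induction N rule: int_ge_induct)
  case (step N)
  have "{M..N + 1 - 1} = insert N {M..N - 1}" using step by auto
  then show ?case using step by simp
qed simp

context symmetric_table begin

text \<open>Here \<open>G a b\<close> is \<open>2 * r * cos ((a - b) / (2 * r))\<close>, concave in
  the increment. Its tangent at the common increment of the orbit bounds every edge from above, and
  the linear terms telescope to zero because the ends are fixed.\<close>

lemma circle_m_orbit:
  assumes circle: "\<And>s. norm (g s) = r"
  shows "\<A> \<subseteq> m_orbit_set \<gamma>"
proof -
  have "\<gamma> 0 \<noteq> \<gamma> (l / 2)" using gamma_neq[of 0 "l / 2"] l_pos by simp
  then have "g 0 \<noteq> g (l / 2)" by (simp add: g_def)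
  then have "g 0 \<noteq> 0" using g_half[of 0] by auto
  then have r: "r > 0" using circle[of 0] by auto
  note g' = g_has_vector_derivative
  \<comment> \<open>Constant norm makes the tangent orthogonal to \<open>g\<close>, and strict
    support at the opposite point fixes its sign. The resulting linear equation has the solutions
    \<open>w * cis (s / r)\<close>.\<close>
  have \<tau>_g: "\<tau> s = (\<i> / of_real r) * g s" for s
  proof -
    have "((\<lambda>s. g s \<bullet> g s) has_vector_derivative (g s \<bullet> \<tau> s + \<tau> s \<bullet> g s)) (at s)"
      by (rule bounded_bilinear.has_vector_derivative[OF bounded_bilinear_inner g' g'])
    moreover have "(\<lambda>s. g s \<bullet> g s) = (\<lambda>s. r\<^sup>2)" using circle by (simp add: dot_square_norm)
    ultimately have "g s \<bullet> \<tau> s + \<tau> s \<bullet> g s = 0"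
      using vector_derivative_unique_at[of "\<lambda>s. r\<^sup>2"] has_vector_derivative_const by metis
    then have orth: "\<tau> s \<bullet> g s = 0" by (simp add: inner_commute)
    define k where "k = cross (\<tau> s) (g s)"
    have gk: "g s = k *\<^sub>R (\<i> * \<tau> s)" using unit_decomposition[OF norm_velocity, of "g s" s] orth by (simp add: k_def)
    have "cross (\<tau> s) (\<gamma> (s + l / 2) - \<gamma> s) > 0"
      by (rule support_pos) (use gamma_neq[of s "s + l / 2"] l_pos in auto)
    then have "k < 0" unfolding gamma_diff_half k_def cross.minus_right cross.add_right by linarith
    moreover have "\<bar>k\<bar> = r" using arg_cong[OF gk, of norm] circle[of s] norm_velocity[of s] by (simp add: norm_mult)
    ultimately have "k = - r" by simp
    then show ?thesis unfolding gk using r by (simp add: complex_eq_iff field_simps)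
  qed
  have "((\<lambda>s. g s * cis (- s / r)) has_vector_derivative 0) (at s)" for s
  proof -
    have cis': "((\<lambda>s. cis (- s / r)) has_vector_derivative (- \<i> / of_real r) * cis (- s / r)) (at s)"
    proof -
      have "((\<lambda>s. exp (of_real s * (- \<i> / of_real r))) has_vector_derivative (- \<i> / of_real r) * exp (of_real s * (- \<i> / of_real r))) (at s)"
        using exp_scaleR_has_vector_derivative_right[of "- \<i> / of_real r" s UNIV]
        by (simp add: scaleR_conv_of_real mult.commute)
      moreover have "exp (of_real s * (- \<i> / of_real r)) = cis (- s / r)" for s
        by (simp add: cis_conv_exp mult.commute)
      ultimately show ?thesis by (simp only:)
    qed
    have "((\<lambda>s. g s * cis (- s / r)) has_vector_derivative
        (g s * ((- \<i> / of_real r) * cis (- s / r)) + \<tau> s * cis (- s / r))) (at s)"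
      by (rule has_vector_derivative_mult[OF g' cis'])
    moreover have "g s * ((- \<i> / of_real r) * cis (- s / r)) + \<tau> s * cis (- s / r) = 0"
      unfolding \<tau>_g by (simp add: algebra_simps)
    ultimately show ?thesis by simp
  qed
  then obtain w where w: "\<And>s. g s * cis (- s / r) = w"
    using has_vector_derivative_zero_constant[of UNIV "\<lambda>s. g s * cis (- s / r)"] by auto
  have g_eq: "g s = w * cis (s / r)" for s
  proof -
    have "cis (- s / r) * cis (s / r) = 1" unfolding cis_mult by simp
    then have "g s * cis (- s / r) * cis (s / r) = g s" by (simp only: mult.assoc mult_1_right)
    then show ?thesis by (simp only: w)
  qed
  have nw: "norm w = r" using circle[of 0] g_eq[of 0] by simp
  have G_eq: "G a b = 2 * r * \<bar>cos ((a - b) / (2 * r))\<bar>" for a b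
  proof -
    define x y where "x = (a + b) / (2 * r)" and "y = (a - b) / (2 * r)"
    have xy: "a / r = x + y" "b / r = x - y" using r by (simp_all add: x_def y_def field_simps)
    have "cis (x + y) + cis (x - y) = of_real (2 * cos y) * cis x"
      by (simp add: complex_eq_iff cos_add sin_add cos_diff sin_diff)
    then have "g a + g b = w * (of_real (2 * cos y) * cis x)" unfolding g_eq xy by (simp flip: distrib_left)
    then show ?thesis unfolding G_def y_def[symmetric] by (simp add: norm_mult nw)
  qed
  \<comment> \<open>No computation of the circumference is required: the formula makes
    \<open>G\<close> vanish at parameter distance \<open>pi * r\<close>, while \<open>G\<close> is
    positive at distances below \<open>l / 2\<close>.\<close>
  have lr: "l / 2 \<le> pi * r"
  proof (rule ccontr)
    assume "\<not> l / 2 \<le> pi * r"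
    then have "G (pi * r) 0 > 0" using r by (intro G_pos) auto
    moreover have "G (pi * r) 0 = 0" unfolding G_eq using r by simp
    ultimately show False by simp
  qed
  have angle: "\<bar>x / (2 * r)\<bar> \<le> pi / 2" if "\<bar>x\<bar> \<le> l / 2" for x
    using that lr r by (simp add: abs_mult field_simps)
  have G_cos: "G a b = 2 * r * cos ((a - b) / (2 * r))" if "\<bar>a - b\<bar> < l / 2" for a b
  proof -
    have "\<bar>(a - b) / (2 * r)\<bar> \<le> pi / 2" by (rule angle) (use that in simp)
    then have "- (pi / 2) \<le> (a - b) / (2 * r)" "(a - b) / (2 * r) \<le> pi / 2" by linarith+
    then have "cos ((a - b) / (2 * r)) \<ge> 0" by (rule cos_ge_zero)
    then show ?thesis unfolding G_eq by (simp only: abs_of_nonneg)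
  qed
  have P_eq: "P a b = sin ((b - a) / (2 * r))" if ab: "\<bar>a - b\<bar> < l / 2" for a b
  proof -
    have 1: "((\<lambda>x. G x b) has_real_derivative P a b) (at a)"
      using G_has_real_derivative[OF DERIV_ident DERIV_const, of a b] g_add_nonzero[OF ab] by simp
    have 2: "((\<lambda>x. 2 * r * cos ((x - b) / (2 * r))) has_real_derivative - sin ((a - b) / (2 * r))) (at a)"
      using r by (auto intro!: derivative_eq_intros)
    have "eventually (\<lambda>x. \<bar>x - b\<bar> < l / 2) (nhds a)"
      by (rule order_tendstoD(2)[OF tendsto_rabs[OF tendsto_diff[OF filterlim_ident tendsto_const]] ab])
    then have ev: "eventually (\<lambda>x. G x b = 2 * r * cos ((x - b) / (2 * r))) (nhds a)"
      by eventually_elim (rule G_cos)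
    have "((\<lambda>x. G x b) has_real_derivative - sin ((a - b) / (2 * r))) (at a)"
      by (rule iffD2[OF DERIV_cong_ev[OF refl ev refl] 2])
    then have "P a b = - sin ((a - b) / (2 * r))" using 1 DERIV_unique by blast
    then show ?thesis by (metis minus_diff_eq minus_divide_left sin_minus)
  qed
  have len: "chord_length \<gamma> u v = G u (v - l / 2)" for u v
  proof -
    have "v - l / 2 + l / 2 = v" by simp
    then have "\<gamma> v - \<gamma> u = - (g u + g (v - l / 2))" using gamma_diff_half[of "v - l / 2" u] by (simp only:)
    then have "norm (\<gamma> v - \<gamma> u) = norm (g u + g (v - l / 2))" by (simp only: norm_minus_cancel)
    then show ?thesis by (simp only: chord_length_def G_def norm_minus_commute[of "\<gamma> u"])
  qed
  show ?thesis
  proof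
    fix p assume p: "p \<in> \<A>"
    then obtain q where "fst p = \<gamma> q" by (rule phase_cylinder_base)
    then obtain t where t: "\<bar>q - t\<bar> < l / 2" "p = ychord q t" using phase_cylinder_ychord[OF p] by blast
    define \<delta> where "\<delta> = t - q"
    define s where "s = (\<lambda>n::int. q + of_int n * \<delta> + of_int n * (l / 2))"
    define O' where "O' = (\<lambda>n::int. ychord (s n) (s n + \<delta>))"
    have s1: "s (n + 1) = s n + \<delta> + l / 2" for n by (simp add: s_def algebra_simps add_divide_distrib)
    have \<delta>: "\<bar>\<delta>\<bar> < l / 2" using t(1) unfolding \<delta>_def by linarith
    have step: "T (O' n) = O' (n + 1)" for n
    proof -
      have n1: "\<bar>s n - (s n + \<delta>)\<bar> < l / 2" "\<bar>(s n + \<delta>) - s n\<bar> < l / 2" using \<delta> by auto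
      have n2: "\<bar>(s n + \<delta>) - (s n + \<delta> + \<delta>)\<bar> < l / 2" using \<delta> by simp
      have "P (s n + \<delta>) (s n) + P (s n + \<delta>) (s n + \<delta> + \<delta>) = 0"
        unfolding P_eq[OF n1(2)] P_eq[OF n2] by simp
      then have "T (O' n) = ychord (s n + \<delta> + l / 2) (s n + \<delta> + \<delta> + l / 2)"
        using billiard_map_ychord_eq_iff[OF n1(1) n2] by (simp add: O'_def)
      moreover have "s n + \<delta> + \<delta> + l / 2 = s (n + 1) + \<delta>" by (simp add: s1)
      ultimately show ?thesis by (simp only: O'_def s1)
    qed
    have orb: "billiard_orbit \<gamma> O'"
      unfolding billiard_orbit_def using step ychord_in_phase_cylinder \<delta> by (simp add: O'_def)
    have "locally_maximizing \<gamma> s"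
      unfolding locally_maximizing_def
    proof (intro allI impI)
      fix M N :: int assume MN: "M < N"
      let ?L = "\<lambda>r. \<Sum>n=M..N-1. chord_length \<gamma> (r n) (r (n + 1))"
      \<comment> \<open>Two displacements of this size cannot push an increment out of the range
        where \<open>G\<close> is given by the cosine.\<close>
      define \<epsilon> where "\<epsilon> = (l / 2 - \<bar>\<delta>\<bar>) / 2"
      have "\<epsilon> > 0" using \<delta> by (simp add: \<epsilon>_def)
      moreover have "?L \<rho> \<le> ?L s"
        if \<rho>: "\<rho> M = s M" "\<rho> N = s N" "\<forall>n\<in>{M..N}. \<bar>\<rho> n - s n\<bar> < \<epsilon>" for \<rho>
      proof -
        define f where "f = (\<lambda>n. \<rho> n - s n)"
        define k where "k = sin (\<delta> / (2 * r))"
        have le: "chord_length \<gamma> (\<rho> n) (\<rho> (n + 1)) \<le> chord_length \<gamma> (s n) (s (n + 1)) - k * (f (n + 1) - f n)"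
          if n: "n \<in> {M..N-1}" for n
        proof -
          define x where "x = \<delta> + (f (n + 1) - f n)"
          have fn: "\<bar>f n\<bar> < \<epsilon>" "\<bar>f (n + 1)\<bar> < \<epsilon>" using \<rho>(3) n unfolding f_def by auto
          have "\<bar>x\<bar> \<le> \<bar>\<delta>\<bar> + \<bar>f (n + 1) - f n\<bar>" unfolding x_def by (rule abs_triangle_ineq)
          also have "\<dots> \<le> \<bar>\<delta>\<bar> + (\<bar>f (n + 1)\<bar> + \<bar>f n\<bar>)" by (rule add_left_mono[OF abs_triangle_ineq4])
          also have "\<dots> < \<bar>\<delta>\<bar> + (\<epsilon> + \<epsilon>)" by (rule add_strict_left_mono[OF add_strict_mono[OF fn(2,1)]])
          also have "\<dots> = l / 2" by (simp add: \<epsilon>_def)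
          finally have x: "\<bar>x\<bar> < l / 2" .
          have \<rho>x: "\<rho> n - (\<rho> (n + 1) - l / 2) = - x" using s1[of n] by (simp add: x_def f_def)
          have ss: "s n - (s (n + 1) - l / 2) = - \<delta>" using s1[of n] by simp
          have 1: "chord_length \<gamma> (\<rho> n) (\<rho> (n + 1)) = 2 * r * cos (x / (2 * r))"
            using G_cos[of "\<rho> n" "\<rho> (n + 1) - l / 2"] x unfolding len \<rho>x by simp
          have 2: "chord_length \<gamma> (s n) (s (n + 1)) = 2 * r * cos (\<delta> / (2 * r))"
            using G_cos[of "s n" "s (n + 1) - l / 2"] \<delta> unfolding len ss by simp
          have "cos (x / (2 * r)) \<le> cos (\<delta> / (2 * r)) - k * (x / (2 * r) - \<delta> / (2 * r))"
            unfolding k_def by (rule cos_le_tangent; rule angle) (use x \<delta> in auto)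
          then have "2 * r * cos (x / (2 * r)) \<le> 2 * r * (cos (\<delta> / (2 * r)) - k * (x / (2 * r) - \<delta> / (2 * r)))"
            using r by (intro mult_left_mono) auto
          also have "\<dots> = 2 * r * cos (\<delta> / (2 * r)) - k * (f (n + 1) - f n)"
            using r by (simp add: x_def field_simps)
          finally show ?thesis unfolding 1 2 .
        qed
        have "?L \<rho> \<le>
          (\<Sum>n=M..N-1. chord_length \<gamma> (s n) (s (n + 1)) - k * (f (n + 1) - f n))"
          by (rule sum_mono[OF le])
        also have "\<dots> = ?L s - k * (\<Sum>n=M..N-1. f (n + 1) - f n)"
          by (subst sum_subtractf) (simp only: sum_distrib_left)
        also have "(\<Sum>n=M..N-1. f (n + 1) - f n) = 0"
          using sum_telescope_int[of M N f] MN \<rho>(1,2) by (simp add: f_def)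
        finally show ?thesis by simp
      qed
      ultimately show "\<exists>\<epsilon>>0. \<forall>r. r M = s M \<and> r N = s N \<and> (\<forall>n\<in>{M..N}. \<bar>r n - s n\<bar> < \<epsilon>) \<longrightarrow>
        ?L r \<le> ?L s"
        by (intro exI[of _ \<epsilon>]) blast
    qed
    moreover have "\<gamma> (s n) = fst (O' n)" for n by (simp add: O'_def ychord_altdef)
    ultimately have "m_orbit \<gamma> O'" using orb unfolding m_orbit_def by blast
    moreover have "p = O' 0" using t(2) by (simp add: O'_def s_def \<delta>_def)
    ultimately show "p \<in> m_orbit_set \<gamma>" unfolding m_orbit_set_def by blast
  qed
qed

end

lemma region_bounded_by_subset: "region_bounded_by X \<alpha> \<beta> \<subseteq> X"
  using closure_of_subset_topspace by (fastforce simp: region_bounded_by_def)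

theorem corollary1p2:
  fixes \<gamma> :: "real \<Rightarrow> complex" and l :: real
    and \<alpha> \<alpha>' \<B> \<M>\<^sub>B :: "oriented_line set"
  assumes "convex_billiard_table \<gamma> l"
    and "centrally_symmetric (range \<gamma>)"
    and "invariant_curve \<gamma> \<alpha>"
    and "curve_has_rotation_number \<gamma> l \<alpha> (1/4)"
    and "\<forall>p\<in>\<alpha>. (billiard_map \<gamma> ^^ 4) p = p"
    and "\<alpha>' = reverse_line \<gamma> ` \<alpha>"
    and "\<B> = region_bounded_by (phase_cylinder \<gamma>) \<alpha> \<alpha>'"
    and "\<M>\<^sub>B = m_orbit_set \<gamma> \<inter> \<B>"
  shows "\<M>\<^sub>B = \<B> \<longleftrightarrow> is_circle (range \<gamma>)"
proof
  interpret convex_table \<gamma> l by unfold_locales (rule assms(1))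
  assume "\<M>\<^sub>B = \<B>"
  then have sub: "region_bounded_by (phase_cylinder \<gamma>) \<alpha> (reverse_line \<gamma> ` \<alpha>) \<subseteq> m_orbit_set \<gamma>"
    using assms(6-8) by blast
  obtain c where "(\<lambda>p. 2 * c - p) ` range \<gamma> = range \<gamma>"
    using assms(2) unfolding centrally_symmetric_def by blast
  then interpret quarter_table \<gamma> l c \<alpha>
    by unfold_locales (use half_period assms(3-5) in auto)
  show "is_circle (range \<gamma>)"
    by (rule circle_of_constant_distance[of "norm (g 0)"], rule constant_distance[OF sub[folded \<alpha>'_def]])
next
  interpret convex_table \<gamma> l by unfold_locales (rule assms(1))
  assume "is_circle (range \<gamma>)"
  then obtain c r where c: "range \<gamma> = sphere c r" unfolding is_circle_def by blast
  \<comment> \<open>The centre of symmetry is taken to be the centre of the circle, so that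
    \<open>norm (g s)\<close> is the radius.\<close>
  have "(\<lambda>p. 2 * c - p) ` sphere c r = sphere c r"
  proof
    have *: "2 * c - p \<in> sphere c r" if "p \<in> sphere c r" for p
      using that by (simp add: dist_norm norm_minus_commute)
    then show "(\<lambda>p. 2 * c - p) ` sphere c r \<subseteq> sphere c r" by blast
    show "sphere c r \<subseteq> (\<lambda>p. 2 * c - p) ` sphere c r"
    proof
      fix p assume "p \<in> sphere c r"
      then show "p \<in> (\<lambda>p. 2 * c - p) ` sphere c r"
        using * by (intro image_eqI[of _ _ "2 * c - p"]) auto
    qed
  qed
  then interpret symmetric_table \<gamma> l c
    by unfold_locales (rule half_period, simp add: c)
  have "norm (g s) = r" for s
    using rangeI[of \<gamma> s] unfolding c by (simp add: g_def dist_norm norm_minus_commute)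
  then have "phase_cylinder \<gamma> \<subseteq> m_orbit_set \<gamma>" by (rule circle_m_orbit)
  then show "\<M>\<^sub>B = \<B>"
    using region_bounded_by_subset[of "phase_cylinder \<gamma>" \<alpha> \<alpha>'] assms(7,8) by blast
qed

end
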